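(* Let $\Lambda$ be an artinian ring with Jacobson radical $J$. Whenever $T$ is a right $\Lambda$-module such that $\Lambda/J$, viewed as a right $\Lambda$-module, embeds into $T$, one has $$\operatorname{l\,Fin\,dim}\Lambda\le \operatorname{rep}(T).$$
   Context: $\Lambda$ is an artinian ring (left and right artinian, with $1$), so every module has a projective cover. $\operatorname{l\,Fin\,dim}\Lambda$ is the left big finitistic dimension: the supremum of the finite projective dimensions attained on arbitrary left $\Lambda$-modules. For a module $M$, $\Omega^0(M)=M$, $\Omega^1(M)$ is the kernel of a projective cover of $M$, and $\Omega^{j+1}(M)=\Omega^1(\Omega^j(M))$. Repetition index: the minimal projective resolution of $M$ is repetitive at degree $n\ge 0$ if there is a decomposition $\Omega^n(M)= P\oplus\bigoplus_{i\in I}A_i$ with $P$ projective such that each $A_i$ occurs (up to isomorphism) as a direct summand of $\Omega^j(M)$ for infinitely many $j$. $\operatorname{rep}(M)$ is the least nonnegative integer $k$ such that the minimal projective resolution of $M$ is repetitive at degree $k$, or $\infty$ if there is no such $k$. (The same definition is used for right modules.) *)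

theory Defs
  imports "HOL-Algebra.Module" "HOL-Algebra.AbelCoset" "HOL-Library.Extended_Nat"
begin

text \<open>
  The locale \<open>module\<close> of \<open>HOL-Algebra\<close> demands a commutative ring of scalars, so modules over
  an arbitrary ring with unit are introduced here, on the same record type.  The fields \<open>mult\<close>
  and \<open>one\<close> of a module record are ignored throughout.
\<close>

locale left_module = R?: ring R + M?: abelian_group M
  for R :: "('r, 'x) ring_scheme" (structure) and M :: "('r, 'm, 'y) module_scheme" (structure) +
  assumes smult_closed [simp, intro]:
      "\<lbrakk>a \<in> carrier R; x \<in> carrier M\<rbrakk> \<Longrightarrow> a \<odot>\<^bsub>M\<^esub> x \<in> carrier M"
    and smult_l_distr:
      "\<lbrakk>a \<in> carrier R; b \<in> carrier R; x \<in> carrier M\<rbrakk> \<Longrightarrow>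
      (a \<oplus> b) \<odot>\<^bsub>M\<^esub> x = a \<odot>\<^bsub>M\<^esub> x \<oplus>\<^bsub>M\<^esub> b \<odot>\<^bsub>M\<^esub> x"
    and smult_r_distr:
      "\<lbrakk>a \<in> carrier R; x \<in> carrier M; y \<in> carrier M\<rbrakk> \<Longrightarrow>
      a \<odot>\<^bsub>M\<^esub> (x \<oplus>\<^bsub>M\<^esub> y) = a \<odot>\<^bsub>M\<^esub> x \<oplus>\<^bsub>M\<^esub> a \<odot>\<^bsub>M\<^esub> y"
    and smult_assoc1:
      "\<lbrakk>a \<in> carrier R; b \<in> carrier R; x \<in> carrier M\<rbrakk> \<Longrightarrow>
      (a \<otimes> b) \<odot>\<^bsub>M\<^esub> x = a \<odot>\<^bsub>M\<^esub> (b \<odot>\<^bsub>M\<^esub> x)"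
    and smult_one [simp]:
      "x \<in> carrier M \<Longrightarrow> \<one> \<odot>\<^bsub>M\<^esub> x = x"

definition opposite :: "('r, 'x) ring_scheme \<Rightarrow> ('r, 'x) ring_scheme" where
  "opposite R = R\<lparr>mult := (\<lambda>a b. b \<otimes>\<^bsub>R\<^esub> a)\<rparr>"

text \<open>
  In a right module the term \<open>a \<odot> x\<close> stands for the product of \<open>x\<close> by \<open>a\<close> from the right;
  all notions for right modules are those for left modules over the opposite ring.
\<close>

abbreviation right_module :: "('r, 'x) ring_scheme \<Rightarrow> ('r, 'm) module \<Rightarrow> bool" where
  "right_module R M \<equiv> left_module (opposite R) M"

definition regular_module :: "('r, 'x) ring_scheme \<Rightarrow> ('r, 'r) module" where
  "regular_module R = \<lparr>carrier = carrier R, mult = mult R, one = one R, zero = zero R,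
     add = add R, smult = mult R\<rparr>"

definition sub_mod :: "('r, 'm) module \<Rightarrow> 'm set \<Rightarrow> ('r, 'm) module" where
  "sub_mod M N = M\<lparr>carrier := N\<rparr>"

definition quotient_module :: "('r, 'm) module \<Rightarrow> 'm set \<Rightarrow> ('r, 'm set) module" where
  "quotient_module M N = \<lparr>carrier = a_rcosets\<^bsub>M\<^esub> N, mult = undefined, one = undefined, zero = N,
     add = set_add M, smult = (\<lambda>a X. \<Union>x\<in>X. N +>\<^bsub>M\<^esub> (a \<odot>\<^bsub>M\<^esub> x))\<rparr>"

definition module_hom ::
    "('r, 'x) ring_scheme \<Rightarrow> ('r, 'm) module \<Rightarrow> ('r, 'n) module \<Rightarrow> ('m \<Rightarrow> 'n) set" where
  "module_hom R M N = {f. f \<in> carrier M \<rightarrow> carrier N \<and>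
     (\<forall>x\<in>carrier M. \<forall>y\<in>carrier M. f (x \<oplus>\<^bsub>M\<^esub> y) = f x \<oplus>\<^bsub>N\<^esub> f y) \<and>
     (\<forall>a\<in>carrier R. \<forall>x\<in>carrier M. f (a \<odot>\<^bsub>M\<^esub> x) = a \<odot>\<^bsub>N\<^esub> f x)}"

definition module_iso ::
    "('r, 'x) ring_scheme \<Rightarrow> ('r, 'm) module \<Rightarrow> ('r, 'n) module \<Rightarrow> bool" where
  "module_iso R M N \<longleftrightarrow> (\<exists>f\<in>module_hom R M N. bij_betw f (carrier M) (carrier N))"

definition embeds ::
    "('r, 'x) ring_scheme \<Rightarrow> ('r, 'm) module \<Rightarrow> ('r, 'n) module \<Rightarrow> bool" where
  "embeds R M N \<longleftrightarrow> (\<exists>f\<in>module_hom R M N. inj_on f (carrier M))"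

definition artinian_module :: "('r, 'x) ring_scheme \<Rightarrow> ('r, 'm) module \<Rightarrow> bool" where
  "artinian_module R M \<longleftrightarrow> left_module R M \<and>
     (\<forall>F :: nat \<Rightarrow> 'm set. (\<forall>n. submodule (F n) R M) \<and> decseq F \<longrightarrow> (\<exists>k. \<forall>n\<ge>k. F n = F k))"

definition artinian_ring :: "('r, 'x) ring_scheme \<Rightarrow> bool" where
  "artinian_ring R \<longleftrightarrow> ring R \<and> artinian_module R (regular_module R) \<and>
     artinian_module (opposite R) (regular_module (opposite R))"

definition maximal_left_ideal :: "'r set \<Rightarrow> ('r, 'x) ring_scheme \<Rightarrow> bool" where
  "maximal_left_ideal I R \<longleftrightarrow> submodule I R (regular_module R) \<and> I \<noteq> carrier R \<and>
     (\<forall>K. submodule K R (regular_module R) \<and> I \<subseteq> K \<longrightarrow> K = I \<or> K = carrier R)"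

definition jacobson_radical :: "('r, 'x) ring_scheme \<Rightarrow> 'r set" where
  "jacobson_radical R = carrier R \<inter> \<Inter>{I. maximal_left_ideal I R}"

text \<open>
  The lifting property is required only for epimorphisms \<open>g\<close> from modules \<open>N\<close> on the type
  \<open>'p \<Rightarrow> 'r\<close> onto modules \<open>L\<close> on the type \<open>'p\<close>.  This is no restriction: that type
  contains the free module on \<open>carrier P\<close> (finitely supported functions), so already the case
  of the canonical map onto \<open>L = P\<close> makes \<open>P\<close> a direct summand of a free module, and hence
  gives the lifting property for modules on arbitrary types.
\<close>

definition projective :: "('r, 'x) ring_scheme \<Rightarrow> ('r, 'p) module \<Rightarrow> bool" where
  "projective R P \<longleftrightarrow> left_module R P \<and>
     (\<forall>(N :: ('r, 'p \<Rightarrow> 'r) module) (L :: ('r, 'p) module) g f.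
        left_module R N \<and> left_module R L \<and>
        g \<in> module_hom R N L \<and> g ` carrier N = carrier L \<and> f \<in> module_hom R P L \<longrightarrow>
        (\<exists>h\<in>module_hom R P N. \<forall>x\<in>carrier P. g (h x) = f x))"

definition superfluous :: "('r, 'x) ring_scheme \<Rightarrow> ('r, 'm) module \<Rightarrow> 'm set \<Rightarrow> bool" where
  "superfluous R M K \<longleftrightarrow> submodule K R M \<and>
     (\<forall>N. submodule N R M \<and> N <+>\<^bsub>M\<^esub> K = carrier M \<longrightarrow> N = carrier M)"

definition projective_cover ::
    "('r, 'x) ring_scheme \<Rightarrow> ('r, 'p) module \<Rightarrow> ('p \<Rightarrow> 'm) \<Rightarrow> ('r, 'm) module \<Rightarrow> bool" where
  "projective_cover R P f M \<longleftrightarrow> projective R P \<and> left_module R M \<and>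
     f \<in> module_hom R P M \<and> f ` carrier P = carrier M \<and> superfluous R P (a_kernel P M f)"

text \<open>
  Resolutions of a module on the type \<open>'m\<close> are formed from modules on the following type.  It is
  infinite and at least as large as \<open>'r\<close> and \<open>'m\<close>, so a free module on any of its subsets
  embeds into it as a set; therefore, up to isomorphism, it accommodates free resolutions of the
  module as well as all iterated projective covers (whenever these exist).
\<close>

type_synonym ('r, 'm) res = "('r \<times> 'm) list"

definition projective_resolution ::
    "('r, 'x) ring_scheme \<Rightarrow> ('r, 'm) module \<Rightarrow> (nat \<Rightarrow> ('r, 'p) module) \<Rightarrow>
       (nat \<Rightarrow> 'p \<Rightarrow> 'p) \<Rightarrow> ('p \<Rightarrow> 'm) \<Rightarrow> bool" where
  "projective_resolution R M P d e \<longleftrightarrow>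
     (\<forall>i. projective R (P i)) \<and>
     e \<in> module_hom R (P 0) M \<and> e ` carrier (P 0) = carrier M \<and>
     (\<forall>i. d i \<in> module_hom R (P (Suc i)) (P i)) \<and>
     d 0 ` carrier (P 1) = a_kernel (P 0) M e \<and>
     (\<forall>i. d (Suc i) ` carrier (P (Suc (Suc i))) = a_kernel (P (Suc i)) (P i) (d i))"

definition proj_dim :: "('r, 'x) ring_scheme \<Rightarrow> ('r, 'm) module \<Rightarrow> enat" where
  "proj_dim R M = Inf {enat n | n.
     \<exists>(P :: nat \<Rightarrow> ('r, ('r, 'm) res) module) d e.
       projective_resolution R M P d e \<and> (\<forall>i>n. carrier (P i) = {\<zero>\<^bsub>P i\<^esub>})}"

text \<open>
  A supremum over all modules has to be taken over the modules on a fixed type \<open>'m\<close>; statements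
  about it are to be made for an arbitrary \<open>'m\<close>.
\<close>

definition l_Fin_dim :: "'m itself \<Rightarrow> ('r, 'x) ring_scheme \<Rightarrow> enat" where
  "l_Fin_dim (_ :: 'm itself) R =
     Sup {proj_dim R M | M :: ('r, 'm) module. left_module R M \<and> proj_dim R M \<noteq> \<infinity>}"

text \<open>\<open>syzygy R M n K\<close>: the module \<open>K\<close> is a copy of the \<open>n\<close>-th syzygy of \<open>M\<close>.\<close>

inductive syzygy ::
    "('r, 'x) ring_scheme \<Rightarrow> ('r, 'm) module \<Rightarrow> nat \<Rightarrow> ('r, ('r, 'm) res) module \<Rightarrow> bool"
  for R :: "('r, 'x) ring_scheme" and M :: "('r, 'm) module" where
  zero: "left_module R K \<Longrightarrow> module_iso R K M \<Longrightarrow> syzygy R M 0 K"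
| Suc: "syzygy R M n L \<Longrightarrow> projective_cover R P f L \<Longrightarrow>
        syzygy R M (Suc n) (sub_mod P (a_kernel P L f))"

definition internal_direct_sum ::
    "('r, 'x) ring_scheme \<Rightarrow> ('r, 'm) module \<Rightarrow> 'i set \<Rightarrow> ('i \<Rightarrow> 'm set) \<Rightarrow> bool" where
  "internal_direct_sum R M I A \<longleftrightarrow> (\<forall>i\<in>I. submodule (A i) R M) \<and>
     (\<forall>x\<in>carrier M. \<exists>!a. a \<in> (\<Pi>\<^sub>E i\<in>I. A i) \<and> finite {i\<in>I. a i \<noteq> \<zero>\<^bsub>M\<^esub>} \<and>
        x = finsum M a {i\<in>I. a i \<noteq> \<zero>\<^bsub>M\<^esub>})"

definition iso_to_direct_summand ::
    "('r, 'x) ring_scheme \<Rightarrow> ('r, 'n) module \<Rightarrow> ('r, 'm) module \<Rightarrow> bool" where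
  "iso_to_direct_summand R A M \<longleftrightarrow> (\<exists>B C. submodule B R M \<and> submodule C R M \<and>
     B <+>\<^bsub>M\<^esub> C = carrier M \<and> B \<inter> C = {\<zero>\<^bsub>M\<^esub>} \<and> module_iso R A (sub_mod M B))"

text \<open>
  The decomposition is an internal one, with index \<open>None\<close> for the projective summand.  The nonzero
  summands \<open>A i\<close> are indexed injectively by nonzero elements of \<open>K\<close>, so it suffices to admit
  sets of elements of the type of \<open>K\<close> as index sets \<open>I\<close>.
\<close>

definition repetitive_at :: "('r, 'x) ring_scheme \<Rightarrow> ('r, 'm) module \<Rightarrow> nat \<Rightarrow> bool" where
  "repetitive_at R M n \<longleftrightarrow>
     (\<exists>(K :: ('r, ('r, 'm) res) module) Q (I :: ('r, 'm) res set) A.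
        syzygy R M n K \<and>
        internal_direct_sum R K (insert None (Some ` I)) (case_option Q A) \<and>
        projective R (sub_mod K Q) \<and>
        (\<forall>i\<in>I. infinite {j. \<exists>L. syzygy R M j L \<and> iso_to_direct_summand R (sub_mod K (A i)) L}))"

definition rep_index :: "('r, 'x) ring_scheme \<Rightarrow> ('r, 'm) module \<Rightarrow> enat" where
  "rep_index R M = Inf {enat n | n. repetitive_at R M n}"

end

theory Submission
  imports Defs
begin

text \<open>
  Let \<open>M\<close> be a left module of finite projective dimension \<open>m\<close>, and suppose that the minimal resolution
  of \<open>T\<close> is repetitive at a degree \<open>n < m\<close>.  Since \<open>\<Lambda> / J\<close> embeds into \<open>T\<close> and \<open>Tor\<^sub>m\<^sub>+\<^sub>1(-, M) = 0\<close>,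
  the group \<open>Tor\<^sub>m(\<Lambda> / J, M)\<close>, which is nonzero, embeds into \<open>Tor\<^sub>m(T, M) = Tor\<^sub>m\<^sub>-\<^sub>n(\<Omega>\<^sup>n T, M)\<close>.
  The projective summand of \<open>\<Omega>\<^sup>n T\<close> contributes nothing to this group, so one of the summands \<open>A\<close> that
  recur in infinitely many syzygies has \<open>Tor\<^sub>m\<^sub>-\<^sub>n(A, M) \<noteq> 0\<close>.  For large \<open>j\<close> with \<open>A\<close> a summand of
  \<open>\<Omega>\<^sup>j T\<close> it follows that \<open>Tor\<^sub>m\<^sub>-\<^sub>n\<^sub>+\<^sub>j(T, M) \<noteq> 0\<close>, in a degree above \<open>m\<close>; a contradiction.

  The \<open>Tor\<close> groups enter only through their vanishing, that is, through the exactness of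
  \<open>X \<otimes> P\<close> for a finite projective resolution \<open>P\<close> of \<open>M\<close> (\<open>tor_vanishes\<close>).  Elements of \<open>X \<otimes> P\<close>
  are represented by lists of pairs and compared by means of the linear forms on \<open>P\<close>, which separate
  them because \<open>P\<close> has a dual basis.  The needed properties are dimension shifting
  (\<open>tor_shift_up\<close>, \<open>tor_shift_down\<close>, \<open>tor_vanishes_projective\<close>) and the behaviour under direct sums
  (\<open>tor_vanishes_direct_sum\<close>, \<open>tor_vanishes_summand\<close>).

  That \<open>Tor\<^sub>m(\<Lambda> / J, M)\<close> is not zero is used in the form: if the last differential
  \<open>d : P\<^sub>m \<rightarrow> P\<^sub>m\<^sub>-\<^sub>1\<close> is injective modulo \<open>J\<close>, then its image \<open>K\<close> is a direct summand, so the resolution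
  can be shortened (\<open>projective_resolution_truncate\<close>).  Since every submodule of a module
  killed by \<open>J\<close> is a summand, there is a retraction of \<open>P\<^sub>m\<^sub>-\<^sub>1\<close> onto \<open>K\<close> modulo \<open>J\<close>; it lifts to a map \<open>r\<close>
  from \<open>P\<^sub>m\<^sub>-\<^sub>1\<close> to \<open>K\<close>, and \<open>r\<close> is bijective on \<open>K\<close> because \<open>1 - r\<close> is nilpotent there (\<open>complement_if_radical_compatible\<close>).
\<close>

section \<open>Modules over a ring that need not be commutative\<close>

lemma left_module_ring: "left_module R M \<Longrightarrow> ring R"
  by (simp add: left_module_def)

lemma opposite_simps [simp]:
  "carrier (opposite R) = carrier R" "zero (opposite R) = zero R" "one (opposite R) = one R"
  "add (opposite R) = add R" "mult (opposite R) a b = b \<otimes>\<^bsub>R\<^esub> a"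
  by (simp_all add: opposite_def)

lemma sub_mod_simps [simp]:
  "carrier (sub_mod M N) = N" "zero (sub_mod M N) = zero M"
  "add (sub_mod M N) = add M" "smult (sub_mod M N) = smult M"
  by (simp_all add: sub_mod_def)

lemma regular_module_simps [simp]:
  "carrier (regular_module R) = carrier R" "zero (regular_module R) = zero R"
  "add (regular_module R) = add R" "smult (regular_module R) = mult R"
  by (simp_all add: regular_module_def)

lemma ring_opposite:
  assumes "ring R"
  shows "ring (opposite R)"
proof -
  interpret ring R by fact
  have "add_monoid (opposite R) = add_monoid R"
    by simp
  then have "abelian_group (opposite R)"
    using is_abelian_group by (simp add: abelian_group_def abelian_monoid_def abelian_group_axioms_def)
  then show ?thesis
    by (intro ringI monoidI) (simp_all add: m_assoc l_distr r_distr)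
qed

lemma left_moduleI:
  assumes "ring R" and zero: "zero M \<in> carrier M"
    and add: "\<And>x y. \<lbrakk>x \<in> carrier M; y \<in> carrier M\<rbrakk> \<Longrightarrow> x \<oplus>\<^bsub>M\<^esub> y \<in> carrier M"
    and smult: "\<And>a x. \<lbrakk>a \<in> carrier R; x \<in> carrier M\<rbrakk> \<Longrightarrow> a \<odot>\<^bsub>M\<^esub> x \<in> carrier M"
    and assoc: "\<And>x y z. \<lbrakk>x \<in> carrier M; y \<in> carrier M; z \<in> carrier M\<rbrakk> \<Longrightarrow>
      (x \<oplus>\<^bsub>M\<^esub> y) \<oplus>\<^bsub>M\<^esub> z = x \<oplus>\<^bsub>M\<^esub> (y \<oplus>\<^bsub>M\<^esub> z)"
    and comm: "\<And>x y. \<lbrakk>x \<in> carrier M; y \<in> carrier M\<rbrakk> \<Longrightarrow> x \<oplus>\<^bsub>M\<^esub> y = y \<oplus>\<^bsub>M\<^esub> x"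
    and zero_add: "\<And>x. x \<in> carrier M \<Longrightarrow> zero M \<oplus>\<^bsub>M\<^esub> x = x"
    and zero_smult: "\<And>x. x \<in> carrier M \<Longrightarrow> zero R \<odot>\<^bsub>M\<^esub> x = zero M"
    and l_distr: "\<And>a b x. \<lbrakk>a \<in> carrier R; b \<in> carrier R; x \<in> carrier M\<rbrakk> \<Longrightarrow>
      (a \<oplus>\<^bsub>R\<^esub> b) \<odot>\<^bsub>M\<^esub> x = a \<odot>\<^bsub>M\<^esub> x \<oplus>\<^bsub>M\<^esub> b \<odot>\<^bsub>M\<^esub> x"
    and r_distr: "\<And>a x y. \<lbrakk>a \<in> carrier R; x \<in> carrier M; y \<in> carrier M\<rbrakk> \<Longrightarrow>
      a \<odot>\<^bsub>M\<^esub> (x \<oplus>\<^bsub>M\<^esub> y) = a \<odot>\<^bsub>M\<^esub> x \<oplus>\<^bsub>M\<^esub> a \<odot>\<^bsub>M\<^esub> y"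
    and assoc1: "\<And>a b x. \<lbrakk>a \<in> carrier R; b \<in> carrier R; x \<in> carrier M\<rbrakk> \<Longrightarrow>
      (a \<otimes>\<^bsub>R\<^esub> b) \<odot>\<^bsub>M\<^esub> x = a \<odot>\<^bsub>M\<^esub> (b \<odot>\<^bsub>M\<^esub> x)"
    and one: "\<And>x. x \<in> carrier M \<Longrightarrow> one R \<odot>\<^bsub>M\<^esub> x = x"
  shows "left_module R M"
proof -
  interpret ring R by fact
  have neg: "(\<ominus>\<^bsub>R\<^esub> \<one>\<^bsub>R\<^esub>) \<odot>\<^bsub>M\<^esub> x \<oplus>\<^bsub>M\<^esub> x = zero M" if "x \<in> carrier M" for x
    using assms(9)[of "\<ominus>\<^bsub>R\<^esub> \<one>\<^bsub>R\<^esub>" "\<one>\<^bsub>R\<^esub>" x] zero_smult[OF that] one[OF that] that by (simp add: l_neg)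
  have "abelian_group M"
  proof (rule abelian_groupI)
    fix x assume x: "x \<in> carrier M"
    show "\<exists>y\<in>carrier M. y \<oplus>\<^bsub>M\<^esub> x = \<zero>\<^bsub>M\<^esub>"
      using neg[OF x] smult[of "\<ominus>\<^bsub>R\<^esub> \<one>\<^bsub>R\<^esub>" x] x by auto
  qed (fact zero add assoc comm zero_add)+
  then show ?thesis
    using assms by (auto intro!: left_module.intro left_module_axioms.intro)
qed

context left_module
begin

lemma smult_zero_left [simp]: "x \<in> carrier M \<Longrightarrow> \<zero>\<^bsub>R\<^esub> \<odot>\<^bsub>M\<^esub> x = \<zero>\<^bsub>M\<^esub>"
  using smult_l_distr[of "\<zero>\<^bsub>R\<^esub>" "\<zero>\<^bsub>R\<^esub>" x] M.add.l_cancel_one'[of "\<zero>\<^bsub>R\<^esub> \<odot>\<^bsub>M\<^esub> x" "\<zero>\<^bsub>R\<^esub> \<odot>\<^bsub>M\<^esub> x"] by simp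

lemma smult_zero_right [simp]: "a \<in> carrier R \<Longrightarrow> a \<odot>\<^bsub>M\<^esub> \<zero>\<^bsub>M\<^esub> = \<zero>\<^bsub>M\<^esub>"
  using smult_r_distr[of a "\<zero>\<^bsub>M\<^esub>" "\<zero>\<^bsub>M\<^esub>"] M.add.l_cancel_one'[of "a \<odot>\<^bsub>M\<^esub> \<zero>\<^bsub>M\<^esub>" "a \<odot>\<^bsub>M\<^esub> \<zero>\<^bsub>M\<^esub>"] by simp

lemma smult_minus_one: "x \<in> carrier M \<Longrightarrow> (\<ominus>\<^bsub>R\<^esub> \<one>\<^bsub>R\<^esub>) \<odot>\<^bsub>M\<^esub> x = \<ominus>\<^bsub>M\<^esub> x"
  using smult_l_distr[of "\<ominus>\<^bsub>R\<^esub> \<one>\<^bsub>R\<^esub>" "\<one>\<^bsub>R\<^esub>" x]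
  by (intro M.minus_equality[symmetric]) (simp_all add: R.l_neg)

lemma smult_minus: "a \<in> carrier R \<Longrightarrow> x \<in> carrier M \<Longrightarrow> a \<odot>\<^bsub>M\<^esub> (\<ominus>\<^bsub>M\<^esub> x) = \<ominus>\<^bsub>M\<^esub> (a \<odot>\<^bsub>M\<^esub> x)"
  using smult_r_distr[of a "\<ominus>\<^bsub>M\<^esub> x" x]
  by (intro M.minus_equality[symmetric]) (simp_all add: M.l_neg)

lemma submoduleI:
  assumes "H \<subseteq> carrier M" "\<zero>\<^bsub>M\<^esub> \<in> H" "\<And>x y. \<lbrakk>x \<in> H; y \<in> H\<rbrakk> \<Longrightarrow> x \<oplus>\<^bsub>M\<^esub> y \<in> H"
    "\<And>a x. \<lbrakk>a \<in> carrier R; x \<in> H\<rbrakk> \<Longrightarrow> a \<odot>\<^bsub>M\<^esub> x \<in> H"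
  shows "submodule H R M"
proof (intro submodule.intro subgroup.intro submodule_axioms.intro)
  fix x assume "x \<in> H"
  then have "\<ominus>\<^bsub>M\<^esub> x \<in> H"
    using assms(1,4) smult_minus_one[of x] by (metis R.add.inv_closed R.one_closed subsetD)
  then show "inv\<^bsub>add_monoid M\<^esub> x \<in> H" by (simp add: a_inv_def)
qed (use assms in auto)

lemma submodule_carrier: "submodule (carrier M) R M"
  by (rule submoduleI) auto

lemma submodule_zero: "submodule {\<zero>\<^bsub>M\<^esub>} R M"
  by (rule submoduleI) auto

end

lemma left_module_sub_mod:
  assumes "left_module R M" "submodule H R M"
  shows "left_module R (sub_mod M H)"
proof -
  interpret left_module R M by fact
  interpret H: submodule H R M by fact
  have *: "\<And>x. x \<in> H \<Longrightarrow> x \<in> carrier M" using H.subset by auto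
  show ?thesis
  proof (rule left_moduleI)
    show "ring R" by (rule R.ring_axioms)
  qed (use H.m_closed H.one_closed in
        \<open>simp_all add: * M.a_ac smult_l_distr smult_r_distr smult_assoc1\<close>)
qed

lemma submoduleD:
  assumes "submodule H R M"
  shows "x \<in> H \<Longrightarrow> x \<in> carrier M" "H \<subseteq> carrier M" "\<zero>\<^bsub>M\<^esub> \<in> H"
    "\<And>x y. \<lbrakk>x \<in> H; y \<in> H\<rbrakk> \<Longrightarrow> x \<oplus>\<^bsub>M\<^esub> y \<in> H"
    "\<And>a x. \<lbrakk>a \<in> carrier R; x \<in> H\<rbrakk> \<Longrightarrow> a \<odot>\<^bsub>M\<^esub> x \<in> H"
    "\<And>x. x \<in> H \<Longrightarrow> \<ominus>\<^bsub>M\<^esub> x \<in> H"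
proof -
  interpret H: submodule H R M by fact
  show "x \<in> H \<Longrightarrow> x \<in> carrier M" "H \<subseteq> carrier M" "\<zero>\<^bsub>M\<^esub> \<in> H"
    "\<And>x y. \<lbrakk>x \<in> H; y \<in> H\<rbrakk> \<Longrightarrow> x \<oplus>\<^bsub>M\<^esub> y \<in> H"
    "\<And>a x. \<lbrakk>a \<in> carrier R; x \<in> H\<rbrakk> \<Longrightarrow> a \<odot>\<^bsub>M\<^esub> x \<in> H"
    "\<And>x. x \<in> H \<Longrightarrow> \<ominus>\<^bsub>M\<^esub> x \<in> H"
    using H.subset H.m_closed H.one_closed H.m_inv_closed by (auto simp: a_inv_def)
qed

lemma left_module_regular:
  assumes "ring R"
  shows "left_module R (regular_module R)"
proof -
  interpret ring R by fact
  show ?thesis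
    by (rule left_moduleI)
      (simp_all add: a_ac l_distr r_distr m_assoc ring_axioms)
qed

lemma module_homI:
  assumes "\<And>x. x \<in> carrier M \<Longrightarrow> f x \<in> carrier N"
    "\<And>x y. \<lbrakk>x \<in> carrier M; y \<in> carrier M\<rbrakk> \<Longrightarrow> f (x \<oplus>\<^bsub>M\<^esub> y) = f x \<oplus>\<^bsub>N\<^esub> f y"
    "\<And>a x. \<lbrakk>a \<in> carrier R; x \<in> carrier M\<rbrakk> \<Longrightarrow> f (a \<odot>\<^bsub>M\<^esub> x) = a \<odot>\<^bsub>N\<^esub> f x"
  shows "f \<in> module_hom R M N"
  using assms by (auto simp: module_hom_def)

lemma module_homD:
  assumes "f \<in> module_hom R M N"
  shows "\<And>x. x \<in> carrier M \<Longrightarrow> f x \<in> carrier N"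
    "\<And>x y. \<lbrakk>x \<in> carrier M; y \<in> carrier M\<rbrakk> \<Longrightarrow> f (x \<oplus>\<^bsub>M\<^esub> y) = f x \<oplus>\<^bsub>N\<^esub> f y"
    "\<And>a x. \<lbrakk>a \<in> carrier R; x \<in> carrier M\<rbrakk> \<Longrightarrow> f (a \<odot>\<^bsub>M\<^esub> x) = a \<odot>\<^bsub>N\<^esub> f x"
  using assms by (auto simp: module_hom_def)

lemma module_hom_zero:
  assumes "left_module R M" "left_module R N" "f \<in> module_hom R M N"
  shows "f \<zero>\<^bsub>M\<^esub> = \<zero>\<^bsub>N\<^esub>"
proof -
  interpret M: left_module R M by fact
  interpret N: left_module R N by fact
  show ?thesis
    using module_homD(3)[OF assms(3), of "\<zero>\<^bsub>R\<^esub>" "\<zero>\<^bsub>M\<^esub>"] module_homD(1)[OF assms(3), of "\<zero>\<^bsub>M\<^esub>"] by simp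
qed

lemma module_hom_minus:
  assumes "left_module R M" "left_module R N" "f \<in> module_hom R M N" "x \<in> carrier M"
  shows "f (\<ominus>\<^bsub>M\<^esub> x) = \<ominus>\<^bsub>N\<^esub> f x"
proof -
  interpret M: left_module R M by fact
  interpret N: left_module R N by fact
  show ?thesis
    using module_homD(3)[OF assms(3), of "\<ominus>\<^bsub>R\<^esub> \<one>\<^bsub>R\<^esub>" x] module_homD(1)[OF assms(3,4)] assms(4)
    by (simp add: M.smult_minus_one N.smult_minus_one)
qed

lemma module_hom_comp:
  "g \<in> module_hom R L M \<Longrightarrow> f \<in> module_hom R M N \<Longrightarrow> f \<circ> g \<in> module_hom R L N"
  unfolding module_hom_def by (auto simp: Pi_iff)

lemma module_hom_sub_mod_dom:
  "f \<in> module_hom R M N \<Longrightarrow> submodule H R M \<Longrightarrow> f \<in> module_hom R (sub_mod M H) N"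
  using submoduleD(1)[of H R M] unfolding module_hom_def by auto

lemma mem_a_kernel: "x \<in> a_kernel M N f \<longleftrightarrow> x \<in> carrier M \<and> f x = \<zero>\<^bsub>N\<^esub>"
  by (simp add: a_kernel_def')

lemma module_hom_inv:
  assumes "left_module R M" "f \<in> module_hom R M N" "bij_betw f (carrier M) (carrier N)"
  shows "the_inv_into (carrier M) f \<in> module_hom R N M"
proof -
  interpret left_module R M by fact
  let ?h = "the_inv_into (carrier M) f"
  note inj = bij_betw_imp_inj_on[OF assms(3)] and f = module_homD[OF assms(2)]
  have h: "?h y \<in> carrier M" "f (?h y) = y" if "y \<in> carrier N" for y
    using that assms(3) f_the_inv_into_f_bij_betw[OF assms(3)] bij_betw_the_inv_into[OF assms(3)]
    by (auto dest: bij_betwE)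
  have hf: "?h y = x" if "x \<in> carrier M" "f x = y" for x y
    using the_inv_into_f_f[OF inj that(1)] that(2) by simp
  show ?thesis
    by (rule module_homI) (auto intro!: hf simp: h f)
qed

lemma mem_set_add: "x \<in> A <+>\<^bsub>M\<^esub> B \<longleftrightarrow> (\<exists>a\<in>A. \<exists>b\<in>B. x = a \<oplus>\<^bsub>M\<^esub> b)"
  by (auto simp: set_add_def')

lemma set_addI: "a \<in> A \<Longrightarrow> b \<in> B \<Longrightarrow> a \<oplus>\<^bsub>M\<^esub> b \<in> A <+>\<^bsub>M\<^esub> B"
  by (auto simp: mem_set_add)

lemma submodule_set_add:
  assumes "left_module R M" "submodule H R M" "submodule K R M"
  shows "submodule (H <+>\<^bsub>M\<^esub> K) R M"
proof -
  interpret left_module R M by fact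
  note H = submoduleD[OF assms(2)] and K = submoduleD[OF assms(3)]
  show ?thesis
  proof (rule submoduleI)
    show "H <+>\<^bsub>M\<^esub> K \<subseteq> carrier M" using H(1) K(1) by (auto simp: mem_set_add)
    have "\<zero>\<^bsub>M\<^esub> = \<zero>\<^bsub>M\<^esub> \<oplus>\<^bsub>M\<^esub> \<zero>\<^bsub>M\<^esub>" by simp
    with H(3) K(3) show "\<zero>\<^bsub>M\<^esub> \<in> H <+>\<^bsub>M\<^esub> K" unfolding mem_set_add by blast
  next
    fix x y assume "x \<in> H <+>\<^bsub>M\<^esub> K" "y \<in> H <+>\<^bsub>M\<^esub> K"
    then obtain a b c d where *: "a \<in> H" "b \<in> K" "c \<in> H" "d \<in> K" "x = a \<oplus>\<^bsub>M\<^esub> b" "y = c \<oplus>\<^bsub>M\<^esub> d"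
      unfolding mem_set_add by blast
    have "x \<oplus>\<^bsub>M\<^esub> y = (a \<oplus>\<^bsub>M\<^esub> c) \<oplus>\<^bsub>M\<^esub> (b \<oplus>\<^bsub>M\<^esub> d)"
      unfolding *(5,6) using H(1)[OF *(1)] H(1)[OF *(3)] K(1)[OF *(2)] K(1)[OF *(4)] by (simp add: M.a_ac)
    with H(4)[OF *(1,3)] K(4)[OF *(2,4)] show "x \<oplus>\<^bsub>M\<^esub> y \<in> H <+>\<^bsub>M\<^esub> K" unfolding mem_set_add by blast
  next
    fix r x assume r: "r \<in> carrier R" and "x \<in> H <+>\<^bsub>M\<^esub> K"
    then obtain a b where *: "a \<in> H" "b \<in> K" "x = a \<oplus>\<^bsub>M\<^esub> b" unfolding mem_set_add by blast
    have "r \<odot>\<^bsub>M\<^esub> x = r \<odot>\<^bsub>M\<^esub> a \<oplus>\<^bsub>M\<^esub> r \<odot>\<^bsub>M\<^esub> b"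
      unfolding *(3) by (rule smult_r_distr[OF r H(1)[OF *(1)] K(1)[OF *(2)]])
    with H(5)[OF r *(1)] K(5)[OF r *(2)] show "r \<odot>\<^bsub>M\<^esub> x \<in> H <+>\<^bsub>M\<^esub> K" unfolding mem_set_add by blast
  qed
qed

lemma subset_set_add:
  assumes "left_module R M" "submodule H R M" "submodule K R M"
  shows "H \<subseteq> H <+>\<^bsub>M\<^esub> K" "K \<subseteq> H <+>\<^bsub>M\<^esub> K"
proof -
  interpret left_module R M by fact
  note H = submoduleD[OF assms(2)] and K = submoduleD[OF assms(3)]
  show "H \<subseteq> H <+>\<^bsub>M\<^esub> K" using H(1) K(3) by (force simp: mem_set_add)
  show "K \<subseteq> H <+>\<^bsub>M\<^esub> K" using K(1) H(3) by (force simp: mem_set_add)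
qed

lemma submodule_a_kernel:
  assumes "left_module R M" "left_module R N" "f \<in> module_hom R M N"
  shows "submodule (a_kernel M N f) R M"
proof -
  interpret M: left_module R M by fact
  interpret N: left_module R N by fact
  show ?thesis
    using module_homD[OF assms(3)] module_hom_zero[OF assms]
    by (intro M.submoduleI) (auto simp: mem_a_kernel)
qed

lemma submodule_image:
  assumes "left_module R M" "left_module R N" "f \<in> module_hom R M N" "submodule H R M"
  shows "submodule (f ` H) R N"
proof -
  interpret M: left_module R M by fact
  interpret N: left_module R N by fact
  note H = submoduleD[OF assms(4)] and f = module_homD[OF assms(3)]
  show ?thesis
  proof (rule N.submoduleI)
    show "\<zero>\<^bsub>N\<^esub> \<in> f ` H" using module_hom_zero[OF assms(1-3)] H(3) by (metis imageI)
    fix x y assume "x \<in> f ` H" "y \<in> f ` H"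
    then obtain u v where "u \<in> H" "v \<in> H" "x = f u" "y = f v" by auto
    then show "x \<oplus>\<^bsub>N\<^esub> y \<in> f ` H" using f(2)[of u v] H(1,4) by (metis imageI)
  next
    fix a x assume "a \<in> carrier R" "x \<in> f ` H"
    then obtain u where "u \<in> H" "x = f u" by auto
    then show "a \<odot>\<^bsub>N\<^esub> x \<in> f ` H" using f(3)[of a u] H(1,5) \<open>a \<in> carrier R\<close> by (metis imageI)
  qed (use f H in auto)
qed

section \<open>Finite sums along lists\<close>

primrec lsum :: "('r, 'm) module \<Rightarrow> 'm list \<Rightarrow> 'm" where
  "lsum M [] = \<zero>\<^bsub>M\<^esub>"
| "lsum M (x # xs) = x \<oplus>\<^bsub>M\<^esub> lsum M xs"

lemma lsum_sub_mod [simp]: "lsum (sub_mod M N) = lsum M"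
proof
  show "lsum (sub_mod M N) xs = lsum M xs" for xs by (induction xs) auto
qed

lemma lsum_mem:
  "submodule H R M \<Longrightarrow> set xs \<subseteq> H \<Longrightarrow> lsum M xs \<in> H"
  by (induction xs) (auto simp: submoduleD)

context
  fixes R :: "('r, 'x) ring_scheme" and M :: "('r, 'm) module"
  assumes M: "left_module R M"
begin

interpretation left_module R M by (rule M)

lemma lsum_closed: "set xs \<subseteq> carrier M \<Longrightarrow> lsum M xs \<in> carrier M"
  by (induction xs) auto

lemma lsum_map_add:
  assumes "\<And>i. i \<in> set is \<Longrightarrow> f i \<in> carrier M" "\<And>i. i \<in> set is \<Longrightarrow> g i \<in> carrier M"
  shows "lsum M (map (\<lambda>i. f i \<oplus>\<^bsub>M\<^esub> g i) is) = lsum M (map f is) \<oplus>\<^bsub>M\<^esub> lsum M (map g is)"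
  using assms
proof (induction "is")
  case (Cons i "is")
  then have "lsum M (map f is) \<in> carrier M" "lsum M (map g is) \<in> carrier M"
    by (auto intro!: lsum_closed)
  with Cons show ?case by (simp add: M.add.m_ac)
qed simp

lemma smult_lsum:
  assumes "a \<in> carrier R" "\<And>i. i \<in> set is \<Longrightarrow> f i \<in> carrier M"
  shows "a \<odot>\<^bsub>M\<^esub> lsum M (map f is) = lsum M (map (\<lambda>i. a \<odot>\<^bsub>M\<^esub> f i) is)"
  using assms
proof (induction "is")
  case (Cons i "is")
  then have "lsum M (map f is) \<in> carrier M" by (auto intro!: lsum_closed)
  with Cons show ?case by (simp add: smult_r_distr)
qed simp

lemma lsum_smult:
  assumes "x \<in> carrier M" "\<And>i. i \<in> set is \<Longrightarrow> c i \<in> carrier R"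
  shows "lsum (regular_module R) (map c is) \<in> carrier R"
    and "lsum (regular_module R) (map c is) \<odot>\<^bsub>M\<^esub> x = lsum M (map (\<lambda>i. c i \<odot>\<^bsub>M\<^esub> x) is)"
  using assms(2)
proof (induction "is")
  case (Cons i "is")
  { case 1 with Cons show ?case by simp }
  { case 2 with Cons show ?case by (simp add: smult_l_distr assms(1)) }
qed (use assms(1) in simp_all)

lemma lsum_zero: "(\<And>i. i \<in> set is \<Longrightarrow> f i = \<zero>\<^bsub>M\<^esub>) \<Longrightarrow> lsum M (map f is) = \<zero>\<^bsub>M\<^esub>"
  by (induction "is") auto

lemma lsum_eq_finsum:
  assumes "distinct is" "\<And>i. i \<in> set is \<Longrightarrow> f i \<in> carrier M"
  shows "lsum M (map f is) = finsum M f (set is)"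
  using assms
proof (induction "is")
  case (Cons i "is")
  then have "f \<in> set is \<rightarrow> carrier M" by auto
  with Cons show ?case by (simp add: M.finsum_insert)
qed simp

lemma module_hom_lsum:
  assumes "left_module R N" "f \<in> module_hom R M N" "set xs \<subseteq> carrier M"
  shows "f (lsum M xs) = lsum N (map f xs)"
  using assms(3)
  by (induction xs) (auto simp: lsum_closed module_homD(2)[OF assms(2)] module_hom_zero[OF M assms(1,2)])

lemma module_hom_add_fun:
  assumes "left_module R N" "f \<in> module_hom R N M" "g \<in> module_hom R N M"
  shows "(\<lambda>x. f x \<oplus>\<^bsub>M\<^esub> g x) \<in> module_hom R N M"
proof -
  interpret N: left_module R N by fact
  note f = module_homD[OF assms(2)] and g = module_homD[OF assms(3)]
  show ?thesis
  proof (rule module_homI)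
    fix x y assume "x \<in> carrier N" "y \<in> carrier N"
    then show "f (x \<oplus>\<^bsub>N\<^esub> y) \<oplus>\<^bsub>M\<^esub> g (x \<oplus>\<^bsub>N\<^esub> y) = f x \<oplus>\<^bsub>M\<^esub> g x \<oplus>\<^bsub>M\<^esub> (f y \<oplus>\<^bsub>M\<^esub> g y)"
      using f(1)[of x] f(1)[of y] g(1)[of x] g(1)[of y] by (simp add: f g M.add.m_ac)
  qed (use f g in \<open>auto simp: smult_r_distr\<close>)
qed

lemma module_hom_lsum_fun:
  assumes "left_module R N" "\<And>i. i \<in> set is \<Longrightarrow> h i \<in> module_hom R N M"
  shows "(\<lambda>x. lsum M (map (\<lambda>i. h i x) is)) \<in> module_hom R N M"
  using assms(2)
proof (induction "is")
  case Nil
  interpret N: left_module R N by fact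
  show ?case by (rule module_homI) auto
next
  case (Cons i "is")
  then show ?case using module_hom_add_fun[OF assms(1), of "h i" "\<lambda>x. lsum M (map (\<lambda>i. h i x) is)"]
    by simp
qed

end

section \<open>Projective modules as retracts of free modules\<close>

definition free_module :: "('r, 'x) ring_scheme \<Rightarrow> 'b set \<Rightarrow> ('r, 'b \<Rightarrow> 'r) module" where
  "free_module R B =
     \<lparr>carrier = {\<phi>. (\<forall>b. \<phi> b \<in> carrier R) \<and> (\<forall>b. b \<notin> B \<longrightarrow> \<phi> b = \<zero>\<^bsub>R\<^esub>) \<and> finite {b. \<phi> b \<noteq> \<zero>\<^bsub>R\<^esub>}},
      mult = undefined, one = undefined, zero = (\<lambda>_. \<zero>\<^bsub>R\<^esub>), add = (\<lambda>\<phi> \<psi> b. \<phi> b \<oplus>\<^bsub>R\<^esub> \<psi> b),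
      smult = (\<lambda>a \<phi> b. a \<otimes>\<^bsub>R\<^esub> \<phi> b)\<rparr>"

definition free_lift :: "('r, 'x) ring_scheme \<Rightarrow> ('r, 'm) module \<Rightarrow> ('b \<Rightarrow> 'm) \<Rightarrow> ('b \<Rightarrow> 'r) \<Rightarrow> 'm" where
  "free_lift R M k \<phi> = finsum M (\<lambda>b. \<phi> b \<odot>\<^bsub>M\<^esub> k b) {b. \<phi> b \<noteq> \<zero>\<^bsub>R\<^esub>}"

lemma mem_free_module:
  "\<phi> \<in> carrier (free_module R B) \<longleftrightarrow>
     (\<forall>b. \<phi> b \<in> carrier R) \<and> (\<forall>b. b \<notin> B \<longrightarrow> \<phi> b = \<zero>\<^bsub>R\<^esub>) \<and> finite {b. \<phi> b \<noteq> \<zero>\<^bsub>R\<^esub>}"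
  by (simp add: free_module_def)

lemma free_moduleD:
  assumes "\<phi> \<in> carrier (free_module R B)"
  shows "\<phi> b \<in> carrier R" "b \<notin> B \<Longrightarrow> \<phi> b = \<zero>\<^bsub>R\<^esub>" "finite {b. \<phi> b \<noteq> \<zero>\<^bsub>R\<^esub>}"
  using assms by (auto simp: mem_free_module)

lemma free_module_simps [simp]:
  "zero (free_module R B) = (\<lambda>_. \<zero>\<^bsub>R\<^esub>)" "add (free_module R B) = (\<lambda>\<phi> \<psi> b. \<phi> b \<oplus>\<^bsub>R\<^esub> \<psi> b)"
  "smult (free_module R B) = (\<lambda>a \<phi> b. a \<otimes>\<^bsub>R\<^esub> \<phi> b)"
  by (simp_all add: free_module_def)

lemma left_module_free_module:
  fixes R :: "('r, 'x) ring_scheme" and B :: "'b set"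
  assumes "ring R"
  shows "left_module R (free_module R B)"
proof -
  interpret ring R by fact
  let ?C = "carrier (free_module R B)"
  have add: "(\<lambda>b. \<phi> b \<oplus>\<^bsub>R\<^esub> \<psi> b) \<in> ?C" if "\<phi> \<in> ?C" "\<psi> \<in> ?C" for \<phi> \<psi> :: "'b \<Rightarrow> 'r"
    unfolding mem_free_module
  proof (intro conjI)
    show "finite {b. \<phi> b \<oplus>\<^bsub>R\<^esub> \<psi> b \<noteq> \<zero>\<^bsub>R\<^esub>}"
      by (rule finite_subset[OF _ finite_UnI[OF free_moduleD(3)[OF that(1)] free_moduleD(3)[OF that(2)]]]) auto
  qed (simp_all add: free_moduleD(1,2)[OF that(1)] free_moduleD(1,2)[OF that(2)])
  have smult: "(\<lambda>b. a \<otimes>\<^bsub>R\<^esub> \<phi> b) \<in> ?C" if "a \<in> carrier R" "\<phi> \<in> ?C" for a and \<phi> :: "'b \<Rightarrow> 'r"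
    unfolding mem_free_module
  proof (intro conjI)
    show "finite {b. a \<otimes>\<^bsub>R\<^esub> \<phi> b \<noteq> \<zero>\<^bsub>R\<^esub>}"
      by (rule finite_subset[OF _ free_moduleD(3)[OF that(2)]]) (use that(1) in auto)
  qed (simp_all add: free_moduleD(1,2)[OF that(2)] that(1))
  show ?thesis
  proof (rule left_moduleI)
    show "ring R" by (rule ring_axioms)
    show "\<zero>\<^bsub>free_module R B\<^esub> \<in> ?C" by (simp add: mem_free_module)
  qed (simp_all add: add smult free_moduleD(1) a_ac l_distr r_distr m_assoc)
qed

lemma free_lift_eq_lsum:
  assumes "left_module R M" "\<phi> \<in> carrier (free_module R B)" "\<And>b. b \<in> B \<Longrightarrow> k b \<in> carrier M"
    and "distinct bs" "{b. \<phi> b \<noteq> \<zero>\<^bsub>R\<^esub>} \<subseteq> set bs" "set bs \<subseteq> B"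
  shows "free_lift R M k \<phi> = lsum M (map (\<lambda>b. \<phi> b \<odot>\<^bsub>M\<^esub> k b) bs)"
proof -
  interpret left_module R M by fact
  have \<phi>: "\<phi> b \<in> carrier R" for b using free_moduleD(1)[OF assms(2)] .
  have k: "k b \<in> carrier M" if "b \<in> set bs" for b using that assms(3,6) by blast
  have "free_lift R M k \<phi> = finsum M (\<lambda>b. \<phi> b \<odot>\<^bsub>M\<^esub> k b) (set bs)"
    unfolding free_lift_def
  proof (rule M.add.finprod_mono_neutral_cong_left)
    show "\<phi> b \<odot>\<^bsub>M\<^esub> k b = \<zero>\<^bsub>M\<^esub>" if "b \<in> set bs - {b. \<phi> b \<noteq> \<zero>\<^bsub>R\<^esub>}" for b
      using that k[of b] by simp
    show "(\<lambda>b. \<phi> b \<odot>\<^bsub>M\<^esub> k b) \<in> set bs \<rightarrow> carrier M" using \<phi> k by blast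
  qed (use assms(5) in simp_all)
  also have "\<dots> = lsum M (map (\<lambda>b. \<phi> b \<odot>\<^bsub>M\<^esub> k b) bs)"
    by (rule lsum_eq_finsum[symmetric, OF assms(1) assms(4)]) (simp add: \<phi> k)
  finally show ?thesis .
qed

lemma finite_support_list:
  assumes "finite S" "S \<subseteq> carrier (free_module R B)"
  obtains bs where "distinct bs" "set bs \<subseteq> B" "\<forall>\<phi>\<in>S. {b. \<phi> b \<noteq> \<zero>\<^bsub>R\<^esub>} \<subseteq> set bs"
proof -
  have S: "\<phi> \<in> S \<Longrightarrow> \<phi> \<in> carrier (free_module R B)" for \<phi> using assms(2) by blast
  have fin: "finite (\<Union>\<phi>\<in>S. {b. \<phi> b \<noteq> \<zero>\<^bsub>R\<^esub>})"
    by (rule finite_UN_I[OF assms(1) free_moduleD(3)[OF S]])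
  from finite_distinct_list[OF fin]
  obtain bs where bs: "set bs = (\<Union>\<phi>\<in>S. {b. \<phi> b \<noteq> \<zero>\<^bsub>R\<^esub>})" "distinct bs" by (elim exE conjE)
  have "set bs \<subseteq> B"
  proof
    fix b assume "b \<in> set bs"
    then obtain \<phi> where \<phi>: "\<phi> \<in> S" "\<phi> b \<noteq> \<zero>\<^bsub>R\<^esub>" using bs(1) by blast
    with free_moduleD(2)[OF S[OF \<phi>(1)], of b] show "b \<in> B" by blast
  qed
  moreover have "\<forall>\<phi>\<in>S. {b. \<phi> b \<noteq> \<zero>\<^bsub>R\<^esub>} \<subseteq> set bs"
    unfolding bs(1) by (intro ballI UN_upper)
  ultimately show ?thesis by (rule that[OF bs(2)])
qed

lemma free_lift_mem:
  assumes "left_module R M" "submodule H R M" "\<phi> \<in> carrier (free_module R B)" "\<And>b. b \<in> B \<Longrightarrow> k b \<in> H"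
  shows "free_lift R M k \<phi> \<in> H"
proof -
  have sub: "finite {\<phi>}" "{\<phi>} \<subseteq> carrier (free_module R B)" using assms(3) by simp_all
  obtain bs where bs: "distinct bs" "set bs \<subseteq> B" "\<forall>\<chi>\<in>{\<phi>}. {b. \<chi> b \<noteq> \<zero>\<^bsub>R\<^esub>} \<subseteq> set bs"
    by (rule finite_support_list[OF sub])
  have "free_lift R M k \<phi> = lsum M (map (\<lambda>b. \<phi> b \<odot>\<^bsub>M\<^esub> k b) bs)"
    by (rule free_lift_eq_lsum[OF assms(1,3) _ bs(1) bspec[OF bs(3) singletonI] bs(2)])
      (simp_all add: assms(4) submoduleD(1)[OF assms(2)])
  also have "\<dots> \<in> H"
    by (rule lsum_mem[OF assms(2)]) (use bs(2) assms(4) free_moduleD(1)[OF assms(3)] submoduleD(5)[OF assms(2)] in auto)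
  finally show ?thesis .
qed

lemma free_lift_hom:
  assumes "left_module R M" and k: "\<And>b. b \<in> B \<Longrightarrow> k b \<in> carrier M"
  shows "free_lift R M k \<in> module_hom R (free_module R B) M"
proof -
  interpret left_module R M by fact
  interpret F: left_module R "free_module R B" by (rule left_module_free_module[OF R.ring_axioms])
  show ?thesis
  proof (rule module_homI)
    show "free_lift R M k \<phi> \<in> carrier M" if "\<phi> \<in> carrier (free_module R B)" for \<phi>
      by (rule free_lift_mem[OF assms(1) submodule_carrier that k])
  next
    fix \<phi> \<psi> assume *: "\<phi> \<in> carrier (free_module R B)" "\<psi> \<in> carrier (free_module R B)"
    note R = free_moduleD(1)[OF *(1)] free_moduleD(1)[OF *(2)]
    let ?s = "\<phi> \<oplus>\<^bsub>free_module R B\<^esub> \<psi>"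
    have s: "?s \<in> carrier (free_module R B)" by (rule F.a_closed[OF *])
    have sub: "finite {\<phi>, \<psi>, ?s}" "{\<phi>, \<psi>, ?s} \<subseteq> carrier (free_module R B)" using * s by simp_all
    obtain bs where bs: "distinct bs" "set bs \<subseteq> B"
      "\<forall>\<chi>\<in>{\<phi>, \<psi>, ?s}. {b. \<chi> b \<noteq> \<zero>\<^bsub>R\<^esub>} \<subseteq> set bs"
      by (rule finite_support_list[OF sub])
    have eq: "free_lift R M k \<chi> = lsum M (map (\<lambda>b. \<chi> b \<odot>\<^bsub>M\<^esub> k b) bs)" if "\<chi> \<in> {\<phi>, \<psi>, ?s}" for \<chi>
      by (rule free_lift_eq_lsum[OF assms(1) subsetD[OF sub(2) that] k bs(1) bspec[OF bs(3) that] bs(2)])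
    have "lsum M (map (\<lambda>b. ?s b \<odot>\<^bsub>M\<^esub> k b) bs) =
        lsum M (map (\<lambda>b. \<phi> b \<odot>\<^bsub>M\<^esub> k b \<oplus>\<^bsub>M\<^esub> \<psi> b \<odot>\<^bsub>M\<^esub> k b) bs)"
      by (rule arg_cong[where f = "lsum M"], rule map_cong) (use R bs(2) k in \<open>auto intro!: smult_l_distr\<close>)
    also have "\<dots> = lsum M (map (\<lambda>b. \<phi> b \<odot>\<^bsub>M\<^esub> k b) bs) \<oplus>\<^bsub>M\<^esub> lsum M (map (\<lambda>b. \<psi> b \<odot>\<^bsub>M\<^esub> k b) bs)"
      by (rule lsum_map_add[OF assms(1)]) (use R bs(2) k in auto)
    finally show "free_lift R M k ?s = free_lift R M k \<phi> \<oplus>\<^bsub>M\<^esub> free_lift R M k \<psi>"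
      by (simp only: eq insert_iff simp_thms)
  next
    fix a \<phi> assume a: "a \<in> carrier R" and *: "\<phi> \<in> carrier (free_module R B)"
    note R = free_moduleD(1)[OF *]
    let ?s = "a \<odot>\<^bsub>free_module R B\<^esub> \<phi>"
    have s: "?s \<in> carrier (free_module R B)" by (rule F.smult_closed[OF a *])
    have sub: "finite {\<phi>, ?s}" "{\<phi>, ?s} \<subseteq> carrier (free_module R B)" using * s by simp_all
    obtain bs where bs: "distinct bs" "set bs \<subseteq> B"
      "\<forall>\<chi>\<in>{\<phi>, ?s}. {b. \<chi> b \<noteq> \<zero>\<^bsub>R\<^esub>} \<subseteq> set bs"
      by (rule finite_support_list[OF sub])
    have eq: "free_lift R M k \<chi> = lsum M (map (\<lambda>b. \<chi> b \<odot>\<^bsub>M\<^esub> k b) bs)" if "\<chi> \<in> {\<phi>, ?s}" for \<chi>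
      by (rule free_lift_eq_lsum[OF assms(1) subsetD[OF sub(2) that] k bs(1) bspec[OF bs(3) that] bs(2)])
    have "lsum M (map (\<lambda>b. ?s b \<odot>\<^bsub>M\<^esub> k b) bs) =
        lsum M (map (\<lambda>b. a \<odot>\<^bsub>M\<^esub> (\<phi> b \<odot>\<^bsub>M\<^esub> k b)) bs)"
      by (rule arg_cong[where f = "lsum M"], rule map_cong)
        (use R a bs(2) k in \<open>auto intro!: smult_assoc1\<close>)
    also have "\<dots> = a \<odot>\<^bsub>M\<^esub> lsum M (map (\<lambda>b. \<phi> b \<odot>\<^bsub>M\<^esub> k b) bs)"
      by (rule smult_lsum[symmetric, OF assms(1) a]) (use R bs(2) k in auto)
    finally show "free_lift R M k ?s = a \<odot>\<^bsub>M\<^esub> free_lift R M k \<phi>"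
      by (simp only: eq insert_iff simp_thms)
  qed
qed

lemma projective_left_module: "projective R P \<Longrightarrow> left_module R P"
  by (simp add: projective_def)

lemma projective_retract_of_free:
  fixes P :: "('r, 'p) module"
  assumes "projective R P"
  obtains h where "h \<in> module_hom R P (free_module R (carrier P))"
    "\<And>p. p \<in> carrier P \<Longrightarrow> free_lift R P (\<lambda>b. b) (h p) = p"
proof -
  interpret P: left_module R P by (rule projective_left_module[OF assms])
  let ?F = "free_module R (carrier P)" and ?g = "free_lift R P (\<lambda>b. b)"
  have F: "left_module R ?F" by (rule left_module_free_module[OF P.R.ring_axioms])
  have g: "?g \<in> module_hom R ?F P"
    by (rule free_lift_hom[OF P.left_module_axioms])
  have surj: "?g ` carrier ?F = carrier P"
  proof (intro equalityI subsetI)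
    fix p assume p: "p \<in> carrier P"
    define \<phi> where "\<phi> = (\<lambda>b. if b = p then \<one>\<^bsub>R\<^esub> else \<zero>\<^bsub>R\<^esub>)"
    have \<phi>: "\<phi> \<in> carrier ?F"
      using p by (auto simp: mem_free_module \<phi>_def intro: finite_subset[of _ "{p}"])
    have "?g \<phi> = lsum P (map (\<lambda>b. \<phi> b \<odot>\<^bsub>P\<^esub> b) [p])"
      by (rule free_lift_eq_lsum[OF P.left_module_axioms \<phi>]) (use p in \<open>auto simp: \<phi>_def\<close>)
    then have "?g \<phi> = p" using p by (simp add: \<phi>_def)
    with \<phi> show "p \<in> ?g ` carrier ?F" by (metis imageI)
  qed (use module_homD(1)[OF g] in auto)
  have id: "(\<lambda>x. x) \<in> module_hom R P P" by (rule module_homI) auto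
  from assms F P.left_module_axioms g surj id have "\<exists>h\<in>module_hom R P ?F. \<forall>x\<in>carrier P. ?g (h x) = x"
    unfolding projective_def by blast
  with that show ?thesis by blast
qed

text \<open>A finite part of a dual basis: the coordinate functions are fixed once for all, while the list
  of basis elements depends on the finitely many elements to be expanded.\<close>

lemma projective_dual_basis:
  fixes P :: "('r, 'p) module"
  assumes "projective R P"
  obtains s where "\<forall>q. s q \<in> module_hom R P (regular_module R)"
    "\<forall>S. finite S \<and> S \<subseteq> carrier P \<longrightarrow> (\<exists>bs. set bs \<subseteq> carrier P \<and>
      (\<forall>p\<in>S. lsum P (map (\<lambda>q. s q p \<odot>\<^bsub>P\<^esub> q) bs) = p))"
proof -
  interpret P: left_module R P by (rule projective_left_module[OF assms])
  obtain h where h: "h \<in> module_hom R P (free_module R (carrier P))"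
    "\<And>p. p \<in> carrier P \<Longrightarrow> free_lift R P (\<lambda>b. b) (h p) = p"
    using projective_retract_of_free[OF assms] by blast
  show ?thesis
  proof (rule that[of "\<lambda>q p. h p q"]; intro allI impI; (elim conjE)?)
    show "(\<lambda>p. h p q) \<in> module_hom R P (regular_module R)" for q
      using module_homD(2,3)[OF h(1)] free_moduleD(1)[OF module_homD(1)[OF h(1)]]
      by (intro module_homI) simp_all
  next
    fix S assume S: "finite S" "S \<subseteq> carrier P"
    have sub: "finite (h ` S)" "h ` S \<subseteq> carrier (free_module R (carrier P))"
      using S module_homD(1)[OF h(1)] by blast+
    obtain bs where bs: "distinct bs" "set bs \<subseteq> carrier P"
      "\<forall>\<phi>\<in>h ` S. {b. \<phi> b \<noteq> \<zero>\<^bsub>R\<^esub>} \<subseteq> set bs"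
      by (rule finite_support_list[OF sub])
    have "lsum P (map (\<lambda>q. h p q \<odot>\<^bsub>P\<^esub> q) bs) = p" if "p \<in> S" for p
    proof -
      have "h p \<in> carrier (free_module R (carrier P))"
        using that S(2) module_homD(1)[OF h(1)] by blast
      from free_lift_eq_lsum[OF P.left_module_axioms this _ bs(1) bspec[OF bs(3) imageI[OF that]] bs(2), of "\<lambda>b. b"]
      show ?thesis using h(2)[of p] that S(2) by (simp add: subsetD)
    qed
    then show "\<exists>bs. set bs \<subseteq> carrier P \<and> (\<forall>p\<in>S. lsum P (map (\<lambda>q. h p q \<odot>\<^bsub>P\<^esub> q) bs) = p)"
      using bs(2) by blast
  qed
qed

text \<open>Lifting along a quotient by a submodule, with the lift taken back into the module itself: an
  endomorphism with values in \<open>K\<close> that is the identity modulo \<open>C\<close>.\<close>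

lemma projective_lift_modulo:
  fixes P :: "('r, 'p) module"
  assumes "projective R P" "submodule K R P" "submodule C R P" "K <+>\<^bsub>P\<^esub> C = carrier P"
  obtains r where "r \<in> module_hom R P P" "\<And>x. x \<in> carrier P \<Longrightarrow> r x \<in> K"
    "\<And>x. x \<in> carrier P \<Longrightarrow> x \<oplus>\<^bsub>P\<^esub> \<ominus>\<^bsub>P\<^esub> r x \<in> C"
proof -
  note M = projective_left_module[OF assms(1)]
  interpret P: left_module R P by (rule M)
  obtain h where h: "h \<in> module_hom R P (free_module R (carrier P))"
    "\<And>p. p \<in> carrier P \<Longrightarrow> free_lift R P (\<lambda>b. b) (h p) = p"
    using projective_retract_of_free[OF assms(1)] by blast
  note hF = module_homD(1)[OF h(1)]
  have "\<exists>k\<in>K. x \<oplus>\<^bsub>P\<^esub> \<ominus>\<^bsub>P\<^esub> k \<in> C" if x: "x \<in> carrier P" for x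
  proof -
    obtain k c where kc: "k \<in> K" "c \<in> C" "x = k \<oplus>\<^bsub>P\<^esub> c"
      using x mem_set_add[of x P K C] unfolding assms(4) by blast
    then have "k \<in> carrier P" "c \<in> carrier P"
      using submoduleD(1)[OF assms(2)] submoduleD(1)[OF assms(3)] by simp_all
    then have "x \<oplus>\<^bsub>P\<^esub> \<ominus>\<^bsub>P\<^esub> k = c" using kc(3) by (simp add: P.M.a_ac P.M.r_neg1 P.M.r_neg)
    with kc(1,2) show ?thesis by (intro bexI[of _ k]) simp_all
  qed
  then obtain k where k: "\<And>x. x \<in> carrier P \<Longrightarrow> k x \<in> K"
      "\<And>x. x \<in> carrier P \<Longrightarrow> x \<oplus>\<^bsub>P\<^esub> \<ominus>\<^bsub>P\<^esub> k x \<in> C"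
    by metis
  have kP: "\<And>x. x \<in> carrier P \<Longrightarrow> k x \<in> carrier P" using k(1) submoduleD(1)[OF assms(2)] by blast
  let ?r = "free_lift R P k \<circ> h"
  show ?thesis
  proof (rule that[of ?r])
    show "?r \<in> module_hom R P P"
      by (rule module_hom_comp[OF h(1) free_lift_hom[OF M kP]])
    show "?r x \<in> K" if "x \<in> carrier P" for x
      using free_lift_mem[OF M assms(2) hF[OF that] k(1)] by simp
    show "x \<oplus>\<^bsub>P\<^esub> \<ominus>\<^bsub>P\<^esub> ?r x \<in> C" if x: "x \<in> carrier P" for x
    proof -
      let ?\<phi> = "h x"
      have \<phi>: "?\<phi> \<in> carrier (free_module R (carrier P))" by (rule hF[OF x])
      have sub: "finite {?\<phi>}" "{?\<phi>} \<subseteq> carrier (free_module R (carrier P))" using \<phi> by simp_all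
      obtain bs where bs: "distinct bs" "set bs \<subseteq> carrier P"
        "\<forall>\<chi>\<in>{?\<phi>}. {b. \<chi> b \<noteq> \<zero>\<^bsub>R\<^esub>} \<subseteq> set bs"
        by (rule finite_support_list[OF sub])
      note bs = bs(1,2) bspec[OF bs(3) singletonI]
      have \<phi>R: "?\<phi> b \<in> carrier R" for b by (rule free_moduleD(1)[OF \<phi>])
      have kr: "free_lift R P k ?\<phi> = lsum P (map (\<lambda>b. ?\<phi> b \<odot>\<^bsub>P\<^esub> k b) bs)"
        by (rule free_lift_eq_lsum[OF M \<phi> kP bs(1,3,2)])
      have xs: "x = lsum P (map (\<lambda>b. ?\<phi> b \<odot>\<^bsub>P\<^esub> b) bs)"
        using free_lift_eq_lsum[OF M \<phi> _ bs(1,3,2), of "\<lambda>b. b"] h(2)[OF x] by simp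
      have "(\<lambda>y. \<ominus>\<^bsub>P\<^esub> y) \<in> module_hom R P P"
        by (rule module_homI) (auto simp: P.smult_minus P.M.minus_add P.M.a_comm)
      then have "\<ominus>\<^bsub>P\<^esub> free_lift R P k ?\<phi> = lsum P (map (\<lambda>b. \<ominus>\<^bsub>P\<^esub> (?\<phi> b \<odot>\<^bsub>P\<^esub> k b)) bs)"
        unfolding kr using module_hom_lsum[OF M M, of "\<lambda>y. \<ominus>\<^bsub>P\<^esub> y" "map (\<lambda>b. ?\<phi> b \<odot>\<^bsub>P\<^esub> k b) bs"]
          bs(2) kP \<phi>R by (auto simp: o_def)
      then have "x \<oplus>\<^bsub>P\<^esub> \<ominus>\<^bsub>P\<^esub> ?r x =
          lsum P (map (\<lambda>b. ?\<phi> b \<odot>\<^bsub>P\<^esub> b \<oplus>\<^bsub>P\<^esub> \<ominus>\<^bsub>P\<^esub> (?\<phi> b \<odot>\<^bsub>P\<^esub> k b)) bs)"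
        using bs(2) kP \<phi>R by (subst lsum_map_add[OF M]) (auto simp flip: xs)
      also have "\<dots> = lsum P (map (\<lambda>b. ?\<phi> b \<odot>\<^bsub>P\<^esub> (b \<oplus>\<^bsub>P\<^esub> \<ominus>\<^bsub>P\<^esub> k b)) bs)"
        by (rule arg_cong[where f = "lsum P"], rule map_cong)
          (use bs(2) kP \<phi>R in \<open>auto simp: P.smult_r_distr P.smult_minus subsetD\<close>)
      also have "\<dots> \<in> C"
        by (rule lsum_mem[OF assms(3)]) (use bs(2) k \<phi>R submoduleD(5)[OF assms(3)] in auto)
      finally show ?thesis .
    qed
  qed
qed

text \<open>Direct summands of projectives; the definition of projectivity passes to submodules because they
  live on the same type.\<close>

lemma projective_summand:
  fixes P :: "('r, 'p) module"
  assumes "projective R P" "submodule C R P" "pr \<in> module_hom R P (sub_mod P C)"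
    "\<And>x. x \<in> C \<Longrightarrow> pr x = x"
  shows "projective R (sub_mod P C)"
  unfolding projective_def
proof (intro conjI allI impI)
  show "left_module R (sub_mod P C)"
    by (rule left_module_sub_mod[OF projective_left_module[OF assms(1)] assms(2)])
  fix N :: "('r, 'p \<Rightarrow> 'r) module" and L :: "('r, 'p) module" and g f
  assume *: "left_module R N \<and> left_module R L \<and> g \<in> module_hom R N L \<and>
    g ` carrier N = carrier L \<and> f \<in> module_hom R (sub_mod P C) L"
  then have "f \<circ> pr \<in> module_hom R P L" using module_hom_comp[OF assms(3)] by blast
  with assms(1) * obtain h where h: "h \<in> module_hom R P N" "\<forall>x\<in>carrier P. g (h x) = (f \<circ> pr) x"
    unfolding projective_def by blast
  have "h \<in> module_hom R (sub_mod P C) N"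
    by (rule module_hom_sub_mod_dom[OF h(1) assms(2)])
  moreover have "\<forall>x\<in>carrier (sub_mod P C). g (h x) = f x"
    using h(2) assms(4) submoduleD(1)[OF assms(2)] by auto
  ultimately show "\<exists>h\<in>module_hom R (sub_mod P C) N. \<forall>x\<in>carrier (sub_mod P C). g (h x) = f x"
    by blast
qed

section \<open>Tensor products with projective modules\<close>

text \<open>A list of pairs \<open>(x\<^sub>i, p\<^sub>i)\<close> stands for the element \<open>x\<^sub>1 \<otimes> p\<^sub>1 + \<dots> + x\<^sub>n \<otimes> p\<^sub>n\<close> of \<open>X \<otimes> P\<close>, where \<open>X\<close> is a right
  and \<open>P\<close> a left module.  If \<open>P\<close> is projective, elements of the tensor product are separated by the
  linear forms on \<open>P\<close>, so equality in \<open>X \<otimes> P\<close> can be tested in \<open>X\<close>.  This avoids the construction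
  of the tensor product.\<close>

abbreviation linear_forms :: "('r, 'x) ring_scheme \<Rightarrow> ('r, 'p) module \<Rightarrow> ('p \<Rightarrow> 'r) set" where
  "linear_forms R P \<equiv> module_hom R P (regular_module R)"

abbreviation tensors :: "('r, 'm) module \<Rightarrow> ('r, 'p) module \<Rightarrow> ('m \<times> 'p) list set" where
  "tensors X P \<equiv> lists (carrier X \<times> carrier P)"

definition pairing :: "('r, 'm) module \<Rightarrow> ('p \<Rightarrow> 'r) \<Rightarrow> ('m \<times> 'p) list \<Rightarrow> 'm" where
  "pairing X f t = lsum X (map (\<lambda>(x, p). f p \<odot>\<^bsub>X\<^esub> x) t)"

definition tensor_eq ::
    "('r, 'x) ring_scheme \<Rightarrow> ('r, 'p) module \<Rightarrow> ('r, 'm) module \<Rightarrow> ('m \<times> 'p) list \<Rightarrow> ('m \<times> 'p) list \<Rightarrow> bool" where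
  "tensor_eq R P X t u \<longleftrightarrow> (\<forall>f\<in>linear_forms R P. pairing X f t = pairing X f u)"

lemma tensor_eqI:
  "(\<And>f. f \<in> linear_forms R P \<Longrightarrow> pairing X f t = pairing X f u) \<Longrightarrow> tensor_eq R P X t u"
  by (simp add: tensor_eq_def)

lemma tensor_eqD: "tensor_eq R P X t u \<Longrightarrow> f \<in> linear_forms R P \<Longrightarrow> pairing X f t = pairing X f u"
  by (simp add: tensor_eq_def)

lemma linear_form_closed: "f \<in> linear_forms R P \<Longrightarrow> p \<in> carrier P \<Longrightarrow> f p \<in> carrier R"
  using module_homD(1)[of f R P "regular_module R"] by simp

lemma pairing_Nil [simp]: "pairing X f [] = \<zero>\<^bsub>X\<^esub>"
  by (simp add: pairing_def)

lemma pairing_Cons [simp]: "pairing X f ((x, p) # t) = f p \<odot>\<^bsub>X\<^esub> x \<oplus>\<^bsub>X\<^esub> pairing X f t"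
  by (simp add: pairing_def)

lemma pairing_sub_mod [simp]: "pairing (sub_mod X N) f t = pairing X f t"
  by (simp add: pairing_def)

lemma pairing_map_snd [simp]:
  "pairing X f (map (map_prod id d) t) = pairing X (\<lambda>p. f (d p)) t"
  by (simp add: pairing_def comp_def case_prod_unfold)

lemma tensors_map:
  assumes "t \<in> tensors X P" "\<And>x. x \<in> carrier X \<Longrightarrow> g x \<in> carrier Y" "\<And>p. p \<in> carrier P \<Longrightarrow> d p \<in> carrier Q"
  shows "map (map_prod g d) t \<in> tensors Y Q"
  using assms by (auto simp: in_lists_conv_set)

lemma pairing_closed:
  assumes "left_module (opposite R) X" "f \<in> linear_forms R P" "t \<in> tensors X P"
  shows "pairing X f t \<in> carrier X"
proof -
  interpret X: left_module "opposite R" X by fact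
  from assms(3) show ?thesis
    by (induction t rule: lists.induct) (auto simp: linear_form_closed[OF assms(2)])
qed

lemma pairing_append:
  assumes "left_module (opposite R) X" "f \<in> linear_forms R P" "t \<in> tensors X P" "u \<in> tensors X P"
  shows "pairing X f (t @ u) = pairing X f t \<oplus>\<^bsub>X\<^esub> pairing X f u"
proof -
  interpret X: left_module "opposite R" X by fact
  note u = pairing_closed[OF assms(1,2,4)]
  from assms(3) show ?thesis
  proof (induction t rule: lists.induct)
    case (Cons a t)
    then show ?case
      using pairing_closed[OF assms(1,2) Cons(2)] linear_form_closed[OF assms(2)]
      by (cases a) (simp add: u X.M.a_assoc)
  qed (simp add: u)
qed

lemma pairing_map_fst:
  assumes "left_module (opposite R) X" "left_module (opposite R) Y" "g \<in> module_hom (opposite R) X Y"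
    and "f \<in> linear_forms R P" "t \<in> tensors X P"
  shows "pairing Y f (map (map_prod g id) t) = g (pairing X f t)"
proof -
  interpret X: left_module "opposite R" X by fact
  note g = module_homD[OF assms(3)]
  from assms(5) show ?thesis
  proof (induction t rule: lists.induct)
    case (Cons a t)
    then show ?case
      using pairing_closed[OF assms(1,4) Cons(2)] linear_form_closed[OF assms(4)]
      by (cases a) (simp add: g)
  qed (simp add: module_hom_zero[OF assms(1-3)])
qed

lemma pairing_map_minus:
  assumes "left_module (opposite R) X" "f \<in> linear_forms R P" "t \<in> tensors X P"
  shows "pairing X f (map (map_prod (a_inv X) id) t) = \<ominus>\<^bsub>X\<^esub> pairing X f t"
proof -
  interpret X: left_module "opposite R" X by fact
  have "a_inv X \<in> module_hom (opposite R) X X"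
    by (rule module_homI) (auto simp: X.smult_minus X.M.minus_add X.M.a_comm)
  from pairing_map_fst[OF assms(1,1) this assms(2,3)] show ?thesis .
qed

lemma pairing_zero_form:
  assumes "left_module (opposite R) X" "\<And>p. p \<in> carrier P \<Longrightarrow> f p = \<zero>\<^bsub>R\<^esub>" "t \<in> tensors X P"
  shows "pairing X f t = \<zero>\<^bsub>X\<^esub>"
proof -
  interpret X: left_module "opposite R" X by fact
  from assms(3) show ?thesis
    by (induction t rule: lists.induct) (use X.smult_zero_left assms(2) in auto)
qed

lemma lsum_opposite_regular: "lsum (regular_module (opposite R)) xs = lsum (regular_module R) xs"
  by (induction xs) auto

text \<open>A tensor in \<open>Y \<otimes> P\<close> can be evaluated at \<open>s \<in> Y*\<close> and \<open>f \<in> P*\<close> in either order.  This turns a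
  tensor into the element of \<open>P\<close> in the bracket, which \<open>s\<close> extracts from it.\<close>

lemma linear_form_pairing:
  assumes "left_module R P" "left_module (opposite R) Y"
    and f: "f \<in> linear_forms R P" and s: "s \<in> linear_forms (opposite R) Y" and t: "t \<in> tensors Y P"
  shows "s (pairing Y f t) = f (lsum P (map (\<lambda>(y, p). s y \<odot>\<^bsub>P\<^esub> p) t))"
proof -
  interpret P: left_module R P by fact
  interpret Y: left_module "opposite R" Y by fact
  note fD = module_homD[OF f, simplified] and sD = module_homD[OF s, simplified]
  have R: "left_module R (regular_module R)" "left_module (opposite R) (regular_module (opposite R))"
    using left_module_regular P.R.ring_axioms Y.R.ring_axioms by blast+
  from t show ?thesis
  proof (induction t rule: lists.induct)
    case Nil
    show ?case using module_hom_zero[OF assms(1) R(1) f] module_hom_zero[OF assms(2) R(2) s] by simp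
  next
    case (Cons a t)
    then obtain y p where a: "a = (y, p)" "y \<in> carrier Y" "p \<in> carrier P" by auto
    have "lsum P (map (\<lambda>(y, p). s y \<odot>\<^bsub>P\<^esub> p) t) \<in> carrier P"
      by (rule lsum_closed[OF assms(1)]) (use Cons(2) sD(1) in auto)
    with a Cons show ?case
      using pairing_closed[OF assms(2) f Cons(2)] by (simp add: fD sD)
  qed
qed

text \<open>Writing every \<open>p\<close> in the coordinates of a dual basis collects the terms of \<open>\<Sigma> x\<^sub>i \<otimes> p\<^sub>i\<close> into
  \<open>\<Sigma>\<^sub>q (\<Sigma>\<^sub>i x\<^sub>i s\<^sub>q(p\<^sub>i)) \<otimes> q\<close>.\<close>

lemma pairing_dual_basis:
  assumes "left_module R P" "left_module (opposite R) X"
    and s: "\<And>q. s q \<in> linear_forms R P" and f: "f \<in> linear_forms R P"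
    and bs: "set bs \<subseteq> carrier P" and t: "t \<in> tensors X P"
    and expand: "\<And>p. p \<in> snd ` set t \<Longrightarrow> lsum P (map (\<lambda>q. s q p \<odot>\<^bsub>P\<^esub> q) bs) = p"
  shows "pairing X f (map (\<lambda>q. (pairing X (s q) t, q)) bs) = pairing X f t"
proof -
  interpret P: left_module R P by fact
  interpret X: left_module "opposite R" X by fact
  have R: "left_module R (regular_module R)"
    by (rule left_module_regular[OF P.R.ring_axioms])
  note fc = linear_form_closed[OF f] and sc = linear_form_closed[OF s]
  note pc = pairing_closed[OF assms(2) s]
  have bsP: "q \<in> carrier P" if "q \<in> set bs" for q using that bs by blast
  have eq: "pairing X f (map (\<lambda>q. (pairing X (s q) u, q)) bs)
      = lsum X (map (\<lambda>q. f q \<odot>\<^bsub>X\<^esub> pairing X (s q) u) bs)" for u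
    by (simp add: pairing_def comp_def)
  from t expand show ?thesis
    unfolding eq
  proof (induction t rule: lists.induct)
    case Nil
    have "lsum X (map (\<lambda>q. f q \<odot>\<^bsub>X\<^esub> pairing X (s q) []) bs) = \<zero>\<^bsub>X\<^esub>"
      by (rule lsum_zero[OF assms(2)]) (use fc bsP X.smult_zero_right in simp)
    then show ?case by simp
  next
    case (Cons a t)
    then obtain x p where a: "a = (x, p)" "x \<in> carrier X" "p \<in> carrier P" by auto
    have "lsum X (map (\<lambda>q. f q \<odot>\<^bsub>X\<^esub> pairing X (s q) (a # t)) bs)
        = lsum X (map (\<lambda>q. f q \<odot>\<^bsub>X\<^esub> (s q p \<odot>\<^bsub>X\<^esub> x) \<oplus>\<^bsub>X\<^esub> f q \<odot>\<^bsub>X\<^esub> pairing X (s q) t) bs)"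
      by (rule arg_cong[where f = "lsum X"], rule map_cong)
        (simp_all add: a X.smult_r_distr fc sc pc bsP Cons(2))
    also have "\<dots> = lsum X (map (\<lambda>q. f q \<odot>\<^bsub>X\<^esub> (s q p \<odot>\<^bsub>X\<^esub> x)) bs)
        \<oplus>\<^bsub>X\<^esub> lsum X (map (\<lambda>q. f q \<odot>\<^bsub>X\<^esub> pairing X (s q) t) bs)"
      by (rule lsum_map_add[OF assms(2)]) (simp_all add: a fc sc pc bsP Cons(2))
    also have "lsum X (map (\<lambda>q. f q \<odot>\<^bsub>X\<^esub> pairing X (s q) t) bs) = pairing X f t"
      by (rule Cons.IH) (simp add: Cons.prems)
    also have "lsum X (map (\<lambda>q. f q \<odot>\<^bsub>X\<^esub> (s q p \<odot>\<^bsub>X\<^esub> x)) bs)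
        = lsum X (map (\<lambda>q. (s q p \<otimes>\<^bsub>R\<^esub> f q) \<odot>\<^bsub>X\<^esub> x) bs)"
      by (rule arg_cong[where f = "lsum X"], rule map_cong)
        (use X.smult_assoc1[of "f _" "s _ p" x] in \<open>simp_all add: a fc sc bsP\<close>)
    also have "\<dots> = lsum (regular_module R) (map (\<lambda>q. s q p \<otimes>\<^bsub>R\<^esub> f q) bs) \<odot>\<^bsub>X\<^esub> x"
      using lsum_smult(2)[OF assms(2) a(2), of bs "\<lambda>q. s q p \<otimes>\<^bsub>R\<^esub> f q"]
      by (simp add: lsum_opposite_regular a fc sc bsP)
    also have "map (\<lambda>q. s q p \<otimes>\<^bsub>R\<^esub> f q) bs = map f (map (\<lambda>q. s q p \<odot>\<^bsub>P\<^esub> q) bs)"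
      using module_homD(3)[OF f] by (simp add: a sc bsP)
    also have "lsum (regular_module R) \<dots> = f (lsum P (map (\<lambda>q. s q p \<odot>\<^bsub>P\<^esub> q) bs))"
      by (rule module_hom_lsum[symmetric, OF assms(1) R f]) (use a sc bsP in auto)
    also have "lsum P (map (\<lambda>q. s q p \<odot>\<^bsub>P\<^esub> q) bs) = p"
      by (rule Cons.prems) (simp add: a)
    finally show ?case by (simp add: a)
  qed
qed

text \<open>Exactness of \<open>\<otimes> P\<close>: the coordinates of a tensor that dies in \<open>X \<otimes> P\<close> lie in the kernel of \<open>g\<close>, and
  they are the entries of an equal tensor.\<close>

lemma tensor_kernel:
  fixes P :: "('r, 'p) module"
  assumes "projective R P" "left_module (opposite R) X" "left_module (opposite R) Y"
    and g: "g \<in> module_hom (opposite R) Y X" and t: "t \<in> tensors Y P"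
    and zero: "tensor_eq R P X (map (map_prod g id) t) []"
  obtains u where "u \<in> tensors (sub_mod Y (a_kernel Y X g)) P" "tensor_eq R P Y t u"
proof -
  note P = projective_left_module[OF assms(1)]
  obtain s where s: "\<forall>q. s q \<in> linear_forms R P"
    "\<forall>S. finite S \<and> S \<subseteq> carrier P \<longrightarrow> (\<exists>bs. set bs \<subseteq> carrier P \<and>
      (\<forall>p\<in>S. lsum P (map (\<lambda>q. s q p \<odot>\<^bsub>P\<^esub> q) bs) = p))"
    by (rule projective_dual_basis[OF assms(1)])
  note s = spec[OF s(1)] mp[OF spec[OF s(2)], OF conjI]
  have "finite (snd ` set t)" "snd ` set t \<subseteq> carrier P" using t by auto
  from s(2)[OF this] obtain bs where bs: "set bs \<subseteq> carrier P"
    "\<forall>p\<in>snd ` set t. lsum P (map (\<lambda>q. s q p \<odot>\<^bsub>P\<^esub> q) bs) = p" by blast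
  let ?u = "map (\<lambda>q. (pairing Y (s q) t, q)) bs"
  have "g (pairing Y (s q) t) = \<zero>\<^bsub>X\<^esub>" for q
    using tensor_eqD[OF zero s(1)] pairing_map_fst[OF assms(3,2) g s(1) t] by simp
  then have u: "?u \<in> tensors (sub_mod Y (a_kernel Y X g)) P"
    using bs(1) pairing_closed[OF assms(3) s(1) t] by (auto simp: mem_a_kernel in_lists_conv_set)
  have "tensor_eq R P Y t ?u"
  proof (rule tensor_eqI)
    fix f assume f: "f \<in> linear_forms R P"
    show "pairing Y f t = pairing Y f ?u"
      by (rule pairing_dual_basis[OF P assms(3) s(1) f bs(1) t bspec[OF bs(2)], symmetric])
  qed
  with u that show ?thesis by blast
qed

section \<open>Vanishing of Tor along a projective resolution\<close>

text \<open>\<open>tor_vanishes R P d k X\<close> says that \<open>X \<otimes> P\<close> is exact in degree \<open>k + 1\<close>, that is, \<open>Tor\<^sub>k\<^sub>+\<^sub>1(X, M) = 0\<close>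
  if \<open>P\<close> resolves \<open>M\<close>.  Indexing from the first \<open>Tor\<close> keeps the augmentation \<open>P\<^sub>0 \<rightarrow> M\<close> out of the
  argument.\<close>

abbreviation boundary :: "(nat \<Rightarrow> 'p \<Rightarrow> 'p) \<Rightarrow> nat \<Rightarrow> ('m \<times> 'p) list \<Rightarrow> ('m \<times> 'p) list" where
  "boundary d i \<equiv> map (map_prod id (d i))"

definition tor_vanishes ::
    "('r, 'x) ring_scheme \<Rightarrow> (nat \<Rightarrow> ('r, 'p) module) \<Rightarrow> (nat \<Rightarrow> 'p \<Rightarrow> 'p) \<Rightarrow> nat \<Rightarrow> ('r, 'm) module \<Rightarrow> bool" where
  "tor_vanishes R P d k X \<longleftrightarrow>
     (\<forall>t\<in>tensors X (P (Suc k)). tensor_eq R (P k) X (boundary d k t) [] \<longrightarrow>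
        (\<exists>u\<in>tensors X (P (Suc (Suc k))). tensor_eq R (P (Suc k)) X t (boundary d (Suc k) u)))"

lemma tor_vanishesD:
  assumes "tor_vanishes R P d k X" "t \<in> tensors X (P (Suc k))" "tensor_eq R (P k) X (boundary d k t) []"
  obtains u where "u \<in> tensors X (P (Suc (Suc k)))" "tensor_eq R (P (Suc k)) X t (boundary d (Suc k) u)"
  using assms unfolding tor_vanishes_def by blast

locale acyclic_complex =
  fixes R :: "('r, 'x) ring_scheme" and P :: "nat \<Rightarrow> ('r, 'p) module" and d :: "nat \<Rightarrow> 'p \<Rightarrow> 'p"
  assumes projective: "projective R (P i)"
    and hom: "d i \<in> module_hom R (P (Suc i)) (P i)"
    and exact: "d (Suc i) ` carrier (P (Suc (Suc i))) = a_kernel (P (Suc i)) (P i) (d i)"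
begin

lemma module: "left_module R (P i)"
  by (rule projective_left_module[OF projective])

lemma ring: "ring R"
  by (rule left_module_ring[OF module])

lemma closed: "p \<in> carrier (P (Suc i)) \<Longrightarrow> d i p \<in> carrier (P i)"
  by (rule module_homD(1)[OF hom])

lemma d_d: "p \<in> carrier (P (Suc (Suc i))) \<Longrightarrow> d i (d (Suc i) p) = \<zero>\<^bsub>P i\<^esub>"
  using exact[of i] mem_a_kernel[of "d (Suc i) p" "P (Suc i)" "P i" "d i"] by blast

lemma form_comp: "f \<in> linear_forms R (P i) \<Longrightarrow> (\<lambda>p. f (d i p)) \<in> linear_forms R (P (Suc i))"
  using module_hom_comp[OF hom] by (simp add: comp_def)

lemma form_zero: "f \<in> linear_forms R (P i) \<Longrightarrow> f \<zero>\<^bsub>P i\<^esub> = \<zero>\<^bsub>R\<^esub>"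
  using module_hom_zero[OF module left_module_regular[OF ring]] by simp

lemma boundary_tensors: "t \<in> tensors X (P (Suc i)) \<Longrightarrow> boundary d i t \<in> tensors X (P i)"
  using closed by (auto simp: in_lists_conv_set)

lemma boundary_boundary:
  assumes "left_module (opposite R) X" "t \<in> tensors X (P (Suc (Suc i)))" "f \<in> linear_forms R (P i)"
  shows "pairing X (\<lambda>p. f (d i (d (Suc i) p))) t = \<zero>\<^bsub>X\<^esub>"
  by (rule pairing_zero_form[OF assms(1) _ assms(2)]) (simp add: d_d form_zero[OF assms(3)])

text \<open>\<open>Tor\<close> vanishes on summands: apply the projection to a preimage under the boundary.\<close>

lemma tor_vanishes_retract:
  assumes "left_module (opposite R) X" "left_module (opposite R) Y" "tor_vanishes R P d k Y"
    and i: "i \<in> module_hom (opposite R) X Y" and p: "p \<in> module_hom (opposite R) Y X"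
    and pi: "\<And>x. x \<in> carrier X \<Longrightarrow> p (i x) = x"
  shows "tor_vanishes R P d k X"
  unfolding tor_vanishes_def
proof (intro ballI impI)
  fix t assume t: "t \<in> tensors X (P (Suc k))" and zero: "tensor_eq R (P k) X (boundary d k t) []"
  have it: "map (map_prod i id) t \<in> tensors Y (P (Suc k))"
    by (rule tensors_map[OF t module_homD(1)[OF i]]) simp_all
  have "tensor_eq R (P k) Y (boundary d k (map (map_prod i id) t)) []"
  proof (rule tensor_eqI)
    fix f assume f: "f \<in> linear_forms R (P k)"
    show "pairing Y f (boundary d k (map (map_prod i id) t)) = pairing Y f []"
      using tensor_eqD[OF zero f] pairing_map_fst[OF assms(1,2) i form_comp[OF f] t]
        module_hom_zero[OF assms(1,2) i] by (simp del: map_map)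
  qed
  from tor_vanishesD[OF assms(3) it this] obtain u where u: "u \<in> tensors Y (P (Suc (Suc k)))"
    "tensor_eq R (P (Suc k)) Y (map (map_prod i id) t) (boundary d (Suc k) u)" by blast
  have pu: "map (map_prod p id) u \<in> tensors X (P (Suc (Suc k)))"
    by (rule tensors_map[OF u(1) module_homD(1)[OF p]]) simp_all
  have "tensor_eq R (P (Suc k)) X t (boundary d (Suc k) (map (map_prod p id) u))"
  proof (rule tensor_eqI)
    fix f assume f: "f \<in> linear_forms R (P (Suc k))"
    have "pairing X f t = p (i (pairing X f t))"
      using pi pairing_closed[OF assms(1) f t] by simp
    also have "\<dots> = p (pairing Y f (boundary d (Suc k) u))"
      using tensor_eqD[OF u(2) f] pairing_map_fst[OF assms(1,2) i f t] by simp
    also have "\<dots> = pairing X f (boundary d (Suc k) (map (map_prod p id) u))"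
      using pairing_map_fst[OF assms(2,1) p form_comp[OF f] u(1)] by (simp del: map_map)
    finally show "pairing X f t = pairing X f (boundary d (Suc k) (map (map_prod p id) u))" .
  qed
  with pu show "\<exists>u\<in>tensors X (P (Suc (Suc k))). tensor_eq R (P (Suc k)) X t (boundary d (Suc k) u)"
    by (rule bexI[rotated])
qed

text \<open>Projective right modules have no \<open>Tor\<close>: in the coordinates of a dual basis \<open>s\<close> of \<open>Y\<close>, a cycle in
  \<open>Y \<otimes> P\<close> is a finite family of cycles in \<open>P\<close> itself, and each of them is a boundary.\<close>

lemma tor_vanishes_projective:
  fixes Y :: "('r, 'm) module"
  assumes "projective (opposite R) Y"
  shows "tor_vanishes R P d k Y"
  unfolding tor_vanishes_def
proof (intro ballI impI)
  fix t assume t: "t \<in> tensors Y (P (Suc k))" and zero: "tensor_eq R (P k) Y (boundary d k t) []"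
  note Y = projective_left_module[OF assms]
  interpret Y: left_module "opposite R" Y by (rule Y)
  interpret P1: left_module R "P (Suc k)" by (rule module)
  obtain s where s: "\<forall>q. s q \<in> linear_forms (opposite R) Y"
    "\<forall>S. finite S \<and> S \<subseteq> carrier Y \<longrightarrow> (\<exists>bs. set bs \<subseteq> carrier Y \<and>
      (\<forall>y\<in>S. lsum Y (map (\<lambda>q. s q y \<odot>\<^bsub>Y\<^esub> q) bs) = y))"
    by (rule projective_dual_basis[OF assms])
  note s = spec[OF s(1)] mp[OF spec[OF s(2)], OF conjI]
  have "finite (fst ` set t)" "fst ` set t \<subseteq> carrier Y" using t by auto
  from s(2)[OF this] obtain bs where bs: "set bs \<subseteq> carrier Y"
    "\<forall>y\<in>fst ` set t. lsum Y (map (\<lambda>q. s q y \<odot>\<^bsub>Y\<^esub> q) bs) = y" by blast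
  have sc: "s q y \<in> carrier R" if "y \<in> carrier Y" for q y
    using linear_form_closed[OF s(1) that] by simp
  have sR: "s q \<in> module_hom (opposite R) Y (regular_module (opposite R))" for q by (rule s(1))
  have RR: "left_module (opposite R) (regular_module (opposite R))"
    by (rule left_module_regular[OF ring_opposite[OF ring]])
  define c where "c q = lsum (P (Suc k)) (map (\<lambda>(y, p). s q y \<odot>\<^bsub>P (Suc k)\<^esub> p) t)" for q
  have cP: "c q \<in> carrier (P (Suc k))" for q
    unfolding c_def by (rule lsum_closed[OF module]) (use t sc in auto)
  have fc: "f (c q) = s q (pairing Y f t)" if "f \<in> linear_forms R (P (Suc k))" for f q
    unfolding c_def by (rule linear_form_pairing[OF module Y that s(1) t, symmetric])
  have dc: "d k (c q) = \<zero>\<^bsub>P k\<^esub>" for q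
  proof -
    obtain s' where s': "\<forall>q. s' q \<in> linear_forms R (P k)"
      "\<forall>S. finite S \<and> S \<subseteq> carrier (P k) \<longrightarrow> (\<exists>bs. set bs \<subseteq> carrier (P k) \<and>
        (\<forall>p\<in>S. lsum (P k) (map (\<lambda>q. s' q p \<odot>\<^bsub>P k\<^esub> q) bs) = p))"
      by (rule projective_dual_basis[OF projective])
    note s' = spec[OF s'(1)] mp[OF spec[OF s'(2)], OF conjI]
    interpret P0: left_module R "P k" by (rule module)
    have "f (d k (c q)) = \<zero>\<^bsub>R\<^esub>" if f: "f \<in> linear_forms R (P k)" for f
      using fc[OF form_comp[OF f]] tensor_eqD[OF zero f] module_hom_zero[OF Y RR sR] by simp
    then have s'c: "s' b (d k (c q)) = \<zero>\<^bsub>R\<^esub>" for b using s'(1) by blast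
    have "finite {d k (c q)}" "{d k (c q)} \<subseteq> carrier (P k)" using closed[OF cP] by simp_all
    from s'(2)[OF this] obtain bs' where bs': "set bs' \<subseteq> carrier (P k)"
      "lsum (P k) (map (\<lambda>b. s' b (d k (c q)) \<odot>\<^bsub>P k\<^esub> b) bs') = d k (c q)" by blast
    have "lsum (P k) (map (\<lambda>b. s' b (d k (c q)) \<odot>\<^bsub>P k\<^esub> b) bs') = \<zero>\<^bsub>P k\<^esub>"
      by (rule lsum_zero[OF module]) (use bs'(1) s'c P0.smult_zero_left in auto)
    with bs'(2) show ?thesis by simp
  qed
  have "\<exists>e\<in>carrier (P (Suc (Suc k))). d (Suc k) e = c q" for q
  proof -
    have "c q \<in> d (Suc k) ` carrier (P (Suc (Suc k)))"
      unfolding exact mem_a_kernel using cP dc by simp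
    then show ?thesis by auto
  qed
  then obtain e where e: "\<And>q. e q \<in> carrier (P (Suc (Suc k)))" "\<And>q. d (Suc k) (e q) = c q"
    by metis
  let ?u = "map (\<lambda>q. (q, e q)) bs"
  have u: "?u \<in> tensors Y (P (Suc (Suc k)))" using e(1) bs(1) by (auto simp: in_lists_conv_set)
  have "tensor_eq R (P (Suc k)) Y t (boundary d (Suc k) ?u)"
  proof (rule tensor_eqI)
    fix f assume f: "f \<in> linear_forms R (P (Suc k))"
    note fcl = linear_form_closed[OF f]
    let ?h = "\<lambda>y. lsum Y (map (\<lambda>q. s q y \<odot>\<^bsub>Y\<^esub> q) bs)"
    have h: "?h \<in> module_hom (opposite R) Y Y"
    proof (rule module_hom_lsum_fun[OF Y Y])
      fix q assume "q \<in> set bs"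
      then have q: "q \<in> carrier Y" using bs(1) by blast
      show "(\<lambda>y. s q y \<odot>\<^bsub>Y\<^esub> q) \<in> module_hom (opposite R) Y Y"
      proof (rule module_homI)
        show "s q (x \<oplus>\<^bsub>Y\<^esub> y) \<odot>\<^bsub>Y\<^esub> q = s q x \<odot>\<^bsub>Y\<^esub> q \<oplus>\<^bsub>Y\<^esub> s q y \<odot>\<^bsub>Y\<^esub> q"
          if "x \<in> carrier Y" "y \<in> carrier Y" for x y
          using Y.smult_l_distr[of "s q x" "s q y" q] module_homD(2)[OF sR that, of q] that q sc by simp
        show "s q (a \<odot>\<^bsub>Y\<^esub> x) \<odot>\<^bsub>Y\<^esub> q = a \<odot>\<^bsub>Y\<^esub> (s q x \<odot>\<^bsub>Y\<^esub> q)"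
          if "a \<in> carrier (opposite R)" "x \<in> carrier Y" for a x
          using Y.smult_assoc1[of a "s q x" q] module_homD(3)[OF sR that, of q] that q sc by simp
      qed (use q sc Y.smult_closed in auto)
    qed
    have "map (\<lambda>(y, p). f p \<odot>\<^bsub>Y\<^esub> ?h y) t = map (\<lambda>(y, p). f p \<odot>\<^bsub>Y\<^esub> y) t"
      by (rule map_cong) (use bs(2) in force)+
    then have "pairing Y f t = pairing Y f (map (map_prod ?h id) t)"
      unfolding pairing_def by (simp add: comp_def case_prod_unfold del: map_eq_conv)
    also have "\<dots> = ?h (pairing Y f t)"
      by (rule pairing_map_fst[OF Y Y h f t])
    also have "\<dots> = lsum Y (map (\<lambda>q. f (c q) \<odot>\<^bsub>Y\<^esub> q) bs)"
      by (simp add: fc[OF f])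
    also have "\<dots> = pairing Y f (boundary d (Suc k) ?u)"
      by (simp add: pairing_def e(2) comp_def)
    finally show "pairing Y f t = pairing Y f (boundary d (Suc k) ?u)" .
  qed
  with u show "\<exists>u\<in>tensors Y (P (Suc (Suc k))). tensor_eq R (P (Suc k)) Y t (boundary d (Suc k) u)"
    by (rule bexI[rotated])
qed

end

section \<open>Direct sums and summands\<close>

lemma module_hom_sub_mod_cod:
  assumes "submodule H R N" "f \<in> module_hom R M (sub_mod N H)"
  shows "f \<in> module_hom R M N"
  using module_homD[OF assms(2)] submoduleD(1)[OF assms(1)] by (intro module_homI) simp_all

lemma complement_projection:
  assumes "left_module R M" "submodule B R M" "submodule C R M"
    and sum: "B <+>\<^bsub>M\<^esub> C = carrier M" and int: "B \<inter> C = {\<zero>\<^bsub>M\<^esub>}"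
  obtains p where "p \<in> module_hom R M (sub_mod M B)" "\<forall>x\<in>B. p x = x"
proof -
  interpret left_module R M by fact
  note B = submoduleD[OF assms(2)] and C = submoduleD[OF assms(3)]
  have "\<exists>b\<in>B. \<exists>c\<in>C. x = b \<oplus>\<^bsub>M\<^esub> c" if "x \<in> carrier M" for x
    using that mem_set_add[of x M B C] unfolding sum by blast
  then obtain p c where pc: "\<And>x. x \<in> carrier M \<Longrightarrow> p x \<in> B" "\<And>x. x \<in> carrier M \<Longrightarrow> c x \<in> C"
    "\<And>x. x \<in> carrier M \<Longrightarrow> x = p x \<oplus>\<^bsub>M\<^esub> c x" by metis
  have unique: "p x = b" if bc: "b \<in> B" "c' \<in> C" "x = b \<oplus>\<^bsub>M\<^esub> c'" for x b c'
  proof -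
    have x: "x \<in> carrier M" using bc B(1) C(1) by simp
    note cl = B(1)[OF bc(1)] C(1)[OF bc(2)] B(1)[OF pc(1)[OF x]] C(1)[OF pc(2)[OF x]]
    have "p x \<oplus>\<^bsub>M\<^esub> c x = b \<oplus>\<^bsub>M\<^esub> c'" using pc(3)[OF x] bc(3) by simp
    then have "p x \<oplus>\<^bsub>M\<^esub> c x \<oplus>\<^bsub>M\<^esub> \<ominus>\<^bsub>M\<^esub> c x = b \<oplus>\<^bsub>M\<^esub> c' \<oplus>\<^bsub>M\<^esub> \<ominus>\<^bsub>M\<^esub> c x" by simp
    then have px: "p x = b \<oplus>\<^bsub>M\<^esub> (c' \<oplus>\<^bsub>M\<^esub> \<ominus>\<^bsub>M\<^esub> c x)" using cl by (simp add: M.a_assoc M.r_neg)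
    have "c' \<oplus>\<^bsub>M\<^esub> \<ominus>\<^bsub>M\<^esub> c x \<in> C" using C(4)[OF bc(2) C(6)[OF pc(2)[OF x]]] .
    moreover have "\<ominus>\<^bsub>M\<^esub> b \<oplus>\<^bsub>M\<^esub> p x = c' \<oplus>\<^bsub>M\<^esub> \<ominus>\<^bsub>M\<^esub> c x" unfolding px using cl by (simp add: M.r_neg1)
    then have "c' \<oplus>\<^bsub>M\<^esub> \<ominus>\<^bsub>M\<^esub> c x \<in> B" using B(4)[OF B(6)[OF bc(1)] pc(1)[OF x]] by simp
    ultimately have "c' \<oplus>\<^bsub>M\<^esub> \<ominus>\<^bsub>M\<^esub> c x = \<zero>\<^bsub>M\<^esub>" using int by blast
    then show ?thesis using px cl by simp
  qed
  have "p \<in> module_hom R M (sub_mod M B)"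
  proof (rule module_homI)
    show "p x \<in> carrier (sub_mod M B)" if "x \<in> carrier M" for x using pc(1)[OF that] by simp
    show "p (x \<oplus>\<^bsub>M\<^esub> y) = p x \<oplus>\<^bsub>sub_mod M B\<^esub> p y" if x: "x \<in> carrier M" and y: "y \<in> carrier M" for x y
    proof -
      have "x \<oplus>\<^bsub>M\<^esub> y = (p x \<oplus>\<^bsub>M\<^esub> c x) \<oplus>\<^bsub>M\<^esub> (p y \<oplus>\<^bsub>M\<^esub> c y)"
        using pc(3)[OF x] pc(3)[OF y] by simp
      also have "\<dots> = (p x \<oplus>\<^bsub>M\<^esub> p y) \<oplus>\<^bsub>M\<^esub> (c x \<oplus>\<^bsub>M\<^esub> c y)"
        using B(1)[OF pc(1)[OF x]] B(1)[OF pc(1)[OF y]] C(1)[OF pc(2)[OF x]] C(1)[OF pc(2)[OF y]]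
        by (simp add: M.a_ac)
      finally have "x \<oplus>\<^bsub>M\<^esub> y = (p x \<oplus>\<^bsub>M\<^esub> p y) \<oplus>\<^bsub>M\<^esub> (c x \<oplus>\<^bsub>M\<^esub> c y)" .
      from unique[OF B(4)[OF pc(1)[OF x] pc(1)[OF y]] C(4)[OF pc(2)[OF x] pc(2)[OF y]] this]
      show ?thesis by simp
    qed
    show "p (a \<odot>\<^bsub>M\<^esub> x) = a \<odot>\<^bsub>sub_mod M B\<^esub> p x" if a: "a \<in> carrier R" and x: "x \<in> carrier M" for a x
    proof -
      have "a \<odot>\<^bsub>M\<^esub> x = a \<odot>\<^bsub>M\<^esub> p x \<oplus>\<^bsub>M\<^esub> a \<odot>\<^bsub>M\<^esub> c x"
        using pc(3)[OF x] smult_r_distr[OF a B(1)[OF pc(1)[OF x]] C(1)[OF pc(2)[OF x]]] by simp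
      from unique[OF B(5)[OF a pc(1)[OF x]] C(5)[OF a pc(2)[OF x]] this] show ?thesis by simp
    qed
  qed
  moreover have "\<forall>x\<in>B. p x = x"
    using unique[OF _ C(3)] B(1) by simp
  ultimately show ?thesis by (rule that)
qed

text \<open>The coordinates of an element are linear in it because decompositions are unique: the sum of two
  decompositions, on the union of their supports, is the decomposition of the sum.\<close>

lemma internal_direct_sum_projections:
  fixes M :: "('r, 'm) module" and A :: "'i \<Rightarrow> 'm set"
  assumes M: "left_module R M" and sum: "internal_direct_sum R M I A"
  obtains \<pi> where "\<forall>i\<in>I. \<pi> i \<in> module_hom R M (sub_mod M (A i))"
    "\<forall>S. finite S \<and> S \<subseteq> carrier M \<longrightarrow> (\<exists>is. set is \<subseteq> I \<and> (\<forall>x\<in>S. lsum M (map (\<lambda>i. \<pi> i x) is) = x))"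
proof -
  interpret left_module R M by (rule M)
  have sub: "submodule (A i) R M" if "i \<in> I" for i
    using sum that by (simp add: internal_direct_sum_def)
  note A = submoduleD[OF sub]
  define supp where "supp a = {i\<in>I. a i \<noteq> \<zero>\<^bsub>M\<^esub>}" for a
  define dec where "dec a x \<longleftrightarrow> a \<in> (\<Pi>\<^sub>E i\<in>I. A i) \<and> finite (supp a) \<and> x = finsum M a (supp a)" for a x
  have ex1: "\<exists>!a. dec a x" if "x \<in> carrier M" for x
    using sum that unfolding internal_direct_sum_def dec_def supp_def by blast
  have lsum_eq: "finsum M a (supp a) = lsum M (map a is)"
    if a: "a \<in> (\<Pi>\<^sub>E i\<in>I. A i)" and d: "distinct is" and s: "supp a \<subseteq> set is" "set is \<subseteq> I" for a "is"
  proof -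
    have aM: "a i \<in> carrier M" if "i \<in> I" for i using PiE_mem[OF a that] A(1)[OF that] by blast
    have "finsum M a (supp a) = finsum M a (set is)"
    proof (rule M.add.finprod_mono_neutral_cong_left)
      show "a i = \<zero>\<^bsub>M\<^esub>" if "i \<in> set is - supp a" for i using that s(2) by (auto simp: supp_def)
      show "a \<in> set is \<rightarrow> carrier M" using aM s(2) by blast
    qed (use s(1) in simp_all)
    also have "\<dots> = lsum M (map a is)"
      by (rule lsum_eq_finsum[symmetric, OF M d]) (use aM s(2) in blast)
    finally show ?thesis .
  qed
  have decI: "dec a x" if a: "a \<in> (\<Pi>\<^sub>E i\<in>I. A i)" and d: "distinct is" and s: "supp a \<subseteq> set is" "set is \<subseteq> I"
    and x: "x = lsum M (map a is)" for a x "is"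
    unfolding dec_def using lsum_eq[OF a d s] a x finite_subset[OF s(1)] by simp
  define c where "c x = (THE a. dec a x)" for x
  have c: "dec (c x) x" if "x \<in> carrier M" for x
    unfolding c_def by (rule theI'[OF ex1[OF that]])
  have c_eq: "c x = a" if "x \<in> carrier M" "dec a x" for x a
    using ex1[OF that(1)] that(2) c[OF that(1)] by blast
  have cA: "c x \<in> (\<Pi>\<^sub>E i\<in>I. A i)" "finite (supp (c x))" if "x \<in> carrier M" for x
    using c[OF that] by (simp_all add: dec_def)
  have cM: "c x i \<in> A i" "c x i \<in> carrier M" if "x \<in> carrier M" "i \<in> I" for x i
    using PiE_mem[OF cA(1)[OF that(1)] that(2)] A(1)[OF that(2)] by blast+
  have cs: "lsum M (map (c x) is) = x"
    if x: "x \<in> carrier M" and d: "distinct is" and s: "supp (c x) \<subseteq> set is" "set is \<subseteq> I" for x "is"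
    using c[OF x] lsum_eq[OF cA(1)[OF x] d s] by (simp add: dec_def)
  have supps: "\<exists>is. distinct is \<and> set is \<subseteq> I \<and> (\<forall>x\<in>S. supp (c x) \<subseteq> set is)"
    if S: "finite S" "S \<subseteq> carrier M" for S
  proof -
    have "finite (\<Union>x\<in>S. supp (c x))" by (rule finite_UN_I[OF S(1) cA(2)]) (use S(2) in blast)
    from finite_distinct_list[OF this] obtain "is" where
      "set is = (\<Union>x\<in>S. supp (c x))" "distinct is" by (elim exE conjE)
    then show ?thesis by (intro exI[of _ "is"]) (auto simp: supp_def)
  qed
  show ?thesis
  proof (rule that[of "\<lambda>i x. c x i"]; intro ballI allI impI; (elim conjE)?)
    fix i assume i: "i \<in> I"
    show "(\<lambda>x. c x i) \<in> module_hom R M (sub_mod M (A i))"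
    proof (rule module_homI)
      show "c x i \<in> carrier (sub_mod M (A i))" if "x \<in> carrier M" for x
        using cM(1)[OF that i] by simp
    next
      fix x y assume xy: "x \<in> carrier M" "y \<in> carrier M"
      let ?a = "\<lambda>i\<in>I. c x i \<oplus>\<^bsub>M\<^esub> c y i"
      have "finite {x, y}" "{x, y} \<subseteq> carrier M" using xy by simp_all
      from supps[OF this] obtain "is" where "is": "distinct is" "set is \<subseteq> I"
        "supp (c x) \<subseteq> set is" "supp (c y) \<subseteq> set is" by auto
      have "dec ?a (x \<oplus>\<^bsub>M\<^esub> y)"
      proof (rule decI[OF _ "is"(1) _ "is"(2)])
        show "?a \<in> (\<Pi>\<^sub>E i\<in>I. A i)" using A(4) cM(1) xy by auto
        show "supp ?a \<subseteq> set is"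
        proof
          fix j assume j: "j \<in> supp ?a"
          then have "c x j \<noteq> \<zero>\<^bsub>M\<^esub> \<or> c y j \<noteq> \<zero>\<^bsub>M\<^esub>" by (auto simp: supp_def)
          with j "is"(3,4) show "j \<in> set is" by (auto simp: supp_def)
        qed
        have "lsum M (map ?a is) = lsum M (map (\<lambda>i. c x i \<oplus>\<^bsub>M\<^esub> c y i) is)"
          by (rule arg_cong[where f = "lsum M"], rule map_cong) (use "is"(2) in auto)
        also have "\<dots> = x \<oplus>\<^bsub>M\<^esub> y"
          using lsum_map_add[OF M, of "is" "c x" "c y"] cs[OF xy(1) "is"(1,3,2)] cs[OF xy(2) "is"(1,4,2)]
            cM(2) xy "is"(2) by (simp add: subset_iff)
        finally show "x \<oplus>\<^bsub>M\<^esub> y = lsum M (map ?a is)" by simp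
      qed
      from c_eq[OF _ this] xy i show "c (x \<oplus>\<^bsub>M\<^esub> y) i = c x i \<oplus>\<^bsub>sub_mod M (A i)\<^esub> c y i" by simp
    next
      fix r x assume r: "r \<in> carrier R" and x: "x \<in> carrier M"
      let ?a = "\<lambda>i\<in>I. r \<odot>\<^bsub>M\<^esub> c x i"
      have "finite {x}" "{x} \<subseteq> carrier M" using x by simp_all
      from supps[OF this] obtain "is" where "is": "distinct is" "set is \<subseteq> I" "supp (c x) \<subseteq> set is" by auto
      have "dec ?a (r \<odot>\<^bsub>M\<^esub> x)"
      proof (rule decI[OF _ "is"(1) _ "is"(2)])
        show "?a \<in> (\<Pi>\<^sub>E i\<in>I. A i)" using A(5) cM(1) x r by auto
        show "supp ?a \<subseteq> set is"
        proof
          fix j assume j: "j \<in> supp ?a"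
          then have "c x j \<noteq> \<zero>\<^bsub>M\<^esub>" using r by (auto simp: supp_def)
          with j "is"(3) show "j \<in> set is" by (auto simp: supp_def)
        qed
        have "lsum M (map ?a is) = lsum M (map (\<lambda>i. r \<odot>\<^bsub>M\<^esub> c x i) is)"
          by (rule arg_cong[where f = "lsum M"], rule map_cong) (use "is"(2) in auto)
        also have "\<dots> = r \<odot>\<^bsub>M\<^esub> x"
          using smult_lsum[OF M r, of "is" "c x"] cs[OF x "is"(1,3,2)] cM(2) x "is"(2)
          by (simp add: subset_iff)
        finally show "r \<odot>\<^bsub>M\<^esub> x = lsum M (map ?a is)" by simp
      qed
      from c_eq[OF _ this] x r i show "c (r \<odot>\<^bsub>M\<^esub> x) i = r \<odot>\<^bsub>sub_mod M (A i)\<^esub> c x i" by simp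
    qed
  next
    fix S assume S: "finite S" "S \<subseteq> carrier M"
    from supps[OF this] obtain "is" where "is": "distinct is" "set is \<subseteq> I"
      "\<forall>x\<in>S. supp (c x) \<subseteq> set is" by blast
    have "lsum M (map (\<lambda>i. c x i) is) = x" if "x \<in> S" for x
      using cs[OF subsetD[OF S(2) that] "is"(1) bspec[OF "is"(3) that] "is"(2)] .
    with "is"(2) show "\<exists>is. set is \<subseteq> I \<and> (\<forall>x\<in>S. lsum M (map (\<lambda>i. c x i) is) = x)" by blast
  qed
qed

section \<open>Behaviour of Tor under exact sequences and direct sums\<close>

lemma lift_tensor:
  assumes "g ` carrier Y = carrier X" "t \<in> tensors X P"
  obtains y where "y \<in> tensors Y P" "map (map_prod g id) y = t"
proof -
  have "map_prod g id ` (carrier Y \<times> carrier P) = carrier X \<times> carrier P"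
    unfolding assms(1)[symmetric] by force
  then have "t \<in> lists (map_prod g id ` (carrier Y \<times> carrier P))" using assms(2) by simp
  then show ?thesis using that unfolding lists_image by blast
qed

lemma tensors_sub_mod: "N \<subseteq> carrier X \<Longrightarrow> t \<in> tensors (sub_mod X N) P \<Longrightarrow> t \<in> tensors X P"
  by (auto simp: in_lists_conv_set)

lemma tensor_eq_sub_mod [simp]: "tensor_eq R P (sub_mod X N) t u = tensor_eq R P X t u"
  by (simp add: tensor_eq_def)

context acyclic_complex
begin

text \<open>Dimension shifting.  Both directions chase cycles through the short exact sequence of complexes
  that \<open>0 \<rightarrow> ker g \<rightarrow> Y \<rightarrow> X \<rightarrow> 0\<close> induces; the complex in the middle is exact.\<close>

context
  fixes X :: "('r, 'm) module" and Y :: "('r, 'n) module" and g :: "'n \<Rightarrow> 'm"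
  assumes X: "left_module (opposite R) X" and Y: "left_module (opposite R) Y"
    and g: "g \<in> module_hom (opposite R) Y X" and surj: "g ` carrier Y = carrier X"
    and Y0: "\<And>k. tor_vanishes R P d k Y"
begin

interpretation X: left_module "opposite R" X by (rule X)
interpretation Y: left_module "opposite R" Y by (rule Y)

abbreviation (input) "N \<equiv> sub_mod Y (a_kernel Y X g)"

lemma N: "left_module (opposite R) N"
  by (rule left_module_sub_mod[OF Y submodule_a_kernel[OF Y X g]])

lemma N_Y: "t \<in> tensors N Q \<Longrightarrow> t \<in> tensors Y Q"
  by (erule tensors_sub_mod[rotated]) (auto simp: mem_a_kernel)

lemma g_tensors: "t \<in> tensors Y Q \<Longrightarrow> map (map_prod g id) t \<in> tensors X Q"
  by (erule tensors_map[OF _ module_homD(1)[OF g]]) simp_all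

lemma minus_tensors: "t \<in> tensors Y Q \<Longrightarrow> map (map_prod (a_inv Y) id) t \<in> tensors Y Q"
  by (erule tensors_map) simp_all

lemma pairing_N:
  assumes "f \<in> linear_forms R Q" "t \<in> tensors N Q"
  shows "g (pairing Y f t) = \<zero>\<^bsub>X\<^esub>"
  using pairing_closed[OF N assms] by (simp add: mem_a_kernel)

lemma pairing_minus:
  assumes "f \<in> linear_forms R Q" "t \<in> tensors Y Q" "u \<in> tensors Y Q"
  shows "pairing Y f (t @ map (map_prod (a_inv Y) id) u) = pairing Y f t \<oplus>\<^bsub>Y\<^esub> \<ominus>\<^bsub>Y\<^esub> pairing Y f u"
  using pairing_append[OF Y assms(1,2) minus_tensors[OF assms(3)]] pairing_map_minus[OF Y assms(1,3)]
  by simp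

lemma tor_shift_down:
  assumes "tor_vanishes R P d (Suc k) X"
  shows "tor_vanishes R P d k N"
  unfolding tor_vanishes_def
proof (intro ballI impI)
  fix t assume t: "t \<in> tensors N (P (Suc k))" and zero: "tensor_eq R (P k) N (boundary d k t) []"
  note tY = N_Y[OF t]
  from zero have "tensor_eq R (P k) Y (boundary d k t) []" by simp
  from tor_vanishesD[OF Y0 tY this] obtain u where u: "u \<in> tensors Y (P (Suc (Suc k)))"
    "tensor_eq R (P (Suc k)) Y t (boundary d (Suc k) u)" by blast
  note gu = g_tensors[OF u(1)]
  have "tensor_eq R (P (Suc k)) X (boundary d (Suc k) (map (map_prod g id) u)) []"
  proof (rule tensor_eqI)
    fix f assume f: "f \<in> linear_forms R (P (Suc k))"
    have "pairing X f (boundary d (Suc k) (map (map_prod g id) u)) = g (pairing Y f t)"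
      using pairing_map_fst[OF Y X g form_comp[OF f] u(1)] tensor_eqD[OF u(2) f]
      by (simp del: map_map)
    then show "pairing X f (boundary d (Suc k) (map (map_prod g id) u)) = pairing X f []"
      using pairing_N[OF f t] by simp
  qed
  from tor_vanishesD[OF assms gu this] obtain v where v: "v \<in> tensors X (P (Suc (Suc (Suc k))))"
    "tensor_eq R (P (Suc (Suc k))) X (map (map_prod g id) u) (boundary d (Suc (Suc k)) v)" by blast
  obtain w where w: "w \<in> tensors Y (P (Suc (Suc (Suc k))))" "map (map_prod g id) w = v"
    by (rule lift_tensor[OF surj v(1)])
  note dw = boundary_tensors[OF w(1)]
  \<comment> \<open>Subtracting a boundary from \<open>u\<close> changes \<open>d u\<close> by nothing and moves \<open>u\<close> into the kernel of \<open>g\<close>.\<close>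
  let ?z = "u @ map (map_prod (a_inv Y) id) (boundary d (Suc (Suc k)) w)"
  have z: "?z \<in> tensors Y (P (Suc (Suc k)))"
    using u(1) minus_tensors[OF dw] by (simp del: map_map)
  have "tensor_eq R (P (Suc (Suc k))) X (map (map_prod g id) ?z) []"
  proof (rule tensor_eqI)
    fix f assume f: "f \<in> linear_forms R (P (Suc (Suc k)))"
    note pu = pairing_closed[OF Y f u(1)] and pw = pairing_closed[OF Y f dw]
    have "g (pairing Y f u) = pairing X f (boundary d (Suc (Suc k)) v)"
      using pairing_map_fst[OF Y X g f u(1)] tensor_eqD[OF v(2) f] by simp
    also have "\<dots> = g (pairing Y f (boundary d (Suc (Suc k)) w))"
      using pairing_map_fst[OF Y X g form_comp[OF f] w(1)] unfolding w(2) by simp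
    finally have eq: "g (pairing Y f u) = g (pairing Y f (boundary d (Suc (Suc k)) w))" .
    have "pairing X f (map (map_prod g id) ?z) = g (pairing Y f ?z)"
      by (rule pairing_map_fst[OF Y X g f z])
    also have "\<dots> = g (pairing Y f u) \<oplus>\<^bsub>X\<^esub> \<ominus>\<^bsub>X\<^esub> g (pairing Y f (boundary d (Suc (Suc k)) w))"
      unfolding pairing_minus[OF f u(1) dw]
      using module_homD(2)[OF g pu Y.M.a_inv_closed[OF pw]] module_hom_minus[OF Y X g pw] by simp
    also have "\<dots> = \<zero>\<^bsub>X\<^esub>"
      unfolding eq by (rule X.M.r_neg[OF module_homD(1)[OF g pw]])
    finally show "pairing X f (map (map_prod g id) ?z) = pairing X f []" by simp
  qed
  then obtain z' where z': "z' \<in> tensors N (P (Suc (Suc k)))" "tensor_eq R (P (Suc (Suc k))) Y ?z z'"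
    by (rule tensor_kernel[OF projective X Y g z])
  have "tensor_eq R (P (Suc k)) N t (boundary d (Suc k) z')"
  proof (rule tensor_eqI)
    fix f assume f: "f \<in> linear_forms R (P (Suc k))"
    note fd = form_comp[OF f]
    have tc: "pairing Y f t \<in> carrier Y" by (rule pairing_closed[OF Y f tY])
    have "pairing Y f (boundary d (Suc k) z') = pairing Y (\<lambda>p. f (d (Suc k) p)) ?z"
      using tensor_eqD[OF z'(2) fd] by simp
    also have "\<dots> = pairing Y f t \<oplus>\<^bsub>Y\<^esub> \<ominus>\<^bsub>Y\<^esub> \<zero>\<^bsub>Y\<^esub>"
      unfolding pairing_minus[OF fd u(1) dw]
      using tensor_eqD[OF u(2) f] boundary_boundary[OF Y w(1) f] by simp
    also have "\<dots> = pairing Y f t" using tc by simp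
    finally show "pairing N f t = pairing N f (boundary d (Suc k) z')" by simp
  qed
  with z'(1) show "\<exists>u\<in>tensors N (P (Suc (Suc k))). tensor_eq R (P (Suc k)) N t (boundary d (Suc k) u)"
    by (rule bexI[rotated])
qed

lemma tor_shift_up:
  assumes "tor_vanishes R P d k N"
  shows "tor_vanishes R P d (Suc k) X"
  unfolding tor_vanishes_def
proof (intro ballI impI)
  fix t assume t: "t \<in> tensors X (P (Suc (Suc k)))"
    and zero: "tensor_eq R (P (Suc k)) X (boundary d (Suc k) t) []"
  obtain y where y: "y \<in> tensors Y (P (Suc (Suc k)))" "map (map_prod g id) y = t"
    by (rule lift_tensor[OF surj t])
  note dy = boundary_tensors[OF y(1)]
  have "tensor_eq R (P (Suc k)) X (map (map_prod g id) (boundary d (Suc k) y)) []"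
  proof (rule tensor_eqI)
    fix f assume f: "f \<in> linear_forms R (P (Suc k))"
    have "pairing X f (map (map_prod g id) (boundary d (Suc k) y)) = g (pairing Y f (boundary d (Suc k) y))"
      by (rule pairing_map_fst[OF Y X g f dy])
    also have "\<dots> = pairing X f (boundary d (Suc k) t)"
      using pairing_map_fst[OF Y X g form_comp[OF f] y(1)] unfolding y(2) by simp
    finally show "pairing X f (map (map_prod g id) (boundary d (Suc k) y)) = pairing X f []"
      using tensor_eqD[OF zero f] by simp
  qed
  then obtain z where z: "z \<in> tensors N (P (Suc k))" "tensor_eq R (P (Suc k)) Y (boundary d (Suc k) y) z"
    by (rule tensor_kernel[OF projective X Y g dy])
  have "tensor_eq R (P k) N (boundary d k z) []"
  proof (rule tensor_eqI)
    fix f assume f: "f \<in> linear_forms R (P k)"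
    show "pairing N f (boundary d k z) = pairing N f []"
      using tensor_eqD[OF z(2) form_comp[OF f]] boundary_boundary[OF Y y(1) f] by simp
  qed
  from tor_vanishesD[OF assms z(1) this] obtain u where u: "u \<in> tensors N (P (Suc (Suc k)))"
    "tensor_eq R (P (Suc k)) N z (boundary d (Suc k) u)" by blast
  note uY = N_Y[OF u(1)]
  \<comment> \<open>The lift \<open>y\<close> of the cycle \<open>t\<close> is itself a cycle after this correction by an element over \<open>ker g\<close>.\<close>
  let ?c = "y @ map (map_prod (a_inv Y) id) u"
  have c: "?c \<in> tensors Y (P (Suc (Suc k)))"
    using y(1) minus_tensors[OF uY] by simp
  have "tensor_eq R (P (Suc k)) Y (boundary d (Suc k) ?c) []"
  proof (rule tensor_eqI)
    fix f assume f: "f \<in> linear_forms R (P (Suc k))"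
    have "pairing Y f (boundary d (Suc k) ?c) =
        pairing Y (\<lambda>p. f (d (Suc k) p)) y \<oplus>\<^bsub>Y\<^esub> \<ominus>\<^bsub>Y\<^esub> pairing Y (\<lambda>p. f (d (Suc k) p)) u"
      unfolding pairing_map_snd by (rule pairing_minus[OF form_comp[OF f] y(1) uY])
    also have "pairing Y (\<lambda>p. f (d (Suc k) p)) y = pairing Y (\<lambda>p. f (d (Suc k) p)) u"
      using tensor_eqD[OF z(2) f] tensor_eqD[OF u(2) f] by simp
    also have "pairing Y (\<lambda>p. f (d (Suc k) p)) u \<oplus>\<^bsub>Y\<^esub> \<ominus>\<^bsub>Y\<^esub> pairing Y (\<lambda>p. f (d (Suc k) p)) u = \<zero>\<^bsub>Y\<^esub>"
      by (rule Y.M.r_neg[OF pairing_closed[OF Y form_comp[OF f] uY]])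
    finally show "pairing Y f (boundary d (Suc k) ?c) = pairing Y f []" by (simp only: pairing_Nil)
  qed
  from tor_vanishesD[OF Y0 c this] obtain w where w: "w \<in> tensors Y (P (Suc (Suc (Suc k))))"
    "tensor_eq R (P (Suc (Suc k))) Y ?c (boundary d (Suc (Suc k)) w)" by blast
  have "tensor_eq R (P (Suc (Suc k))) X t (boundary d (Suc (Suc k)) (map (map_prod g id) w))"
  proof (rule tensor_eqI)
    fix f assume f: "f \<in> linear_forms R (P (Suc (Suc k)))"
    note py = pairing_closed[OF Y f y(1)] and pu = pairing_closed[OF Y f uY]
    have "pairing X f (boundary d (Suc (Suc k)) (map (map_prod g id) w)) = g (pairing Y f ?c)"
      using pairing_map_fst[OF Y X g form_comp[OF f] w(1)] tensor_eqD[OF w(2) f]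
      by (simp del: map_map)
    also have "\<dots> = g (pairing Y f y) \<oplus>\<^bsub>X\<^esub> \<ominus>\<^bsub>X\<^esub> g (pairing Y f u)"
      unfolding pairing_minus[OF f y(1) uY]
      using module_homD(2)[OF g py Y.M.a_inv_closed[OF pu]] module_hom_minus[OF Y X g pu] by simp
    also have "\<dots> = pairing X f t"
      using pairing_N[OF f u(1)] pairing_map_fst[OF Y X g f y(1)] module_homD(1)[OF g py]
      unfolding y(2) by simp
    finally show "pairing X f t = pairing X f (boundary d (Suc (Suc k)) (map (map_prod g id) w))" by simp
  qed
  with g_tensors[OF w(1)]
  show "\<exists>u\<in>tensors X (P (Suc (Suc (Suc k)))).
      tensor_eq R (P (Suc (Suc k))) X t (boundary d (Suc (Suc k)) u)"
    by (rule bexI[rotated])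
qed

end

lemma tor_vanishes_iso:
  assumes "left_module (opposite R) X" "left_module (opposite R) Y" "module_iso (opposite R) X Y"
  shows "tor_vanishes R P d k X \<longleftrightarrow> tor_vanishes R P d k Y"
proof -
  obtain f where f: "f \<in> module_hom (opposite R) X Y" "bij_betw f (carrier X) (carrier Y)"
    using assms(3) unfolding module_iso_def by blast
  let ?h = "the_inv_into (carrier X) f"
  have hf: "?h (f x) = x" if "x \<in> carrier X" for x
    using the_inv_into_f_f[OF bij_betw_imp_inj_on[OF f(2)] that] .
  have h: "?h \<in> module_hom (opposite R) Y X" by (rule module_hom_inv[OF assms(1) f])
  have fh: "f (?h y) = y" if "y \<in> carrier Y" for y
    using f_the_inv_into_f_bij_betw[OF f(2)] that by simp
  show ?thesis
    using tor_vanishes_retract[OF assms(1,2) _ f(1) h hf] tor_vanishes_retract[OF assms(2,1) _ h f(1) fh]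
    by blast
qed

text \<open>A direct sum, finite or not, has no \<open>Tor\<close> if no summand has: only finitely many projections are
  needed to recover the elements of \<open>X\<close> that occur in a given cycle.\<close>

lemma tor_vanishes_direct_sum:
  assumes X: "left_module (opposite R) X" and sum: "internal_direct_sum (opposite R) X I A"
    and van: "\<And>i. i \<in> I \<Longrightarrow> tor_vanishes R P d k (sub_mod X (A i))"
  shows "tor_vanishes R P d k X"
  unfolding tor_vanishes_def
proof (intro ballI impI)
  fix t assume t: "t \<in> tensors X (P (Suc k))" and zero: "tensor_eq R (P k) X (boundary d k t) []"
  obtain \<pi> where \<pi>: "\<forall>i\<in>I. \<pi> i \<in> module_hom (opposite R) X (sub_mod X (A i))"
    "\<forall>S. finite S \<and> S \<subseteq> carrier X \<longrightarrow> (\<exists>is. set is \<subseteq> I \<and> (\<forall>x\<in>S. lsum X (map (\<lambda>i. \<pi> i x) is) = x))"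
    by (rule internal_direct_sum_projections[OF X sum])
  have sub: "submodule (A i) (opposite R) X" if "i \<in> I" for i
    using sum that by (simp add: internal_direct_sum_def)
  have "finite (fst ` set t) \<and> fst ` set t \<subseteq> carrier X" using t by auto
  from mp[OF spec[OF \<pi>(2)] this] obtain "is" where "is": "set is \<subseteq> I"
    "\<forall>x\<in>fst ` set t. lsum X (map (\<lambda>i. \<pi> i x) is) = x" by blast
  have "\<exists>u. u \<in> tensors X (P (Suc (Suc k))) \<and> (\<forall>f\<in>linear_forms R (P (Suc k)).
      pairing X (\<lambda>p. f (d (Suc k) p)) u = \<pi> i (pairing X f t))" if i: "i \<in> I" for i
  proof -
    note \<pi>i = bspec[OF \<pi>(1) i] and A = left_module_sub_mod[OF X sub[OF i]]
    have \<pi>t: "map (map_prod (\<pi> i) id) t \<in> tensors (sub_mod X (A i)) (P (Suc k))"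
      by (rule tensors_map[OF t module_homD(1)[OF \<pi>i]]) simp_all
    have "tensor_eq R (P k) (sub_mod X (A i)) (boundary d k (map (map_prod (\<pi> i) id) t)) []"
    proof (rule tensor_eqI)
      fix f assume f: "f \<in> linear_forms R (P k)"
      show "pairing (sub_mod X (A i)) f (boundary d k (map (map_prod (\<pi> i) id) t)) =
          pairing (sub_mod X (A i)) f []"
        using pairing_map_fst[OF X A \<pi>i form_comp[OF f] t] tensor_eqD[OF zero f]
          module_hom_zero[OF X A \<pi>i] by (simp del: map_map)
    qed
    from tor_vanishesD[OF van[OF i] \<pi>t this] obtain u where
      u: "u \<in> tensors (sub_mod X (A i)) (P (Suc (Suc k)))"
      "tensor_eq R (P (Suc k)) (sub_mod X (A i)) (map (map_prod (\<pi> i) id) t) (boundary d (Suc k) u)"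
      by blast
    have "pairing X (\<lambda>p. f (d (Suc k) p)) u = \<pi> i (pairing X f t)"
      if f: "f \<in> linear_forms R (P (Suc k))" for f
      using tensor_eqD[OF u(2) f] pairing_map_fst[OF X A \<pi>i f t] by simp
    with tensors_sub_mod[OF submoduleD(2)[OF sub[OF i]] u(1)] show ?thesis by blast
  qed
  then obtain U where U: "\<And>i. i \<in> I \<Longrightarrow> U i \<in> tensors X (P (Suc (Suc k)))"
    "\<And>i f. i \<in> I \<Longrightarrow> f \<in> linear_forms R (P (Suc k)) \<Longrightarrow>
      pairing X (\<lambda>p. f (d (Suc k) p)) (U i) = \<pi> i (pairing X f t)" by metis
  have conc: "concat (map U js) \<in> tensors X (P (Suc (Suc k))) \<and> (\<forall>f\<in>linear_forms R (P (Suc k)).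
      pairing X (\<lambda>p. f (d (Suc k) p)) (concat (map U js)) = lsum X (map (\<lambda>i. \<pi> i (pairing X f t)) js))"
    if "set js \<subseteq> I" for js
    using that
  proof (induction js)
    case (Cons j js)
    then have j: "j \<in> I" and IH: "concat (map U js) \<in> tensors X (P (Suc (Suc k)))"
      "\<And>f. f \<in> linear_forms R (P (Suc k)) \<Longrightarrow> pairing X (\<lambda>p. f (d (Suc k) p)) (concat (map U js))
        = lsum X (map (\<lambda>i. \<pi> i (pairing X f t)) js)" by auto
    have "pairing X (\<lambda>p. f (d (Suc k) p)) (concat (map U (j # js)))
        = lsum X (map (\<lambda>i. \<pi> i (pairing X f t)) (j # js))"
      if f: "f \<in> linear_forms R (P (Suc k))" for f
      using pairing_append[OF X form_comp[OF f] U(1)[OF j] IH(1)] U(2)[OF j f] IH(2)[OF f] by simp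
    moreover have "concat (map U (j # js)) \<in> tensors X (P (Suc (Suc k)))"
      using U(1)[OF j] IH(1) by simp
    ultimately show ?case by blast
  qed simp
  let ?u = "concat (map U is)"
  have "tensor_eq R (P (Suc k)) X t (boundary d (Suc k) ?u)"
  proof (rule tensor_eqI)
    fix f assume f: "f \<in> linear_forms R (P (Suc k))"
    let ?h = "\<lambda>x. lsum X (map (\<lambda>i. \<pi> i x) is)"
    have h: "?h \<in> module_hom (opposite R) X X"
    proof (rule module_hom_lsum_fun[OF X X])
      fix i assume "i \<in> set is"
      then have i: "i \<in> I" using "is"(1) by blast
      show "\<pi> i \<in> module_hom (opposite R) X X"
        by (rule module_hom_sub_mod_cod[OF sub[OF i] bspec[OF \<pi>(1) i]])
    qed
    have "map (\<lambda>(x, p). f p \<odot>\<^bsub>X\<^esub> ?h x) t = map (\<lambda>(x, p). f p \<odot>\<^bsub>X\<^esub> x) t"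
      by (rule map_cong) (use "is"(2) in force)+
    then have "pairing X f t = pairing X f (map (map_prod ?h id) t)"
      unfolding pairing_def by (simp add: comp_def case_prod_unfold del: map_eq_conv)
    also have "\<dots> = ?h (pairing X f t)"
      by (rule pairing_map_fst[OF X X h f t])
    also have "\<dots> = pairing X f (boundary d (Suc k) ?u)"
      using conc[OF "is"(1)] f unfolding pairing_map_snd by simp
    finally show "pairing X f t = pairing X f (boundary d (Suc k) ?u)" .
  qed
  with conc[OF "is"(1)]
  show "\<exists>u\<in>tensors X (P (Suc (Suc k))). tensor_eq R (P (Suc k)) X t (boundary d (Suc k) u)"
    by blast
qed

lemma tor_vanishes_summand:
  assumes "left_module (opposite R) A" "left_module (opposite R) X" "iso_to_direct_summand (opposite R) A X"
    and "tor_vanishes R P d k X"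
  shows "tor_vanishes R P d k A"
proof -
  obtain B C where BC: "submodule B (opposite R) X" "submodule C (opposite R) X"
    "B <+>\<^bsub>X\<^esub> C = carrier X" "B \<inter> C = {\<zero>\<^bsub>X\<^esub>}" "module_iso (opposite R) A (sub_mod X B)"
    using assms(3) unfolding iso_to_direct_summand_def by blast
  obtain p where p: "p \<in> module_hom (opposite R) X (sub_mod X B)" "\<forall>x\<in>B. p x = x"
    by (rule complement_projection[OF assms(2) BC(1-4)])
  have B: "left_module (opposite R) (sub_mod X B)" by (rule left_module_sub_mod[OF assms(2) BC(1)])
  have inc: "(\<lambda>x. x) \<in> module_hom (opposite R) (sub_mod X B) X"
    by (rule module_homI) (use submoduleD(1)[OF BC(1)] in simp_all)
  have "tor_vanishes R P d k (sub_mod X B)"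
    by (rule tor_vanishes_retract[OF B assms(2,4) inc p(1)]) (use p(2) in simp)
  then show ?thesis using tor_vanishes_iso[OF assms(1) B BC(5)] by blast
qed

lemma tor_vanishes_syzygy:
  assumes "left_module (opposite R) T" "syzygy (opposite R) T n K"
  shows "left_module (opposite R) K \<and> (\<forall>k. tor_vanishes R P d k K \<longleftrightarrow> tor_vanishes R P d (k + n) T)"
  using assms(2)
proof (induction rule: syzygy.induct)
  case (zero K)
  then show ?case using tor_vanishes_iso[OF zero(1) assms(1) zero(2)] by simp
next
  case (Suc n L Q f)
  then have L: "left_module (opposite R) L" and Q: "projective (opposite R) Q"
    and f: "f \<in> module_hom (opposite R) Q L" "f ` carrier Q = carrier L"
    by (auto simp: projective_cover_def)
  note QM = projective_left_module[OF Q]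
  let ?N = "sub_mod Q (a_kernel Q L f)"
  have "tor_vanishes R P d k ?N \<longleftrightarrow> tor_vanishes R P d (Suc k) L" for k
    using tor_shift_up[OF L QM f tor_vanishes_projective[OF Q]]
      tor_shift_down[OF L QM f tor_vanishes_projective[OF Q]] by blast
  moreover have "left_module (opposite R) ?N"
    by (rule left_module_sub_mod[OF QM submodule_a_kernel[OF QM L f(1)]])
  ultimately show ?case using Suc.IH by simp
qed

end

section \<open>The Jacobson radical of an artinian ring\<close>

text \<open>The condition \<open>N \<inter> W \<subseteq> D\<close> covers both uses of Zorn's lemma: maximal left ideals, with
  \<open>W = {1}\<close> and \<open>D = {}\<close>, and complements of \<open>W\<close> modulo \<open>D\<close>.\<close>

lemma maximal_submodule:
  assumes "left_module R M" "submodule N0 R M" "N0 \<inter> W \<subseteq> D"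
  obtains N where "submodule N R M" "N0 \<subseteq> N" "N \<inter> W \<subseteq> D"
    "\<forall>K. submodule K R M \<and> N \<subseteq> K \<and> K \<inter> W \<subseteq> D \<longrightarrow> K = N"
proof -
  interpret left_module R M by fact
  let ?A = "{N. submodule N R M \<and> N0 \<subseteq> N \<and> N \<inter> W \<subseteq> D}"
  have "\<exists>N\<in>?A. \<forall>X\<in>?A. N \<subseteq> X \<longrightarrow> X = N"
  proof (rule subset_Zorn_nonempty)
    show "?A \<noteq> {}" using assms(2,3) by blast
  next
    fix C assume C: "C \<noteq> {}" "subset.chain ?A C"
    have sub: "submodule N R M" "N0 \<subseteq> N" "N \<inter> W \<subseteq> D" if "N \<in> C" for N
      using C(2) that by (auto simp: subset.chain_def)
    have total: "N \<subseteq> N' \<or> N' \<subseteq> N" if "N \<in> C" "N' \<in> C" for N N'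
      using subset.chain_total[OF C(2) that] by blast
    have "submodule (\<Union>C) R M"
    proof (rule submoduleI)
      show "\<Union>C \<subseteq> carrier M" using submoduleD(2)[OF sub(1)] by blast
      show "\<zero>\<^bsub>M\<^esub> \<in> \<Union>C" using submoduleD(3)[OF sub(1)] C(1) by blast
      show "a \<odot>\<^bsub>M\<^esub> x \<in> \<Union>C" if "a \<in> carrier R" "x \<in> \<Union>C" for a x
        using submoduleD(5)[OF sub(1) that(1)] that(2) by blast
      fix x y assume "x \<in> \<Union>C" "y \<in> \<Union>C"
      then obtain N N' where N: "N \<in> C" "x \<in> N" "N' \<in> C" "y \<in> N'" by blast
      then show "x \<oplus>\<^bsub>M\<^esub> y \<in> \<Union>C"
        using total[OF N(1,3)] submoduleD(4)[OF sub(1)[OF N(1)], of x y]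
          submoduleD(4)[OF sub(1)[OF N(3)], of x y] by blast
    qed
    then show "\<Union>C \<in> ?A" using sub(2,3) C(1) by blast
  qed
  then obtain N where N: "N \<in> ?A" "\<forall>X\<in>?A. N \<subseteq> X \<longrightarrow> X = N" by blast
  have "\<forall>K. submodule K R M \<and> N \<subseteq> K \<and> K \<inter> W \<subseteq> D \<longrightarrow> K = N"
    using N by blast
  with N(1) that show ?thesis by blast
qed

lemma minimal_submodule:
  assumes "artinian_module R M" "submodule N0 R M" "Q N0"
  obtains N where "submodule N R M" "Q N" "\<forall>K. submodule K R M \<and> K \<subseteq> N \<and> Q K \<longrightarrow> K = N"
proof -
  have "\<exists>N. submodule N R M \<and> Q N \<and> (\<forall>K. submodule K R M \<and> K \<subseteq> N \<and> Q K \<longrightarrow> K = N)"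
  proof (rule ccontr)
    assume no: "\<not> ?thesis"
    have step: "\<exists>K. (submodule K R M \<and> Q K) \<and> K \<subset> N" if "submodule N R M \<and> Q N" for N
      using no that by blast
    have "\<exists>F. \<forall>n. (submodule (F n) R M \<and> Q (F n)) \<and> F (Suc n) \<subset> F n"
      by (rule dependent_nat_choice) (use assms(2,3) step in blast)+
    then obtain F where F: "\<forall>n. submodule (F n) R M \<and> Q (F n)" "\<forall>n. F (Suc n) \<subset> F n" by blast
    then have "decseq F" by (intro decseq_SucI) blast
    then obtain k where "\<forall>n\<ge>k. F n = F k"
      using mp[OF spec[OF conjunct2[OF assms(1)[unfolded artinian_module_def]], of F]] F(1) by blast
    then have "F (Suc k) = F k" by (meson le_SucI order_refl)
    with F(2) show False by blast
  qed
  with that show ?thesis by blast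
qed

context
  fixes R :: "('r, 'x) ring_scheme"
  assumes R: "ring R"
begin

interpretation R: ring R by (rule R)

interpretation Reg: left_module R "regular_module R" by (rule left_module_regular[OF R])

lemma maximal_left_idealD:
  assumes "maximal_left_ideal I R"
  shows "submodule I R (regular_module R)" "\<one>\<^bsub>R\<^esub> \<notin> I"
    "\<And>K. submodule K R (regular_module R) \<Longrightarrow> I \<subseteq> K \<Longrightarrow> K \<noteq> I \<Longrightarrow> K = carrier R"
proof -
  show I: "submodule I R (regular_module R)"
    and "\<And>K. submodule K R (regular_module R) \<Longrightarrow> I \<subseteq> K \<Longrightarrow> K \<noteq> I \<Longrightarrow> K = carrier R"
    using assms by (auto simp: maximal_left_ideal_def)
  show "\<one>\<^bsub>R\<^esub> \<notin> I"
  proof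
    assume "\<one>\<^bsub>R\<^esub> \<in> I"
    then have "a \<in> I" if "a \<in> carrier R" for a
      using submoduleD(5)[OF I that, of "\<one>\<^bsub>R\<^esub>"] that by simp
    then show False using submoduleD(2)[OF I] assms by (auto simp: maximal_left_ideal_def)
  qed
qed

lemma jacobson_radicalI:
  "a \<in> carrier R \<Longrightarrow> (\<And>I. maximal_left_ideal I R \<Longrightarrow> a \<in> I) \<Longrightarrow> a \<in> jacobson_radical R"
  by (simp add: jacobson_radical_def)

lemma jacobson_radicalD:
  "a \<in> jacobson_radical R \<Longrightarrow> a \<in> carrier R"
  "a \<in> jacobson_radical R \<Longrightarrow> maximal_left_ideal I R \<Longrightarrow> a \<in> I"
  by (simp_all add: jacobson_radical_def)

lemma submodule_jacobson_radical: "submodule (jacobson_radical R) R (regular_module R)"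
proof (rule Reg.submoduleI)
  note max = submoduleD[OF maximal_left_idealD(1)]
  show "jacobson_radical R \<subseteq> carrier (regular_module R)" using jacobson_radicalD(1) by auto
  show "\<zero>\<^bsub>regular_module R\<^esub> \<in> jacobson_radical R"
    by (rule jacobson_radicalI) (use max(3) in simp_all)
  show "x \<oplus>\<^bsub>regular_module R\<^esub> y \<in> jacobson_radical R"
    if "x \<in> jacobson_radical R" "y \<in> jacobson_radical R" for x y
    by (rule jacobson_radicalI) (use max(4) jacobson_radicalD that in simp_all)
  show "a \<odot>\<^bsub>regular_module R\<^esub> x \<in> jacobson_radical R"
    if "a \<in> carrier R" "x \<in> jacobson_radical R" for a x
    by (rule jacobson_radicalI) (use max(5) jacobson_radicalD that in simp_all)
qed

text \<open>For \<open>r\<close> outside a maximal left ideal \<open>I\<close>, the left ideal \<open>{y. y r \<in> I}\<close> is again maximal.\<close>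

lemma jacobson_radical_right_mult:
  assumes x: "x \<in> jacobson_radical R" and r: "r \<in> carrier R"
  shows "x \<otimes>\<^bsub>R\<^esub> r \<in> jacobson_radical R"
proof (rule jacobson_radicalI)
  note xR = jacobson_radicalD(1)[OF x]
  show "x \<otimes>\<^bsub>R\<^esub> r \<in> carrier R" using xR r by simp
  fix I assume I: "maximal_left_ideal I R"
  note ID = submoduleD[OF maximal_left_idealD(1)[OF I], simplified]
  show "x \<otimes>\<^bsub>R\<^esub> r \<in> I"
  proof (cases "r \<in> I")
    case True
    then show ?thesis using ID(5)[OF xR] by simp
  next
    case False
    let ?I = "{y \<in> carrier R. y \<otimes>\<^bsub>R\<^esub> r \<in> I}"
    have sub: "submodule ?I R (regular_module R)"
      by (rule Reg.submoduleI) (use ID(3,4,5) r in \<open>auto simp: R.l_distr R.m_assoc\<close>)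
    have "maximal_left_ideal ?I R"
      unfolding maximal_left_ideal_def
    proof (intro conjI allI impI; (elim conjE)?)
      show "?I \<noteq> carrier R" using False r R.one_closed by (metis (mono_tags) CollectD R.l_one)
      fix K assume K: "submodule K R (regular_module R)" "?I \<subseteq> K"
      note KD = submoduleD[OF K(1), simplified]
      show "K = ?I \<or> K = carrier R"
      proof (rule disjCI)
        assume "K \<noteq> carrier R"
        have "k \<otimes>\<^bsub>R\<^esub> r \<in> I" if k: "k \<in> K" for k
        proof (rule ccontr)
          assume no: "k \<otimes>\<^bsub>R\<^esub> r \<notin> I"
          let ?L = "{i \<oplus>\<^bsub>R\<^esub> k' \<otimes>\<^bsub>R\<^esub> r | i k'. i \<in> I \<and> k' \<in> K}"
          have LI: "i \<oplus>\<^bsub>R\<^esub> k' \<otimes>\<^bsub>R\<^esub> r \<in> ?L" if "i \<in> I" "k' \<in> K" for i k'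
            using that by blast
          have "submodule ?L R (regular_module R)"
          proof (rule Reg.submoduleI)
            show "?L \<subseteq> carrier (regular_module R)" using ID(1) KD(1) r by auto
            show "\<zero>\<^bsub>regular_module R\<^esub> \<in> ?L" using LI[OF ID(3) KD(3)] r by simp
          next
            fix u v assume "u \<in> ?L" "v \<in> ?L"
            then obtain i k i' k' where *: "i \<in> I" "k \<in> K" "i' \<in> I" "k' \<in> K"
              "u = i \<oplus>\<^bsub>R\<^esub> k \<otimes>\<^bsub>R\<^esub> r" "v = i' \<oplus>\<^bsub>R\<^esub> k' \<otimes>\<^bsub>R\<^esub> r" by blast
            have "u \<oplus>\<^bsub>R\<^esub> v = (i \<oplus>\<^bsub>R\<^esub> i') \<oplus>\<^bsub>R\<^esub> (k \<oplus>\<^bsub>R\<^esub> k') \<otimes>\<^bsub>R\<^esub> r"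
              using * ID(1) KD(1) r by (simp add: R.l_distr R.a_ac)
            then show "u \<oplus>\<^bsub>regular_module R\<^esub> v \<in> ?L"
              using LI[OF ID(4)[OF *(1,3)] KD(4)[OF *(2,4)]] by (simp only: regular_module_simps)
          next
            fix a u assume a: "a \<in> carrier R" and "u \<in> ?L"
            then obtain i k where *: "i \<in> I" "k \<in> K" "u = i \<oplus>\<^bsub>R\<^esub> k \<otimes>\<^bsub>R\<^esub> r" by blast
            have "a \<otimes>\<^bsub>R\<^esub> u = a \<otimes>\<^bsub>R\<^esub> i \<oplus>\<^bsub>R\<^esub> (a \<otimes>\<^bsub>R\<^esub> k) \<otimes>\<^bsub>R\<^esub> r"
              using * a ID(1) KD(1) r by (simp add: R.r_distr R.m_assoc)
            then show "a \<odot>\<^bsub>regular_module R\<^esub> u \<in> ?L"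
              using LI[OF ID(5)[OF a *(1)] KD(5)[OF a *(2)]] by (simp only: regular_module_simps)
          qed
          moreover have "I \<subseteq> ?L"
          proof
            fix i assume i: "i \<in> I"
            then have "i = i \<oplus>\<^bsub>R\<^esub> \<zero>\<^bsub>R\<^esub> \<otimes>\<^bsub>R\<^esub> r" using ID(1) r by simp
            with LI[OF i KD(3)] show "i \<in> ?L" by simp
          qed
          moreover have "?L \<noteq> I"
          proof
            assume "?L = I"
            moreover have "k \<otimes>\<^bsub>R\<^esub> r \<in> ?L" using LI[OF ID(3) k] KD(1)[OF k] r by simp
            ultimately show False using no by blast
          qed
          ultimately have "?L = carrier R" by (rule maximal_left_idealD(3)[OF I])
          with r obtain i k' where *: "i \<in> I" "k' \<in> K" "r = i \<oplus>\<^bsub>R\<^esub> k' \<otimes>\<^bsub>R\<^esub> r" by blast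
          note cl = ID(1)[OF *(1)] KD(1)[OF *(2)]
          have "(\<one>\<^bsub>R\<^esub> \<oplus>\<^bsub>R\<^esub> \<ominus>\<^bsub>R\<^esub> k') \<otimes>\<^bsub>R\<^esub> r = r \<oplus>\<^bsub>R\<^esub> \<ominus>\<^bsub>R\<^esub> (k' \<otimes>\<^bsub>R\<^esub> r)"
            using cl r by (simp add: R.l_distr R.l_minus)
          also have "\<dots> = (i \<oplus>\<^bsub>R\<^esub> k' \<otimes>\<^bsub>R\<^esub> r) \<oplus>\<^bsub>R\<^esub> \<ominus>\<^bsub>R\<^esub> (k' \<otimes>\<^bsub>R\<^esub> r)"
            using *(3) by simp
          also have "\<dots> = i" using cl r by (simp add: R.a_assoc R.r_neg)
          finally have "\<one>\<^bsub>R\<^esub> \<oplus>\<^bsub>R\<^esub> \<ominus>\<^bsub>R\<^esub> k' \<in> ?I" using *(1) cl by simp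
          then have "\<one>\<^bsub>R\<^esub> \<oplus>\<^bsub>R\<^esub> \<ominus>\<^bsub>R\<^esub> k' \<in> K" using K(2) by blast
          from KD(4)[OF this *(2)] have "\<one>\<^bsub>R\<^esub> \<in> K" using cl by (simp add: R.a_assoc R.l_neg)
          then have "a \<in> K" if "a \<in> carrier R" for a
            using KD(5)[OF that, of "\<one>\<^bsub>R\<^esub>"] that by simp
          with KD(2) \<open>K \<noteq> carrier R\<close> show False by blast
        qed
        then show "K = ?I" using K(2) KD(1) by blast
      qed
    qed (rule sub)
    from jacobson_radicalD(2)[OF x this] show ?thesis by simp
  qed
qed

lemma submodule_annihilator:
  assumes "left_module R M" "x \<in> carrier M" "submodule H R M"
  shows "submodule {a \<in> carrier R. a \<odot>\<^bsub>M\<^esub> x \<in> H} R (regular_module R)"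
proof -
  interpret M: left_module R M by fact
  note H = submoduleD[OF assms(3)]
  show ?thesis
    by (rule Reg.submoduleI) (use assms(2) H(3,4,5) in \<open>auto simp: M.smult_l_distr M.smult_assoc1\<close>)
qed

text \<open>A form of Nakayama's lemma: the annihilator of a nonzero \<open>x\<close> lies in a maximal left ideal,
  which cannot contain both \<open>a\<close> and \<open>1 - a\<close>.\<close>

lemma jacobson_radical_fixes_only_zero:
  assumes M: "left_module R M" and x: "x \<in> carrier M" and a: "a \<in> jacobson_radical R"
    and ax: "a \<odot>\<^bsub>M\<^esub> x = x"
  shows "x = \<zero>\<^bsub>M\<^esub>"
proof (rule ccontr)
  assume x0: "x \<noteq> \<zero>\<^bsub>M\<^esub>"
  interpret M: left_module R M by (rule M)
  note aR = jacobson_radicalD(1)[OF a]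
  let ?A = "{b \<in> carrier R. b \<odot>\<^bsub>M\<^esub> x \<in> {\<zero>\<^bsub>M\<^esub>}}"
  have "submodule ?A R (regular_module R)"
    by (rule submodule_annihilator[OF M x M.submodule_zero])
  moreover have "?A \<inter> {\<one>\<^bsub>R\<^esub>} \<subseteq> {}" using x0 x by simp
  ultimately obtain I where I: "submodule I R (regular_module R)" "?A \<subseteq> I" "I \<inter> {\<one>\<^bsub>R\<^esub>} \<subseteq> {}"
    "\<forall>K. submodule K R (regular_module R) \<and> I \<subseteq> K \<and> K \<inter> {\<one>\<^bsub>R\<^esub>} \<subseteq> {} \<longrightarrow> K = I"
    by (rule maximal_submodule[OF Reg.left_module_axioms])
  note ID = submoduleD[OF I(1), simplified]
  have "maximal_left_ideal I R"
    unfolding maximal_left_ideal_def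
  proof (intro conjI allI impI; (elim conjE)?)
    show "I \<noteq> carrier R" using I(3) R.one_closed by blast
    fix K assume K: "submodule K R (regular_module R)" "I \<subseteq> K"
    note KD = submoduleD[OF K(1), simplified]
    show "K = I \<or> K = carrier R"
    proof (cases "\<one>\<^bsub>R\<^esub> \<in> K")
      case True
      then have "b \<in> K" if "b \<in> carrier R" for b using KD(5)[OF that, of "\<one>\<^bsub>R\<^esub>"] that by simp
      with KD(2) show ?thesis by blast
    next
      case False
      with I(4) K show ?thesis by blast
    qed
  qed (rule I(1))
  then have aI: "a \<in> I" by (rule jacobson_radicalD(2)[OF a])
  have "(\<ominus>\<^bsub>R\<^esub> a) \<odot>\<^bsub>M\<^esub> x = \<ominus>\<^bsub>M\<^esub> x"
    using M.smult_assoc1[of "\<ominus>\<^bsub>R\<^esub> \<one>\<^bsub>R\<^esub>" a x] aR x ax by (simp add: M.smult_minus_one R.l_minus)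
  then have "\<one>\<^bsub>R\<^esub> \<oplus>\<^bsub>R\<^esub> \<ominus>\<^bsub>R\<^esub> a \<in> ?A"
    using aR x by (simp add: M.smult_l_distr M.M.r_neg)
  then have "\<one>\<^bsub>R\<^esub> \<oplus>\<^bsub>R\<^esub> \<ominus>\<^bsub>R\<^esub> a \<in> I" using I(2) by blast
  from ID(4)[OF this aI] have "\<one>\<^bsub>R\<^esub> \<in> I" using aR by (simp add: R.a_assoc R.l_neg)
  with I(3) show False by blast
qed

end

text \<open>The product \<open>I N\<close>, as an intersection of submodules, so that an inclusion \<open>I N \<subseteq> H\<close> needs to be
  tested on single products only and no sums occur.\<close>

definition ideal_mult :: "('r, 'x) ring_scheme \<Rightarrow> 'r set \<Rightarrow> ('r, 'm) module \<Rightarrow> 'm set \<Rightarrow> 'm set" where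
  "ideal_mult R I M N = \<Inter>{H. submodule H R M \<and> (\<forall>a\<in>I. \<forall>x\<in>N. a \<odot>\<^bsub>M\<^esub> x \<in> H)}"

lemma ideal_mult_least:
  "submodule H R M \<Longrightarrow> (\<And>a x. a \<in> I \<Longrightarrow> x \<in> N \<Longrightarrow> a \<odot>\<^bsub>M\<^esub> x \<in> H) \<Longrightarrow> ideal_mult R I M N \<subseteq> H"
  unfolding ideal_mult_def by blast

lemma smult_mem_ideal_mult: "a \<in> I \<Longrightarrow> x \<in> N \<Longrightarrow> a \<odot>\<^bsub>M\<^esub> x \<in> ideal_mult R I M N"
  unfolding ideal_mult_def by blast

lemma submodule_ideal_mult:
  assumes "left_module R M" "I \<subseteq> carrier R" "N \<subseteq> carrier M"
  shows "submodule (ideal_mult R I M N) R M"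
proof -
  interpret left_module R M by fact
  show ?thesis
  proof (rule submoduleI)
    have "\<forall>a\<in>I. \<forall>x\<in>N. a \<odot>\<^bsub>M\<^esub> x \<in> carrier M" using assms(2,3) smult_closed by blast
    then show "ideal_mult R I M N \<subseteq> carrier M"
      by (intro ideal_mult_least[OF submodule_carrier]) blast
  qed (auto simp: ideal_mult_def submoduleD)
qed

lemma ideal_mult_subset:
  assumes "I \<subseteq> carrier R" "submodule N R M"
  shows "ideal_mult R I M N \<subseteq> N"
  by (rule ideal_mult_least[OF assms(2)]) (use submoduleD(5)[OF assms(2)] assms(1) in blast)

lemma submodule_vimage:
  assumes "left_module R M" "left_module R N" "f \<in> module_hom R M N" "submodule H R N"
  shows "submodule {x \<in> carrier M. f x \<in> H} R M"
proof -
  interpret left_module R M by fact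
  note H = submoduleD[OF assms(4)] and f = module_homD[OF assms(3)]
  show ?thesis
    by (rule submoduleI) (use H(3,4,5) in \<open>auto simp: f module_hom_zero[OF assms(1-3)]\<close>)
qed

lemma module_hom_ideal_mult:
  assumes "left_module R M" "left_module R N" "f \<in> module_hom R M N" "I \<subseteq> carrier R"
    and "X \<subseteq> carrier M" "Y \<subseteq> carrier N" "\<And>x. x \<in> X \<Longrightarrow> f x \<in> Y" "x \<in> ideal_mult R I M X"
  shows "f x \<in> ideal_mult R I N Y"
proof -
  interpret left_module R M by fact
  have "ideal_mult R I M X \<subseteq> {x \<in> carrier M. f x \<in> ideal_mult R I N Y}"
  proof (rule ideal_mult_least[OF submodule_vimage[OF assms(1-3) submodule_ideal_mult[OF assms(2,4,6)]]])
    fix a x assume ax: "a \<in> I" "x \<in> X"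
    then have "a \<in> carrier R" "x \<in> carrier M" using assms(4,5) by blast+
    with ax show "a \<odot>\<^bsub>M\<^esub> x \<in> {x \<in> carrier M. f x \<in> ideal_mult R I N Y}"
      using smult_mem_ideal_mult[OF ax(1) assms(7)[OF ax(2)], of N R] module_homD(3)[OF assms(3)] by simp
  qed
  with assms(8) show ?thesis by blast
qed

abbreviation radical_power :: "('r, 'x) ring_scheme \<Rightarrow> ('r, 'm) module \<Rightarrow> 'm set \<Rightarrow> nat \<Rightarrow> 'm set" where
  "radical_power R M N n \<equiv> (ideal_mult R (jacobson_radical R) M ^^ n) N"

lemma jacobson_radical_subset: "jacobson_radical R \<subseteq> carrier R"
  by (simp add: jacobson_radical_def)

lemma submodule_radical_power:
  assumes "left_module R M" "submodule N R M"
  shows "submodule (radical_power R M N n) R M"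
proof (induction n)
  case (Suc n)
  show ?case
    using submodule_ideal_mult[OF assms(1) jacobson_radical_subset submoduleD(2)[OF Suc.IH]] by simp
qed (simp add: assms(2))

lemma radical_power_subset:
  assumes "left_module R M" "submodule N R M"
  shows "radical_power R M N n \<subseteq> ideal_mult R (radical_power R (regular_module R) (carrier R) n) M N"
proof (induction n)
  case 0
  interpret left_module R M by fact
  show ?case
  proof
    fix x assume "x \<in> radical_power R M N 0"
    then have x: "x \<in> N" by simp
    with smult_mem_ideal_mult[of "\<one>\<^bsub>R\<^esub>" "carrier R" x N M R] submoduleD(1)[OF assms(2) x]
    show "x \<in> ideal_mult R (radical_power R (regular_module R) (carrier R) 0) M N" by simp
  qed
next
  case (Suc n)
  interpret left_module R M by fact
  interpret Reg: left_module R "regular_module R" by (rule left_module_regular[OF R.ring_axioms])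
  let ?J = "jacobson_radical R" and ?p = "radical_power R (regular_module R) (carrier R)"
  have carr: "submodule (carrier R) R (regular_module R)"
    using Reg.submodule_carrier by simp
  have p: "?p n \<subseteq> carrier R" for n
    using submoduleD(2)[OF submodule_radical_power[OF Reg.left_module_axioms carr]] by simp
  let ?H = "ideal_mult R (?p (Suc n)) M N"
  note NM = submoduleD(2)[OF assms(2)]
  have H: "submodule ?H R M" by (rule submodule_ideal_mult[OF assms(1) p NM])
  note HD = submoduleD[OF H]
  \<comment> \<open>This is a submodule because \<open>J\<close> is also a right ideal.\<close>
  let ?Q = "{y \<in> carrier M. \<forall>b\<in>?J. b \<odot>\<^bsub>M\<^esub> y \<in> ?H}"
  have JR: "b \<in> carrier R" if "b \<in> ?J" for b by (rule subsetD[OF jacobson_radical_subset that])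
  have Q: "submodule ?Q R M"
  proof (rule submoduleI)
    show "\<zero>\<^bsub>M\<^esub> \<in> ?Q" using HD(3) JR by (simp del: funpow.simps)
    show "x \<oplus>\<^bsub>M\<^esub> y \<in> ?Q" if "x \<in> ?Q" "y \<in> ?Q" for x y
      using that HD(4) JR by (simp add: smult_r_distr del: funpow.simps)
    show "a \<odot>\<^bsub>M\<^esub> x \<in> ?Q" if a: "a \<in> carrier R" and x: "x \<in> ?Q" for a x
    proof -
      have xM: "x \<in> carrier M" and xH: "\<forall>b\<in>?J. b \<odot>\<^bsub>M\<^esub> x \<in> ?H" using x by blast+
      have "b \<odot>\<^bsub>M\<^esub> (a \<odot>\<^bsub>M\<^esub> x) \<in> ?H" if b: "b \<in> ?J" for b
        using bspec[OF xH jacobson_radical_right_mult[OF R.ring_axioms b a]]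
        by (simp only: smult_assoc1[OF JR[OF b] a xM])
      with smult_closed[OF a xM] show ?thesis by blast
    qed
  qed blast
  have "ideal_mult R (?p n) M N \<subseteq> ?Q"
  proof (rule ideal_mult_least[OF Q])
    fix a x assume a: "a \<in> ?p n" and x: "x \<in> N"
    have aR: "a \<in> carrier R" and xM: "x \<in> carrier M" using a x p NM by blast+
    have "b \<odot>\<^bsub>M\<^esub> (a \<odot>\<^bsub>M\<^esub> x) \<in> ?H" if b: "b \<in> ?J" for b
    proof -
      have "b \<otimes>\<^bsub>R\<^esub> a \<in> ?p (Suc n)"
        using smult_mem_ideal_mult[OF b a, of "regular_module R" R] by simp
      from smult_mem_ideal_mult[OF this x, of M R] show ?thesis
        by (simp only: smult_assoc1[OF JR[OF b] aR xM])
    qed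
    with smult_closed[OF aR xM] show "a \<odot>\<^bsub>M\<^esub> x \<in> ?Q" by blast
  qed
  with Suc.IH have "radical_power R M N n \<subseteq> ?Q" by blast
  then have "ideal_mult R ?J M (radical_power R M N n) \<subseteq> ?H"
    by (intro ideal_mult_least[OF H]) blast
  then show ?case by (simp only: funpow.simps o_apply)
qed

text \<open>If \<open>I = J\<^sup>n\<close> is the stable power and \<open>I \<noteq> 0\<close>, then \<open>I I \<noteq> 0\<close>.  For a left ideal \<open>L\<close> minimal with
  \<open>I L \<noteq> 0\<close> and \<open>x \<in> L\<close> with \<open>I x \<noteq> 0\<close> minimality yields \<open>I x = L\<close>, whence \<open>x = a x\<close> for some \<open>a \<in> J\<close>.\<close>

lemma jacobson_radical_nilpotent:
  fixes R :: "('r, 'x) ring_scheme"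
  assumes "artinian_ring R"
  obtains n where "radical_power R (regular_module R) (carrier R) n = {\<zero>\<^bsub>R\<^esub>}"
proof -
  have R: "ring R" and art: "artinian_module R (regular_module R)"
    using assms by (simp_all add: artinian_ring_def)
  interpret R: ring R by (rule R)
  note RegM = left_module_regular[OF R]
  interpret Reg: left_module R "regular_module R" by (rule RegM)
  let ?J = "jacobson_radical R" and ?p = "radical_power R (regular_module R) (carrier R)"
  have carr: "submodule (carrier R) R (regular_module R)"
    using Reg.submodule_carrier by simp
  have p: "submodule (?p n) R (regular_module R)" for n
    by (rule submodule_radical_power[OF RegM carr])
  have Suc_sub: "?p (Suc n) \<subseteq> ?p n" for n
    using ideal_mult_subset[OF jacobson_radical_subset p] by simp
  then have "decseq ?p" by (rule decseq_SucI)
  with p have "(\<forall>n. submodule (?p n) R (regular_module R)) \<and> decseq ?p" by blast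
  from mp[OF spec[OF conjunct2[OF art[unfolded artinian_module_def]]] this]
  obtain k where k: "\<forall>n\<ge>k. ?p n = ?p k" by (elim exE)
  let ?I = "?p k"
  note ID = submoduleD[OF p[of k], simplified]
  have IJ: "?I \<subseteq> ?J"
  proof -
    have "ideal_mult R ?J (regular_module R) ?I \<subseteq> ?J"
      by (rule ideal_mult_least[OF submodule_jacobson_radical[OF R]])
        (use jacobson_radical_right_mult[OF R] ID(1) in simp)
    moreover have "?p (Suc k) = ?I" using k by (metis le_SucI order_refl)
    ultimately show ?thesis by simp
  qed
  have II: "?I \<subseteq> ideal_mult R ?I (regular_module R) ?I"
  proof -
    have "?I = ?p (k + k)" using k by (metis le_add1)
    also have "\<dots> = radical_power R (regular_module R) ?I k" by (simp add: funpow_add)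
    also have "\<dots> \<subseteq> ideal_mult R ?I (regular_module R) ?I" by (rule radical_power_subset[OF RegM p])
    finally show ?thesis .
  qed
  have "?I \<subseteq> {\<zero>\<^bsub>R\<^esub>}"
  proof (rule ccontr)
    assume nz: "\<not> ?I \<subseteq> {\<zero>\<^bsub>R\<^esub>}"
    let ?Q = "\<lambda>L. \<exists>a\<in>?I. \<exists>x\<in>L. a \<otimes>\<^bsub>R\<^esub> x \<noteq> \<zero>\<^bsub>R\<^esub>"
    have "?Q ?I"
    proof (rule ccontr)
      assume "\<not> ?Q ?I"
      then have "ideal_mult R ?I (regular_module R) ?I \<subseteq> {\<zero>\<^bsub>regular_module R\<^esub>}"
        by (intro ideal_mult_least[OF Reg.submodule_zero]) simp
      with II nz show False by auto
    qed
    then obtain L where L: "submodule L R (regular_module R)" "?Q L"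
      "\<forall>K. submodule K R (regular_module R) \<and> K \<subseteq> L \<and> ?Q K \<longrightarrow> K = L"
      by (rule minimal_submodule[OF art p])
    note LD = submoduleD[OF L(1), simplified]
    obtain a x where ax: "a \<in> ?I" "x \<in> L" "a \<otimes>\<^bsub>R\<^esub> x \<noteq> \<zero>\<^bsub>R\<^esub>" using L(2) by blast
    have xR: "x \<in> carrier R" by (rule LD(1)[OF ax(2)])
    let ?L' = "(\<lambda>b. b \<otimes>\<^bsub>R\<^esub> x) ` ?I"
    have "(\<lambda>b. b \<otimes>\<^bsub>R\<^esub> x) \<in> module_hom R (regular_module R) (regular_module R)"
      by (rule module_homI) (use xR in \<open>simp_all add: R.l_distr R.m_assoc\<close>)
    then have sub: "submodule ?L' R (regular_module R)"
      by (rule submodule_image[OF RegM RegM _ p])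
    have L'L: "?L' \<subseteq> L" using LD(5)[OF ID(1) ax(2)] by auto
    have "?Q ?L'"
    proof (rule ccontr)
      assume no: "\<not> ?Q ?L'"
      let ?A = "{c \<in> carrier R. c \<odot>\<^bsub>regular_module R\<^esub> x \<in> {\<zero>\<^bsub>regular_module R\<^esub>}}"
      have "ideal_mult R ?I (regular_module R) ?I \<subseteq> ?A"
      proof (rule ideal_mult_least[OF submodule_annihilator[OF R RegM _ Reg.submodule_zero]])
        show "x \<in> carrier (regular_module R)" using xR by simp
        show "c \<odot>\<^bsub>regular_module R\<^esub> b \<in> ?A" if "c \<in> ?I" "b \<in> ?I" for c b
          using no that ID(1) xR by (auto simp: R.m_assoc)
      qed
      with II ax(1,3) show False by auto
    qed
    with L(3) sub L'L have "?L' = L" by blast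
    with ax(2) obtain b where b: "b \<in> ?I" "x = b \<otimes>\<^bsub>R\<^esub> x" by blast
    then have "x = \<zero>\<^bsub>R\<^esub>"
      using jacobson_radical_fixes_only_zero[OF R RegM, of x b] IJ xR by auto
    with ax(1,3) ID(1) show False by simp
  qed
  then have "?I = {\<zero>\<^bsub>R\<^esub>}" using ID(3) by blast
  with that show ?thesis .
qed

section \<open>Splitting modulo the radical\<close>

text \<open>Every submodule of \<open>M / J M\<close> is a direct summand, stated in \<open>M\<close>.  A submodule \<open>C \<supseteq> J M\<close> that is
  maximal with \<open>C \<inter> W \<subseteq> J M\<close> works: for \<open>u \<notin> C + W\<close> let \<open>L\<close> be the left ideal \<open>{a. a u \<in> C + W}\<close>
  and \<open>L'\<close> a left ideal minimal with \<open>L + L' = \<Lambda>\<close>.  Minimality gives \<open>L \<inter> L' \<subseteq> J\<close>, because \<open>L'\<close> could be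
  intersected with a maximal left ideal that misses an element of \<open>L \<inter> L'\<close>.  Hence \<open>C + L' u\<close> would be
  a larger choice than \<open>C\<close>.\<close>

lemma complement_modulo_radical:
  fixes R :: "('r, 'x) ring_scheme" and M :: "('r, 'm) module"
  assumes art: "artinian_ring R" and M: "left_module R M" and W: "submodule W R M"
  obtains C where "submodule C R M" "ideal_mult R (jacobson_radical R) M (carrier M) \<subseteq> C"
    "C \<inter> W \<subseteq> ideal_mult R (jacobson_radical R) M (carrier M)" "C <+>\<^bsub>M\<^esub> W = carrier M"
proof -
  have R: "ring R" and artm: "artinian_module R (regular_module R)"
    using art by (simp_all add: artinian_ring_def)
  interpret left_module R M by (rule M)
  note RegM = left_module_regular[OF R]
  interpret Reg: left_module R "regular_module R" by (rule RegM)
  let ?J = "jacobson_radical R"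
  let ?D = "ideal_mult R ?J M (carrier M)"
  have D: "submodule ?D R M" by (rule submodule_ideal_mult[OF M jacobson_radical_subset order_refl])
  have carr: "submodule (carrier R) R (regular_module R)"
    using Reg.submodule_carrier by simp
  obtain C where C: "submodule C R M" "?D \<subseteq> C" "C \<inter> W \<subseteq> ?D"
    "\<forall>K. submodule K R M \<and> C \<subseteq> K \<and> K \<inter> W \<subseteq> ?D \<longrightarrow> K = C"
    by (rule maximal_submodule[OF M D, of W ?D]) auto
  note CD = submoduleD[OF C(1)] and WD = submoduleD[OF W]
  let ?V = "C <+>\<^bsub>M\<^esub> W"
  have V: "submodule ?V R M" by (rule submodule_set_add[OF M C(1) W])
  note VD = submoduleD[OF V]
  have CV: "C \<subseteq> ?V" "W \<subseteq> ?V" by (rule subset_set_add[OF M C(1) W])+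
  have "?V = carrier M"
  proof (rule ccontr)
    assume "?V \<noteq> carrier M"
    then obtain u where u: "u \<in> carrier M" "u \<notin> ?V" using VD(2) by blast
    let ?L = "{a \<in> carrier R. a \<odot>\<^bsub>M\<^esub> u \<in> ?V}"
    have L: "submodule ?L R (regular_module R)" by (rule submodule_annihilator[OF R M u(1) V])
    note LD = submoduleD[OF L, unfolded regular_module_simps]
    let ?Q = "\<lambda>K. ?L <+>\<^bsub>regular_module R\<^esub> K = carrier R"
    have "?Q (carrier R)"
      using subset_set_add(2)[OF RegM L carr] submoduleD(2)[OF submodule_set_add[OF RegM L carr]] by simp
    then obtain L' where L': "submodule L' R (regular_module R)" "?Q L'"
      "\<forall>K. submodule K R (regular_module R) \<and> K \<subseteq> L' \<and> ?Q K \<longrightarrow> K = L'"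
      by (rule minimal_submodule[OF artm carr])
    note L'D = submoduleD[OF L'(1), simplified]
    have LL': "?L \<inter> L' \<subseteq> ?J"
    proof
      fix x assume x: "x \<in> ?L \<inter> L'"
      then have xR: "x \<in> carrier R" by blast
      show "x \<in> ?J"
      proof (rule jacobson_radicalI[OF R xR])
        fix I assume I: "maximal_left_ideal I R"
        note Is = maximal_left_idealD(1)[OF R I]
        note ID = submoduleD[OF Is, simplified]
        show "x \<in> I"
        proof (rule ccontr)
          assume xI: "x \<notin> I"
          let ?X = "(\<lambda>b. b \<otimes>\<^bsub>R\<^esub> x) ` carrier R"
          have h: "(\<lambda>b. b \<otimes>\<^bsub>R\<^esub> x) \<in> module_hom R (regular_module R) (regular_module R)"
            by (rule module_homI) (use xR in \<open>simp_all add: R.l_distr R.m_assoc\<close>)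
          have X: "submodule ?X R (regular_module R)"
            by (rule submodule_image[OF RegM RegM h carr])
          have "x = \<one>\<^bsub>R\<^esub> \<otimes>\<^bsub>R\<^esub> x" using xR by simp
          then have "x \<in> ?X" by (rule image_eqI) simp
          then have "I <+>\<^bsub>regular_module R\<^esub> ?X \<noteq> I"
            using subset_set_add(2)[OF RegM Is X] xI by blast
          then have IX: "I <+>\<^bsub>regular_module R\<^esub> ?X = carrier R"
            by (rule maximal_left_idealD(3)[OF R I submodule_set_add[OF RegM Is X]
                  subset_set_add(1)[OF RegM Is X]])
          have IL': "submodule (I \<inter> L') R (regular_module R)"
            by (rule Reg.submoduleI) (use ID L'D in auto)
          have "?Q (I \<inter> L')"
          proof
            show "?L <+>\<^bsub>regular_module R\<^esub> (I \<inter> L') \<subseteq> carrier R"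
              using submoduleD(2)[OF submodule_set_add[OF RegM L IL']] by simp
            show "carrier R \<subseteq> ?L <+>\<^bsub>regular_module R\<^esub> (I \<inter> L')"
            proof
              fix r assume "r \<in> carrier R"
              then obtain l l' where l: "l \<in> ?L" "l' \<in> L'" "r = l \<oplus>\<^bsub>R\<^esub> l'"
                using mem_set_add[of r "regular_module R" ?L L'] L'(2) by (simp, blast)
              from L'D(1)[OF l(2)] obtain i b where i: "i \<in> I" "b \<in> carrier R" "l' = i \<oplus>\<^bsub>R\<^esub> b \<otimes>\<^bsub>R\<^esub> x"
                using mem_set_add[of l' "regular_module R" I ?X] IX by auto
              have bx: "b \<otimes>\<^bsub>R\<^esub> x \<in> ?L" "b \<otimes>\<^bsub>R\<^esub> x \<in> L'" using LD(5)[OF i(2)] L'D(5)[OF i(2)] x by blast+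
              have cl: "i \<in> carrier R" "b \<otimes>\<^bsub>R\<^esub> x \<in> carrier R" "l \<in> carrier R"
                using ID(1)[OF i(1)] L'D(1)[OF bx(2)] l(1) by blast+
              have "i = l' \<oplus>\<^bsub>R\<^esub> \<ominus>\<^bsub>R\<^esub> (b \<otimes>\<^bsub>R\<^esub> x)"
                unfolding i(3) using cl by (simp add: R.a_assoc R.r_neg)
              moreover have "\<ominus>\<^bsub>R\<^esub> (b \<otimes>\<^bsub>R\<^esub> x) \<in> L'"
              proof -
                have "(\<ominus>\<^bsub>R\<^esub> \<one>\<^bsub>R\<^esub>) \<otimes>\<^bsub>R\<^esub> (b \<otimes>\<^bsub>R\<^esub> x) \<in> L'" by (rule L'D(5)) (use bx(2) in simp_all)
                moreover have "(\<ominus>\<^bsub>R\<^esub> \<one>\<^bsub>R\<^esub>) \<otimes>\<^bsub>R\<^esub> (b \<otimes>\<^bsub>R\<^esub> x) = \<ominus>\<^bsub>R\<^esub> (\<one>\<^bsub>R\<^esub> \<otimes>\<^bsub>R\<^esub> (b \<otimes>\<^bsub>R\<^esub> x))"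
                  by (rule R.l_minus) (use cl in simp_all)
                ultimately show ?thesis using cl(2) by simp
              qed
              ultimately have "i \<in> L'" using L'D(4)[OF l(2)] by simp
              moreover have "r = (l \<oplus>\<^bsub>R\<^esub> b \<otimes>\<^bsub>R\<^esub> x) \<oplus>\<^bsub>R\<^esub> i"
                unfolding l(3) i(3) using cl by (simp add: R.a_ac)
              ultimately show "r \<in> ?L <+>\<^bsub>regular_module R\<^esub> (I \<inter> L')"
                using set_addI[OF LD(4)[OF l(1) bx(1)] IntI[OF i(1)], of L' "regular_module R"]
                by (simp only: regular_module_simps)
            qed
          qed
          with L'(3) IL' have "I \<inter> L' = L'" by blast
          with x xI show False by blast
        qed
      qed
    qed
    have h: "(\<lambda>b. b \<odot>\<^bsub>M\<^esub> u) \<in> module_hom R (regular_module R) M"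
      by (rule module_homI) (use u(1) in \<open>simp_all add: smult_l_distr smult_assoc1\<close>)
    let ?U = "(\<lambda>b. b \<odot>\<^bsub>M\<^esub> u) ` L'"
    have U: "submodule ?U R M" by (rule submodule_image[OF RegM M h L'(1)])
    let ?C = "C <+>\<^bsub>M\<^esub> ?U"
    have C': "submodule ?C R M" by (rule submodule_set_add[OF M C(1) U])
    have "?C \<inter> W \<subseteq> ?D"
    proof
      fix w assume "w \<in> ?C \<inter> W"
      then obtain c b where *: "c \<in> C" "b \<in> L'" "w = c \<oplus>\<^bsub>M\<^esub> b \<odot>\<^bsub>M\<^esub> u" "w \<in> W"
        using mem_set_add[of w M C ?U] by auto
      have cl: "c \<in> carrier M" "b \<in> carrier R" "b \<odot>\<^bsub>M\<^esub> u \<in> carrier M"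
        using CD(1)[OF *(1)] L'D(1)[OF *(2)] u(1) by simp_all
      have "b \<odot>\<^bsub>M\<^esub> u = \<ominus>\<^bsub>M\<^esub> c \<oplus>\<^bsub>M\<^esub> w" unfolding *(3) using cl by (simp add: M.r_neg1)
      also have "\<dots> \<in> ?V" by (rule VD(4)[OF subsetD[OF CV(1) CD(6)[OF *(1)]] subsetD[OF CV(2) *(4)]])
      finally have "b \<in> ?J" using LL' cl(2) *(2) by blast
      then have "b \<odot>\<^bsub>M\<^esub> u \<in> ?D" by (rule smult_mem_ideal_mult[OF _ u(1)])
      with C(2) have "b \<odot>\<^bsub>M\<^esub> u \<in> C" by blast
      from CD(4)[OF *(1) this] have "w \<in> C" unfolding *(3) .
      with *(4) C(3) show "w \<in> ?D" by blast
    qed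
    with C(4) C' subset_set_add(1)[OF M C(1) U] have eq: "?C = C" by blast
    obtain l b where lb: "l \<in> ?L" "b \<in> L'" "\<one>\<^bsub>R\<^esub> = l \<oplus>\<^bsub>R\<^esub> b"
      using mem_set_add[of "\<one>\<^bsub>R\<^esub>" "regular_module R" ?L L'] L'(2) by (simp, blast)
    have "b \<odot>\<^bsub>M\<^esub> u \<in> ?U" using lb(2) by blast
    then have bu: "b \<odot>\<^bsub>M\<^esub> u \<in> ?V" using subset_set_add(2)[OF M C(1) U] eq CV(1) by blast
    have lu: "l \<odot>\<^bsub>M\<^esub> u \<in> ?V" using lb(1) by blast
    have "u = (l \<oplus>\<^bsub>R\<^esub> b) \<odot>\<^bsub>M\<^esub> u" using lb(3) u(1) by (metis smult_one)
    also have "\<dots> = l \<odot>\<^bsub>M\<^esub> u \<oplus>\<^bsub>M\<^esub> b \<odot>\<^bsub>M\<^esub> u"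
      by (rule smult_l_distr) (use lb(1) L'D(1)[OF lb(2)] u(1) in simp_all)
    also have "\<dots> \<in> ?V" by (rule VD(4)[OF lu bu])
    finally show False using u(2) by blast
  qed
  with C(1-3) that show ?thesis by blast
qed

text \<open>The hypothesis says that \<open>K / J K\<close> embeds into \<open>M / J M\<close>.  There it is a direct summand, and the
  projection \<open>M / J M \<rightarrow> K / J K\<close> lifts to a map \<open>r\<close> from the projective module \<open>M\<close> to \<open>K\<close>.  On \<open>K\<close> the map \<open>1 - r\<close> takes values in \<open>J K\<close>, so it is nilpotent,
  so \<open>r\<close> is bijective on \<open>K\<close> and its kernel is a complement.\<close>

lemma complement_if_radical_compatible:
  fixes R :: "('r, 'x) ring_scheme" and M :: "('r, 'm) module"
  assumes art: "artinian_ring R" and pr: "projective R M" and K: "submodule K R M"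
    and compat: "K \<inter> ideal_mult R (jacobson_radical R) M (carrier M) \<subseteq> ideal_mult R (jacobson_radical R) M K"
  obtains C where "submodule C R M" "C <+>\<^bsub>M\<^esub> K = carrier M" "C \<inter> K = {\<zero>\<^bsub>M\<^esub>}"
proof -
  note M = projective_left_module[OF pr]
  interpret left_module R M by (rule M)
  let ?J = "jacobson_radical R"
  let ?D = "ideal_mult R ?J M (carrier M)" and ?p = "radical_power R M K"
  note KD = submoduleD[OF K]
  have D: "submodule ?D R M" by (rule submodule_ideal_mult[OF M jacobson_radical_subset order_refl])
  let ?W = "K <+>\<^bsub>M\<^esub> ?D"
  have W: "submodule ?W R M" by (rule submodule_set_add[OF M K D])
  have WK: "K \<subseteq> ?W" by (rule subset_set_add(1)[OF M K D])
  obtain C0 where C0: "submodule C0 R M" "?D \<subseteq> C0" "C0 \<inter> ?W \<subseteq> ?D" "C0 <+>\<^bsub>M\<^esub> ?W = carrier M"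
    by (rule complement_modulo_radical[OF art M W])
  note CD = submoduleD[OF C0(1)]
  have "K <+>\<^bsub>M\<^esub> C0 = carrier M"
  proof
    show "K <+>\<^bsub>M\<^esub> C0 \<subseteq> carrier M" using submoduleD(2)[OF submodule_set_add[OF M K C0(1)]] .
    show "carrier M \<subseteq> K <+>\<^bsub>M\<^esub> C0"
    proof
      fix x assume "x \<in> carrier M"
      then obtain c w where cw: "c \<in> C0" "w \<in> ?W" "x = c \<oplus>\<^bsub>M\<^esub> w"
        using mem_set_add[of x M C0 ?W] unfolding C0(4) by blast
      then obtain k e where ke: "k \<in> K" "e \<in> ?D" "w = k \<oplus>\<^bsub>M\<^esub> e"
        using mem_set_add[of w M K ?D] by blast
      have e: "e \<in> C0" using ke(2) C0(2) by blast
      have "x = k \<oplus>\<^bsub>M\<^esub> (c \<oplus>\<^bsub>M\<^esub> e)"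
        unfolding cw(3) ke(3) using KD(1)[OF ke(1)] CD(1)[OF cw(1)] CD(1)[OF e] by (simp add: M.a_ac)
      with ke(1) CD(4)[OF cw(1) e] show "x \<in> K <+>\<^bsub>M\<^esub> C0" unfolding mem_set_add by blast
    qed
  qed
  then obtain r where r: "r \<in> module_hom R M M" "\<And>x. x \<in> carrier M \<Longrightarrow> r x \<in> K"
    "\<And>x. x \<in> carrier M \<Longrightarrow> x \<oplus>\<^bsub>M\<^esub> \<ominus>\<^bsub>M\<^esub> r x \<in> C0"
    using projective_lift_modulo[OF pr K C0(1)] by blast
  note rD = module_homD[OF r(1)]
  define \<phi> where "\<phi> x = x \<oplus>\<^bsub>M\<^esub> \<ominus>\<^bsub>M\<^esub> r x" for x
  have \<phi>: "\<phi> \<in> module_hom R M M"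
  proof -
    have "(\<lambda>x. x) \<in> module_hom R M M" by (rule module_homI) auto
    moreover have "(\<lambda>x. \<ominus>\<^bsub>M\<^esub> r x) \<in> module_hom R M M"
      by (rule module_homI) (auto simp: rD smult_minus M.minus_add M.a_comm)
    ultimately have "(\<lambda>x. x \<oplus>\<^bsub>M\<^esub> \<ominus>\<^bsub>M\<^esub> r x) \<in> module_hom R M M" by (rule module_hom_add_fun[OF M M])
    then show ?thesis unfolding \<phi>_def .
  qed
  have \<phi>K: "\<phi> x \<in> ideal_mult R ?J M K" if x: "x \<in> K" for x
  proof -
    note xM = KD(1)[OF x]
    have "\<phi> x \<in> K" unfolding \<phi>_def by (rule KD(4)[OF x KD(6)[OF r(2)[OF xM]]])
    moreover have "\<phi> x \<in> C0" unfolding \<phi>_def by (rule r(3)[OF xM])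
    ultimately show ?thesis using C0(3) WK compat by blast
  qed
  have p: "?p i \<subseteq> K" for i
  proof (induction i)
    case (Suc i)
    have "ideal_mult R ?J M (?p i) \<subseteq> ?p i"
      by (rule ideal_mult_subset[OF jacobson_radical_subset submodule_radical_power[OF M K]])
    with Suc show ?case by simp
  qed simp
  have pM: "?p i \<subseteq> carrier M" for i using p KD(2) by blast
  have \<phi>p: "\<phi> x \<in> ?p (Suc i)" if "x \<in> ?p i" for i x
    using that
  proof (induction i arbitrary: x)
    case 0
    then show ?case using \<phi>K by simp
  next
    case (Suc i)
    have "x \<in> ideal_mult R ?J M (?p i)" using Suc.prems by simp
    from module_hom_ideal_mult[OF M M \<phi> jacobson_radical_subset pM pM Suc.IH this]
    show ?case by simp
  qed
  obtain n where n: "radical_power R (regular_module R) (carrier R) n = {\<zero>\<^bsub>R\<^esub>}"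
    by (rule jacobson_radical_nilpotent[OF art])
  have "ideal_mult R {\<zero>\<^bsub>R\<^esub>} M K \<subseteq> {\<zero>\<^bsub>M\<^esub>}"
    by (rule ideal_mult_least[OF submodule_zero]) (use KD(1) in simp)
  then have pn: "?p n \<subseteq> {\<zero>\<^bsub>M\<^esub>}" using radical_power_subset[OF M K, of n] unfolding n by blast
  let ?C = "a_kernel M M r"
  have C: "submodule ?C R M" by (rule submodule_a_kernel[OF M M r(1)])
  have inj: "x = \<zero>\<^bsub>M\<^esub>" if x: "x \<in> K" "r x = \<zero>\<^bsub>M\<^esub>" for x
  proof -
    have "\<phi> x = x" unfolding \<phi>_def x(2) using KD(1)[OF x(1)] by simp
    then have "x \<in> ?p i" for i
    proof (induction i)
      case (Suc i)
      then show ?case using \<phi>p[of x i] by simp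
    qed (simp add: x(1))
    with pn show ?thesis by blast
  qed
  have approx: "\<exists>k\<in>K. y \<oplus>\<^bsub>M\<^esub> \<ominus>\<^bsub>M\<^esub> r k \<in> ?p i" if y: "y \<in> K" for y i
  proof (induction i)
    case 0
    have "y \<oplus>\<^bsub>M\<^esub> \<ominus>\<^bsub>M\<^esub> r y \<in> K" by (rule KD(4)[OF y KD(6)[OF r(2)[OF KD(1)[OF y]]]])
    with y show ?case by auto
  next
    case (Suc i)
    then obtain k where k: "k \<in> K" "y \<oplus>\<^bsub>M\<^esub> \<ominus>\<^bsub>M\<^esub> r k \<in> ?p i" by blast
    let ?e = "y \<oplus>\<^bsub>M\<^esub> \<ominus>\<^bsub>M\<^esub> r k"
    have e: "?e \<in> K" using k(2) p by blast
    note cl = KD(1)[OF y] KD(1)[OF k(1)] KD(1)[OF e] rD(1)[OF KD(1)[OF k(1)]] rD(1)[OF KD(1)[OF e]]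
    have "r (k \<oplus>\<^bsub>M\<^esub> ?e) = r k \<oplus>\<^bsub>M\<^esub> r ?e" by (rule rD(2)[OF cl(2,3)])
    then have "y \<oplus>\<^bsub>M\<^esub> \<ominus>\<^bsub>M\<^esub> r (k \<oplus>\<^bsub>M\<^esub> ?e) = y \<oplus>\<^bsub>M\<^esub> (\<ominus>\<^bsub>M\<^esub> r k \<oplus>\<^bsub>M\<^esub> \<ominus>\<^bsub>M\<^esub> r ?e)"
      using cl by (simp only: M.minus_add)
    also have "\<dots> = \<phi> ?e" unfolding \<phi>_def using cl by (simp only: M.a_assoc M.a_inv_closed)
    finally have "y \<oplus>\<^bsub>M\<^esub> \<ominus>\<^bsub>M\<^esub> r (k \<oplus>\<^bsub>M\<^esub> ?e) = \<phi> ?e" .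
    with \<phi>p[OF k(2)] KD(4)[OF k(1) e] show ?case by metis
  qed
  have "?C <+>\<^bsub>M\<^esub> K = carrier M"
  proof
    show "?C <+>\<^bsub>M\<^esub> K \<subseteq> carrier M" using submoduleD(2)[OF submodule_set_add[OF M C K]] .
    show "carrier M \<subseteq> ?C <+>\<^bsub>M\<^esub> K"
    proof
      fix x assume x: "x \<in> carrier M"
      obtain k where k: "k \<in> K" "r x \<oplus>\<^bsub>M\<^esub> \<ominus>\<^bsub>M\<^esub> r k \<in> ?p n" using approx[OF r(2)[OF x]] by blast
      then have rk: "r x \<oplus>\<^bsub>M\<^esub> \<ominus>\<^bsub>M\<^esub> r k = \<zero>\<^bsub>M\<^esub>" using pn by blast
      note kM = KD(1)[OF k(1)]
      have "r (x \<oplus>\<^bsub>M\<^esub> \<ominus>\<^bsub>M\<^esub> k) = \<zero>\<^bsub>M\<^esub>"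
        using rD(2)[OF x M.a_inv_closed[OF kM]] module_hom_minus[OF M M r(1) kM] rk by simp
      then have "x \<oplus>\<^bsub>M\<^esub> \<ominus>\<^bsub>M\<^esub> k \<in> ?C" using x kM by (simp add: mem_a_kernel)
      moreover have "x = x \<oplus>\<^bsub>M\<^esub> \<ominus>\<^bsub>M\<^esub> k \<oplus>\<^bsub>M\<^esub> k"
        using x kM by (simp add: M.a_assoc M.l_neg)
      ultimately show "x \<in> ?C <+>\<^bsub>M\<^esub> K" unfolding mem_set_add using k(1) by blast
    qed
  qed
  moreover have "?C \<inter> K = {\<zero>\<^bsub>M\<^esub>}"
    using inj KD(3) submoduleD(3)[OF C] by (auto simp: mem_a_kernel)
  ultimately show ?thesis by (rule that[OF C])
qed

section \<open>Shortening a projective resolution\<close>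

text \<open>If the image \<open>K\<close> of the differential \<open>P (m + 1) \<rightarrow> P m\<close> has a complement \<open>C\<close>, then \<open>C\<close> can
  replace \<open>P m\<close> and everything above it can be dropped; the maps need not be changed.\<close>

lemma projective_resolution_truncate:
  fixes P :: "nat \<Rightarrow> ('r, 'p) module"
  assumes M: "left_module R M" and res: "projective_resolution R M P d e"
    and C: "submodule C R (P m)"
    and sum: "C <+>\<^bsub>P m\<^esub> d m ` carrier (P (Suc m)) = carrier (P m)"
    and int: "C \<inter> d m ` carrier (P (Suc m)) = {\<zero>\<^bsub>P m\<^esub>}"
  obtains P' where "projective_resolution R M P' d e" "\<forall>i>m. carrier (P' i) = {\<zero>\<^bsub>P' i\<^esub>}"
proof -
  have proj: "projective R (P i)" and e: "e \<in> module_hom R (P 0) M" "e ` carrier (P 0) = carrier M"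
    and d: "d i \<in> module_hom R (P (Suc i)) (P i)"
    and ex0: "d 0 ` carrier (P (Suc 0)) = a_kernel (P 0) M e"
    and exS: "d (Suc i) ` carrier (P (Suc (Suc i))) = a_kernel (P (Suc i)) (P i) (d i)" for i
    using res by (auto simp: projective_resolution_def)
  note mod = projective_left_module[OF proj]
  define U where "U i = (if i < m then carrier (P i) else if i = m then C else {\<zero>\<^bsub>P i\<^esub>})" for i
  define P' where "P' i = sub_mod (P i) (U i)" for i
  have U: "submodule (U i) R (P i)" for i
    using C left_module.submodule_carrier[OF mod] left_module.submodule_zero[OF mod]
    by (auto simp: U_def)
  note UD = submoduleD[OF U]
  have K: "submodule (d m ` carrier (P (Suc m))) R (P m)"
    by (rule submodule_image[OF mod mod d left_module.submodule_carrier[OF mod]])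
  have projU: "projective R (P' i)" for i
  proof -
    interpret Pi: left_module R "P i" by (rule mod)
    have "\<exists>p\<in>module_hom R (P i) (sub_mod (P i) (U i)). \<forall>x\<in>U i. p x = x"
    proof -
      consider "i < m" | "i = m" | "m < i" by linarith
      then show ?thesis
      proof cases
        case 1
        then show ?thesis by (intro bexI[of _ "\<lambda>x. x"]) (auto simp: U_def intro: module_homI)
      next
        case 2
        obtain p where "p \<in> module_hom R (P m) (sub_mod (P m) C)" "\<forall>x\<in>C. p x = x"
          by (rule complement_projection[OF mod C K sum int])
        with 2 show ?thesis by (auto simp: U_def)
      next
        case 3
        then show ?thesis
          by (intro bexI[of _ "\<lambda>x. \<zero>\<^bsub>P i\<^esub>"]) (auto simp: U_def intro!: module_homI)
      qed
    qed
    then show ?thesis unfolding P'_def using projective_summand[OF proj U] by blast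
  qed
  have dU: "d i x \<in> U i" if "x \<in> U (Suc i)" for i x
  proof (cases "i < m")
    case True
    then show ?thesis using module_homD(1)[OF d] UD(1)[OF that] by (simp add: U_def)
  next
    case False
    then have "x = \<zero>\<^bsub>P (Suc i)\<^esub>" using that by (simp add: U_def)
    then show ?thesis using module_hom_zero[OF mod mod d] UD(3) by simp
  qed
  have sum_image: "f ` C = f ` carrier (P m)"
    if N: "left_module R N" and f: "f \<in> module_hom R (P m) N" "\<And>y. y \<in> d m ` carrier (P (Suc m)) \<Longrightarrow> f y = \<zero>\<^bsub>N\<^esub>"
    for N :: "('r, 'q) module" and f
  proof
    show "f ` C \<subseteq> f ` carrier (P m)" using submoduleD(2)[OF C] by blast
    show "f ` carrier (P m) \<subseteq> f ` C"
    proof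
      fix z assume "z \<in> f ` carrier (P m)"
      then obtain x where x: "x \<in> carrier (P m)" "z = f x" by blast
      then obtain c k where ck: "c \<in> C" "k \<in> d m ` carrier (P (Suc m))" "x = c \<oplus>\<^bsub>P m\<^esub> k"
        using mem_set_add[of x "P m" C "d m ` carrier (P (Suc m))"] unfolding sum by blast
      note cl = submoduleD(1)[OF C ck(1)] submoduleD(1)[OF K ck(2)]
      interpret N: left_module R N by (rule N)
      have "f x = f c"
        using module_homD(2)[OF f(1) cl] f(2)[OF ck(2)] module_homD(1)[OF f(1) cl(1)] ck(3) by simp
      with x ck(1) show "z \<in> f ` C" by blast
    qed
  qed
  have img: "f ` U i = f ` carrier (P i)"
    if "i \<le> m" "left_module R N" "f \<in> module_hom R (P i) N"
      "\<And>y. y \<in> d i ` carrier (P (Suc i)) \<Longrightarrow> f y = \<zero>\<^bsub>N\<^esub>"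
    for N :: "('r, 'q) module" and f i
  proof (cases "i = m")
    case True
    with that sum_image[of N f] show ?thesis by (simp add: U_def)
  qed (use that(1) in \<open>simp add: U_def\<close>)
  have "projective_resolution R M P' d e"
    unfolding projective_resolution_def
  proof (intro conjI allI)
    show "projective R (P' i)" for i by (rule projU)
    show "e \<in> module_hom R (P' 0) M" unfolding P'_def by (rule module_hom_sub_mod_dom[OF e(1) U])
    show "d i \<in> module_hom R (P' (Suc i)) (P' i)" for i
    proof -
      note * = module_homD[OF module_hom_sub_mod_dom[OF d U]]
      show ?thesis unfolding P'_def by (rule module_homI) (use * dU in simp_all)
    qed
    have "e y = \<zero>\<^bsub>M\<^esub>" if "y \<in> d 0 ` carrier (P (Suc 0))" for y
      using that unfolding ex0 mem_a_kernel by blast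
    from img[OF _ M e(1) this] show "e ` carrier (P' 0) = carrier M"
      by (simp add: P'_def e(2))
    show "d 0 ` carrier (P' 1) = a_kernel (P' 0) M e"
    proof (cases "m = 0")
      case True
      have "a_kernel (P' 0) M e = C \<inter> a_kernel (P 0) M e"
        using True UD(1)[of _ 0] by (auto simp: mem_a_kernel P'_def U_def)
      also have "\<dots> = {\<zero>\<^bsub>P 0\<^esub>}" using int True ex0 by simp
      finally show ?thesis using True module_hom_zero[OF mod mod d] by (simp add: P'_def U_def)
    next
      case False
      have "d 0 y = \<zero>\<^bsub>P 0\<^esub>" if "y \<in> d (Suc 0) ` carrier (P (Suc (Suc 0)))" for y
        using that unfolding exS mem_a_kernel by blast
      from img[OF _ mod d this] False ex0 show ?thesis
        by (simp add: P'_def U_def a_kernel_def')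
    qed
    show "d (Suc i) ` carrier (P' (Suc (Suc i))) = a_kernel (P' (Suc i)) (P' i) (d i)" for i
    proof -
      have ker: "a_kernel (P' (Suc i)) (P' i) (d i) = U (Suc i) \<inter> a_kernel (P (Suc i)) (P i) (d i)"
        using UD(1)[of _ "Suc i"] by (auto simp: mem_a_kernel P'_def)
      show ?thesis
      proof (cases "Suc i < m")
        case True
        have "d (Suc i) y = \<zero>\<^bsub>P (Suc i)\<^esub>" if "y \<in> d (Suc (Suc i)) ` carrier (P (Suc (Suc (Suc i))))" for y
          using that unfolding exS mem_a_kernel by blast
        from img[OF _ mod d this] True
        have "d (Suc i) ` U (Suc (Suc i)) = a_kernel (P (Suc i)) (P i) (d i)" by (simp add: exS)
        then show ?thesis unfolding ker using True by (auto simp: P'_def U_def mem_a_kernel)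
      next
        case False
        then have "d (Suc i) ` carrier (P' (Suc (Suc i))) = {\<zero>\<^bsub>P (Suc i)\<^esub>}"
          using module_hom_zero[OF mod mod d] by (simp add: P'_def U_def)
        moreover have "U (Suc i) \<inter> a_kernel (P (Suc i)) (P i) (d i) = {\<zero>\<^bsub>P (Suc i)\<^esub>}"
        proof (cases "Suc i = m")
          case True
          then show ?thesis using int exS[of i] by (auto simp: U_def)
        next
          case neq: False
          then show ?thesis
            using False submoduleD(3)[OF submodule_a_kernel[OF mod mod d]] by (auto simp: U_def)
        qed
        ultimately show ?thesis unfolding ker by simp
      qed
    qed
  qed
  moreover have "\<forall>i>m. carrier (P' i) = {\<zero>\<^bsub>P' i\<^esub>}" by (simp add: P'_def U_def)
  ultimately show ?thesis by (rule that)
qed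

section \<open>Detecting the projective dimension\<close>

text \<open>An embedding of \<open>\<Lambda> / J\<close> is the same as an element with annihilator \<open>J\<close>, the image of \<open>1 + J\<close>.\<close>

lemma embeds_top_generator:
  assumes R: "ring R" and T: "left_module (opposite R) T"
    and emb: "embeds (opposite R) (quotient_module (regular_module (opposite R)) (jacobson_radical R)) T"
  obtains x where "x \<in> carrier T" "\<forall>a\<in>carrier R. a \<odot>\<^bsub>T\<^esub> x = \<zero>\<^bsub>T\<^esub> \<longleftrightarrow> a \<in> jacobson_radical R"
proof -
  interpret R: ring R by (rule R)
  interpret T: left_module "opposite R" T by (rule T)
  let ?J = "jacobson_radical R" and ?N = "regular_module (opposite R)"
  let ?Q = "quotient_module ?N ?J"
  obtain f where f: "f \<in> module_hom (opposite R) ?Q T" "inj_on f (carrier ?Q)"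
    using emb unfolding embeds_def by blast
  note fD = module_homD[OF f(1)]
  note J = submoduleD[OF submodule_jacobson_radical[OF R], simplified]
  have Jneg: "\<ominus>\<^bsub>R\<^esub> h \<in> ?J" if "h \<in> ?J" for h
    using J(5)[OF R.a_inv_closed[OF R.one_closed] that] J(1)[OF that] by (simp add: R.l_minus)
  define c where "c a = (\<lambda>h. h \<oplus>\<^bsub>R\<^esub> a) ` ?J" for a
  have coset: "?J +>\<^bsub>?N\<^esub> a = c a" for a
    by (auto simp: a_r_coset_def' c_def)
  have shift: "c (h \<oplus>\<^bsub>R\<^esub> a) = c a" if h: "h \<in> ?J" and a: "a \<in> carrier R" for h a
  proof
    show "c (h \<oplus>\<^bsub>R\<^esub> a) \<subseteq> c a"
    proof
      fix y assume "y \<in> c (h \<oplus>\<^bsub>R\<^esub> a)"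
      then obtain h' where h': "h' \<in> ?J" "y = h' \<oplus>\<^bsub>R\<^esub> (h \<oplus>\<^bsub>R\<^esub> a)" by (auto simp: c_def)
      then have "y = (h' \<oplus>\<^bsub>R\<^esub> h) \<oplus>\<^bsub>R\<^esub> a" using J(1) h a by (simp add: R.a_assoc)
      with J(4)[OF h'(1) h] show "y \<in> c a" by (auto simp: c_def)
    qed
    show "c a \<subseteq> c (h \<oplus>\<^bsub>R\<^esub> a)"
    proof
      fix y assume "y \<in> c a"
      then obtain h' where h': "h' \<in> ?J" "y = h' \<oplus>\<^bsub>R\<^esub> a" by (auto simp: c_def)
      then have "y = (h' \<oplus>\<^bsub>R\<^esub> \<ominus>\<^bsub>R\<^esub> h) \<oplus>\<^bsub>R\<^esub> (h \<oplus>\<^bsub>R\<^esub> a)" using J(1) h a by (simp add: R.a_assoc R.r_neg1)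
      with J(4)[OF h'(1) Jneg[OF h]] show "y \<in> c (h \<oplus>\<^bsub>R\<^esub> a)" by (auto simp: c_def)
    qed
  qed
  have cJ: "c a = ?J \<longleftrightarrow> a \<in> ?J" if a: "a \<in> carrier R" for a
  proof
    assume "c a = ?J"
    moreover have "\<zero>\<^bsub>R\<^esub> \<oplus>\<^bsub>R\<^esub> a \<in> c a" unfolding c_def using J(3) by blast
    ultimately show "a \<in> ?J" using a by simp
  next
    assume "a \<in> ?J"
    then have "c a = c \<zero>\<^bsub>R\<^esub>" using shift[of a "\<zero>\<^bsub>R\<^esub>"] a by simp
    also have "\<dots> = ?J" unfolding c_def using J(1) by (force simp: image_iff)
    finally show "c a = ?J" .
  qed
  have cQ: "c a \<in> carrier ?Q" if "a \<in> carrier R" for a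
    using that by (auto simp: quotient_module_def A_RCOSETS_def' coset)
  have smult: "a \<odot>\<^bsub>?Q\<^esub> c \<one>\<^bsub>R\<^esub> = c a" if a: "a \<in> carrier R" for a
  proof -
    have "c ((h \<oplus>\<^bsub>R\<^esub> \<one>\<^bsub>R\<^esub>) \<otimes>\<^bsub>R\<^esub> a) = c a" if h: "h \<in> ?J" for h
      using shift[OF jacobson_radical_right_mult[OF R h a] a] J(1)[OF h] a by (simp add: R.l_distr)
    then have "(\<Union>h\<in>?J. c ((h \<oplus>\<^bsub>R\<^esub> \<one>\<^bsub>R\<^esub>) \<otimes>\<^bsub>R\<^esub> a)) = c a" using J(3) by blast
    moreover have "a \<odot>\<^bsub>?Q\<^esub> c \<one>\<^bsub>R\<^esub> = (\<Union>h\<in>?J. c ((h \<oplus>\<^bsub>R\<^esub> \<one>\<^bsub>R\<^esub>) \<otimes>\<^bsub>R\<^esub> a))"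
      by (simp add: quotient_module_def coset c_def[of "\<one>\<^bsub>R\<^esub>"])
    ultimately show ?thesis by simp
  qed
  have JQ: "?J \<in> carrier ?Q" using cQ[of "\<zero>\<^bsub>R\<^esub>"] cJ[of "\<zero>\<^bsub>R\<^esub>"] J(3) by simp
  have "?J \<oplus>\<^bsub>?Q\<^esub> ?J = ?J"
  proof -
    have "?J <+>\<^bsub>?N\<^esub> ?J = ?J"
    proof
      show "?J <+>\<^bsub>?N\<^esub> ?J \<subseteq> ?J" using J(4) by (auto simp: mem_set_add)
      show "?J \<subseteq> ?J <+>\<^bsub>?N\<^esub> ?J"
      proof
        fix h assume h: "h \<in> ?J"
        then have "h = h \<oplus>\<^bsub>R\<^esub> \<zero>\<^bsub>R\<^esub>" using J(1) by simp
        with h J(3) show "h \<in> ?J <+>\<^bsub>?N\<^esub> ?J" by (auto simp: mem_set_add)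
      qed
    qed
    then show ?thesis by (simp add: quotient_module_def)
  qed
  then have "f ?J = f ?J \<oplus>\<^bsub>T\<^esub> f ?J" using fD(2)[OF JQ JQ] by simp
  then have fJ: "f ?J = \<zero>\<^bsub>T\<^esub>" using T.M.add.l_cancel_one'[of "f ?J" "f ?J"] fD(1)[OF JQ] by simp
  show ?thesis
  proof (rule that[of "f (c \<one>\<^bsub>R\<^esub>)"])
    show "f (c \<one>\<^bsub>R\<^esub>) \<in> carrier T" by (rule fD(1)[OF cQ]) simp
    show "\<forall>a\<in>carrier R. a \<odot>\<^bsub>T\<^esub> f (c \<one>\<^bsub>R\<^esub>) = \<zero>\<^bsub>T\<^esub> \<longleftrightarrow> a \<in> ?J"
    proof
      fix a assume a: "a \<in> carrier R"
      have "a \<odot>\<^bsub>T\<^esub> f (c \<one>\<^bsub>R\<^esub>) = f (c a)"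
        using fD(3)[of a "c \<one>\<^bsub>R\<^esub>"] cQ[of "\<one>\<^bsub>R\<^esub>"] smult[OF a] a by simp
      also have "f (c a) = \<zero>\<^bsub>T\<^esub> \<longleftrightarrow> c a = ?J"
        using fJ inj_onD[OF f(2) _ cQ[OF a] JQ] by metis
      finally show "a \<odot>\<^bsub>T\<^esub> f (c \<one>\<^bsub>R\<^esub>) = \<zero>\<^bsub>T\<^esub> \<longleftrightarrow> a \<in> ?J" using cJ[OF a] by simp
    qed
  qed
qed

context acyclic_complex
begin

lemma tor_vanishes_beyond:
  assumes "left_module (opposite R) X" "carrier (P (Suc k)) = {\<zero>\<^bsub>P (Suc k)\<^esub>}"
  shows "tor_vanishes R P d k X"
  unfolding tor_vanishes_def
proof (intro ballI impI)
  fix t assume t: "t \<in> tensors X (P (Suc k))"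
  have "tensor_eq R (P (Suc k)) X t (boundary d (Suc k) [])"
  proof (rule tensor_eqI)
    fix f assume "f \<in> linear_forms R (P (Suc k))"
    then have "pairing X f t = \<zero>\<^bsub>X\<^esub>"
      using assms(2) form_zero by (intro pairing_zero_form[OF assms(1) _ t]) auto
    then show "pairing X f t = pairing X f (boundary d (Suc k) [])" by simp
  qed
  then show "\<exists>u\<in>tensors X (P (Suc (Suc k))). tensor_eq R (P (Suc k)) X t (boundary d (Suc k) u)"
    by (intro bexI[of _ "[]"]) simp_all
qed

text \<open>The element \<open>x \<otimes> p\<close> with \<open>d p \<in> J P m\<close> is a cycle in the top degree \<open>m + 1\<close>, hence zero, and this
  means \<open>p \<in> J P (m + 1)\<close>.\<close>

lemma radical_compatible_if_tor_vanishes: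
  assumes T: "left_module (opposite R) T" and x: "x \<in> carrier T"
    and ann: "\<forall>a\<in>carrier R. a \<odot>\<^bsub>T\<^esub> x = \<zero>\<^bsub>T\<^esub> \<longleftrightarrow> a \<in> jacobson_radical R"
    and top: "carrier (P (Suc (Suc m))) = {\<zero>\<^bsub>P (Suc (Suc m))\<^esub>}"
    and tor: "tor_vanishes R P d m T"
  shows "d m ` carrier (P (Suc m)) \<inter> ideal_mult R (jacobson_radical R) (P m) (carrier (P m))
    \<subseteq> ideal_mult R (jacobson_radical R) (P m) (d m ` carrier (P (Suc m)))"
proof
  let ?J = "jacobson_radical R"
  interpret T: left_module "opposite R" T by (rule T)
  interpret P1: left_module R "P (Suc m)" by (rule module)
  note RegM = left_module_regular[OF ring]
  fix y assume "y \<in> d m ` carrier (P (Suc m)) \<inter> ideal_mult R ?J (P m) (carrier (P m))"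
  then obtain p where p: "p \<in> carrier (P (Suc m))" "y = d m p"
    and y: "d m p \<in> ideal_mult R ?J (P m) (carrier (P m))" by blast
  have Jsub: "submodule ?J R (regular_module R)" by (rule submodule_jacobson_radical[OF ring])
  have t: "[(x, p)] \<in> tensors T (P (Suc m))" using x p(1) by simp
  have "tensor_eq R (P m) T (boundary d m [(x, p)]) []"
  proof (rule tensor_eqI)
    fix f assume f: "f \<in> linear_forms R (P m)"
    have "f (d m p) \<in> ideal_mult R ?J (regular_module R) (carrier R)"
      by (rule module_hom_ideal_mult[OF module RegM f jacobson_radical_subset order_refl _ _ y])
        (use linear_form_closed[OF f] in simp_all)
    moreover have "ideal_mult R ?J (regular_module R) (carrier R) \<subseteq> ?J"
      by (rule ideal_mult_least[OF Jsub]) (simp add: jacobson_radical_right_mult[OF ring])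
    ultimately have "f (d m p) \<in> ?J" by blast
    then have "f (d m p) \<odot>\<^bsub>T\<^esub> x = \<zero>\<^bsub>T\<^esub>" using ann jacobson_radical_subset[of R] by blast
    then show "pairing T f (boundary d m [(x, p)]) = pairing T f []" by simp
  qed
  from tor_vanishesD[OF tor t this] obtain u where u: "u \<in> tensors T (P (Suc (Suc m)))"
    "tensor_eq R (P (Suc m)) T [(x, p)] (boundary d (Suc m) u)" by blast
  have fJ: "f p \<in> ?J" if f: "f \<in> linear_forms R (P (Suc m))" for f
  proof -
    have "pairing T (\<lambda>p. f (d (Suc m) p)) u = \<zero>\<^bsub>T\<^esub>"
      by (rule pairing_zero_form[OF T _ u(1)]) (use top form_zero[OF form_comp[OF f]] in simp)
    then have "f p \<odot>\<^bsub>T\<^esub> x = \<zero>\<^bsub>T\<^esub>"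
      using tensor_eqD[OF u(2) f] T.smult_closed[of "f p" x] linear_form_closed[OF f p(1)] x by simp
    then show ?thesis using ann linear_form_closed[OF f p(1)] by blast
  qed
  obtain s where s: "\<forall>q. s q \<in> linear_forms R (P (Suc m))"
    "\<forall>S. finite S \<and> S \<subseteq> carrier (P (Suc m)) \<longrightarrow> (\<exists>bs. set bs \<subseteq> carrier (P (Suc m)) \<and>
      (\<forall>p\<in>S. lsum (P (Suc m)) (map (\<lambda>q. s q p \<odot>\<^bsub>P (Suc m)\<^esub> q) bs) = p))"
    by (rule projective_dual_basis[OF projective])
  have "finite {p} \<and> {p} \<subseteq> carrier (P (Suc m))" using p(1) by simp
  from mp[OF spec[OF s(2)] this] obtain bs where bs: "set bs \<subseteq> carrier (P (Suc m))"
    "lsum (P (Suc m)) (map (\<lambda>q. s q p \<odot>\<^bsub>P (Suc m)\<^esub> q) bs) = p" by blast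
  have "lsum (P (Suc m)) (map (\<lambda>q. s q p \<odot>\<^bsub>P (Suc m)\<^esub> q) bs)
      \<in> ideal_mult R ?J (P (Suc m)) (carrier (P (Suc m)))"
  proof (rule lsum_mem[OF submodule_ideal_mult[OF module jacobson_radical_subset order_refl]])
    have "s q p \<odot>\<^bsub>P (Suc m)\<^esub> q \<in> ideal_mult R ?J (P (Suc m)) (carrier (P (Suc m)))"
      if "q \<in> set bs" for q
      by (rule smult_mem_ideal_mult[OF fJ[OF spec[OF s(1)]] subsetD[OF bs(1) that]])
    then show "set (map (\<lambda>q. s q p \<odot>\<^bsub>P (Suc m)\<^esub> q) bs)
        \<subseteq> ideal_mult R ?J (P (Suc m)) (carrier (P (Suc m)))" by auto
  qed
  then have pJ: "p \<in> ideal_mult R ?J (P (Suc m)) (carrier (P (Suc m)))" unfolding bs(2) .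
  have sub: "d m ` carrier (P (Suc m)) \<subseteq> carrier (P m)" using closed by (rule image_subsetI)
  show "y \<in> ideal_mult R ?J (P m) (d m ` carrier (P (Suc m)))"
    unfolding p(2)
    by (rule module_hom_ideal_mult[OF module module hom jacobson_radical_subset order_refl sub _ pJ])
      (rule imageI)
qed

end

text \<open>The heart of the argument.  For a resolution of length \<open>m + 1 > n\<close> the module \<open>T\<close> has no \<open>Tor\<close> in
  the top degree: this is the \<open>Tor\<close> of the syzygy \<open>K\<close> in the positive degree \<open>m + 1 - n\<close>, hence of
  the summands of \<open>K\<close>; the projective summand contributes nothing, and every other one is also a
  summand of a syzygy so late that its \<open>Tor\<close> is a \<open>Tor\<close> of \<open>T\<close> beyond the end of the resolution.
  As \<open>T\<close> contains \<open>\<Lambda> / J\<close>, this makes the last differential split, and the resolution can be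
  shortened.\<close>

lemma repetitive_bounds_resolution:
  fixes R :: "('r, 'x) ring_scheme" and T :: "('r, 't) module" and M :: "('r, 'm) module"
    and P :: "nat \<Rightarrow> ('r, 'p) module"
  assumes art: "artinian_ring R" and T: "right_module R T"
    and emb: "embeds (opposite R)
           (quotient_module (regular_module (opposite R)) (jacobson_radical R)) T"
    and rep: "repetitive_at (opposite R) T n" and M: "left_module R M"
    and res: "projective_resolution R M P d e" and len: "\<forall>i>Suc m. carrier (P i) = {\<zero>\<^bsub>P i\<^esub>}"
    and "n \<le> m"
  obtains P' where "projective_resolution R M P' d e" "\<forall>i>m. carrier (P' i) = {\<zero>\<^bsub>P' i\<^esub>}"
proof -
  have R: "ring R" using art by (simp add: artinian_ring_def)
  interpret acyclic_complex R P d
    using res by unfold_locales (simp_all add: projective_resolution_def)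
  obtain K :: "('r, ('r, 't) res) module" and Q and I :: "('r, 't) res set" and A where
    K: "syzygy (opposite R) T n K"
    and sum: "internal_direct_sum (opposite R) K (insert None (Some ` I)) (case_option Q A)"
    and Q: "projective (opposite R) (sub_mod K Q)"
    and A: "\<forall>i\<in>I. infinite {j. \<exists>L. syzygy (opposite R) T j L \<and>
      iso_to_direct_summand (opposite R) (sub_mod K (A i)) L}"
    using rep unfolding repetitive_at_def by blast
  have KM: "left_module (opposite R) K"
    and torK: "tor_vanishes R P d (m - n) K \<longleftrightarrow> tor_vanishes R P d m T"
    using tor_vanishes_syzygy[OF T K] \<open>n \<le> m\<close> by simp_all
  have "tor_vanishes R P d (m - n) K"
  proof (rule tor_vanishes_direct_sum[OF KM sum])
    fix j assume "j \<in> insert None (Some ` I)"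
    then consider "j = None" | i where "i \<in> I" "j = Some i" by blast
    then show "tor_vanishes R P d (m - n) (sub_mod K (case_option Q A j))"
    proof cases
      case 1
      then show ?thesis using tor_vanishes_projective[OF Q] by simp
    next
      case 2
      have "submodule (A i) (opposite R) K"
        using sum 2(1) by (force simp: internal_direct_sum_def)
      then have Ai: "left_module (opposite R) (sub_mod K (A i))" by (rule left_module_sub_mod[OF KM])
      let ?S = "{j. \<exists>L. syzygy (opposite R) T j L \<and>
        iso_to_direct_summand (opposite R) (sub_mod K (A i)) L}"
      have "\<not> ?S \<subseteq> {..n}" using A 2(1) finite_subset by blast
      then obtain l where "l \<in> ?S" "\<not> l \<le> n" by blast
      then obtain L where l: "n < l" "syzygy (opposite R) T l L"
        "iso_to_direct_summand (opposite R) (sub_mod K (A i)) L" by auto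
      have "carrier (P (Suc (m - n + l))) = {\<zero>\<^bsub>P (Suc (m - n + l))\<^esub>}"
        using len l(1) \<open>n \<le> m\<close> by simp
      then have "tor_vanishes R P d (m - n + l) T" by (rule tor_vanishes_beyond[OF T])
      with tor_vanishes_syzygy[OF T l(2)]
      have "left_module (opposite R) L" "tor_vanishes R P d (m - n) L" by simp_all
      then have "tor_vanishes R P d (m - n) (sub_mod K (A i))"
        by (rule tor_vanishes_summand[OF Ai _ l(3)])
      with 2 show ?thesis by simp
    qed
  qed
  then have tor: "tor_vanishes R P d m T" using torK by blast
  obtain x where x: "x \<in> carrier T" "\<forall>a\<in>carrier R. a \<odot>\<^bsub>T\<^esub> x = \<zero>\<^bsub>T\<^esub> \<longleftrightarrow> a \<in> jacobson_radical R"
    by (rule embeds_top_generator[OF R T emb])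
  have "carrier (P (Suc (Suc m))) = {\<zero>\<^bsub>P (Suc (Suc m))\<^esub>}" using len by simp
  note compat = radical_compatible_if_tor_vanishes[OF T x this tor]
  have sub: "submodule (d m ` carrier (P (Suc m))) R (P m)"
    by (rule submodule_image[OF module module hom left_module.submodule_carrier[OF module]])
  obtain C where "submodule C R (P m)" "C <+>\<^bsub>P m\<^esub> d m ` carrier (P (Suc m)) = carrier (P m)"
    "C \<inter> d m ` carrier (P (Suc m)) = {\<zero>\<^bsub>P m\<^esub>}"
    by (rule complement_if_radical_compatible[OF art projective sub compat])
  then show ?thesis using projective_resolution_truncate[OF M res] that by blast
qed

theorem mainTheorem2:
  fixes R :: "('r, 'x) ring_scheme" and T :: "('r, 't) module"
  assumes "artinian_ring R"
    and "right_module R T"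
    and "embeds (opposite R)
           (quotient_module (regular_module (opposite R)) (jacobson_radical R)) T"
  shows "l_Fin_dim TYPE('m) R \<le> rep_index (opposite R) T"
proof -
  have "proj_dim R M \<le> enat n"
    if rep: "repetitive_at (opposite R) T n" and M: "left_module R M" and fin: "proj_dim R M \<noteq> \<infinity>"
    for n and M :: "('r, 'm) module"
  proof (rule ccontr)
    let ?S = "{enat n | n. \<exists>(P :: nat \<Rightarrow> ('r, ('r, 'm) res) module) d e.
      projective_resolution R M P d e \<and> (\<forall>i>n. carrier (P i) = {\<zero>\<^bsub>P i\<^esub>})}"
    assume "\<not> proj_dim R M \<le> enat n"
    then have less: "enat n < proj_dim R M" by simp
    have S: "proj_dim R M = Inf ?S" by (simp only: proj_dim_def)
    have "?S \<noteq> {}"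
    proof
      assume "?S = {}"
      then have "proj_dim R M = \<infinity>" unfolding S by (simp only: Inf_empty top_enat_def)
      with fin show False by contradiction
    qed
    then obtain s where "s \<in> ?S" by blast
    then have "proj_dim R M \<in> ?S" unfolding S by (rule wellorder_InfI)
    then obtain k P d e where k: "proj_dim R M = enat k"
      and res: "projective_resolution R M (P :: nat \<Rightarrow> ('r, ('r, 'm) res) module) d e"
      and len: "\<forall>i>k. carrier (P i) = {\<zero>\<^bsub>P i\<^esub>}" by blast
    from less k obtain m where m: "k = Suc m" "n \<le> m" by (cases k) auto
    obtain P' where "projective_resolution R M P' d e" "\<forall>i>m. carrier (P' i) = {\<zero>\<^bsub>P' i\<^esub>}"
      by (rule repetitive_bounds_resolution[OF assms rep M res len[unfolded m(1)] m(2)])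
    then have "enat m \<in> ?S" by blast
    then have "proj_dim R M \<le> enat m" unfolding proj_dim_def by (rule Inf_lower)
    with k m(1) show False by simp
  qed
  then show ?thesis
    unfolding l_Fin_dim_def rep_index_def by (intro Sup_least Inf_greatest) blast
qed

end
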